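(* Let $\mathcal R$ be a tame set of equality generators, let $(S,P,T)$ be an insertion point, let $n=\mathrm{lh}(P)$, and let $A$ be the type of the variable $\lfloor P\rfloor$ in $\lfloor S\rfloor$. Then the square formed by $\{A,\lfloor P\rfloor\}: D^n\to S$, $\{\mathcal U_T^{n},\mathcal C_T^{n}\}: D^n\to T$, $\kappa_{S,P,T}: S\to S\ll_P T$ and $\iota_{S,P,T}: T\to S\ll_P T$ is a pushout square in the category $\mathsf{Catt}_{\mathcal R}$; that is, it commutes in $\mathsf{Catt}_{\mathcal R}$ and $S\ll_P T$ with $\kappa_{S,P,T},\iota_{S,P,T}$ is the pushout of $S\leftarrow D^n\to T$.
   Context: **Syntax.** Contexts, types, terms and substitutions are raw syntax up to renaming of variables; $\equiv$ is syntactic equality. A context is a list $x_1:A_1,\dots,x_k:A_k$ with $A_i$ a type over the preceding part. Types over $\Gamma$: $\star$, or $s\to_A t$ with $A$ a type and $s,t$ terms over $\Gamma$. Terms over $\Gamma$: variables of $\Gamma$, or $\mathsf{coh}(\Delta:A)[\sigma]$ with $\Delta$ a context, $A$ a type over $\Delta$, $\sigma:\Delta\to\Gamma$ a substitution. A substitution $\sigma:\Delta\to\Gamma$ assigns to each variable of $\Delta$ a term over $\Gamma$. Application $t[\![\sigma]\!]$, $A[\![\sigma]\!]$: variables are replaced, $\star[\![\sigma]\!]=\star$, $(s\to_A t)[\![\sigma]\!]=s[\![\sigma]\!]\to_{A[\![\sigma]\!]}t[\![\sigma]\!]$, $\mathsf{coh}(\Theta:A)[\tau][\![\sigma]\!]=\mathsf{coh}(\Theta:A)[\tau\circ\sigma]$,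 where for $\tau:\Theta\to\Delta$, $\sigma:\Delta\to\Gamma$ the composite $\tau\circ\sigma:\Theta\to\Gamma$ sends $x$ to $x[\![\tau]\!][\![\sigma]\!]$. $\dim(\star)=0$, $\dim(s\to_A t)=1+\dim A$; the dimension of a variable is that of its type; $\dim(\mathsf{coh}(\Delta:A)[\sigma])=\dim A$; $\dim\Gamma$ is the maximal dimension of its types. The support $\mathrm{supp}$ of a term, type or substitution over $\Gamma$ is its set of free variables in $\Gamma$ closed downwards (if $x:A$ in $\Gamma$ is included, so are the variables of $A$). **Trees.** A tree is a (possibly empty) finite list of trees $T=[T_1,\dots,T_n]$. $T^{[\,]}=T$, $T^{k::P}=(T_k)^P$. $\dim([\,])=0$, $\dim([T_1,\dots,T_n])=1+\max_k\dim T_k$. Trunk height: $\mathrm{th}([T_1])=1+\mathrm{th}(T_1)$, and $\mathrm{th}(T)=0$ if $T$ is not a one-element list. $T$ is linear if $\mathrm{th}(T)=\dim(T)$. Suspension $\Sigma$: $\Sigma\Gamma$ has new variables $N:\star,S:\star$ followed by $x:\Sigma A$ for each $x:A$ in $\Gamma$; $\Sigma\star=N\to_\star S$, $\Sigma(s\to_A t)=\Sigma s\to_{\Sigma A}\Sigma t$, $\Sigma x=x$, $\Sigma(\mathsf{coh}(\Delta:A)[\sigma])=\mathsf{coh}(\Sigma\Delta:\Sigma A)[\Sigma\sigma]$, and $\Sigma\sigma$ sends $N\mapsto N$, $S\mapsto S$, $x\mapsto\Sigma(x[\![\sigma]\!])$. Wedge $\Gamma\vee\Delta$: identify the last variable of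 type $\star$ of $\Gamma$ with the first variable of $\Delta$ (of type $\star$); substitutions preserving these points can be wedged. $\lfloor[\,]\rfloor$ is the context with one variable of type $\star$, and $\lfloor[T_1,\dots,T_n]\rfloor=\Sigma\lfloor T_1\rfloor\vee\dots\vee\Sigma\lfloor T_n\rfloor$. We write $T$ for $\lfloor T\rfloor$. A pasting context ($\Delta\vdash_p$) is a context of the form $\lfloor T\rfloor$. $D^n$ is the linear tree of dimension $n$; its context has a single $n$-dimensional variable $d_n$ and variables $d_k^-,d_k^+$ for $k<n$, with $d_0^\pm:\star$, $d_k^{\pm}:d_{k-1}^-\to d_{k-1}^+$ (and $d_n:d_{n-1}^-\to d_{n-1}^+$). For a type $A$ of dimension $n$ and a term $t$ over $\Gamma$, $\{A,t\}:D^n\to\Gamma$ sends $d_n\mapsto t$ and the $d_k^-,d_k^+$ to the successive sources and targets in $A$. Boundaries: $\partial_0T=[\,]$, $\partial_{n+1}[T_1,\dots,T_k]=[\partial_nT_1,\dots,\partial_nT_k]$; inclusions $\delta^{\epsilon,n}_T:\partial_nT\to T$ ($\epsilon\in\{-,+\}$): $\delta^{-,0}$ (resp. $\delta^{+,0}$) picks the first (resp. last) variable of type $\star$, and $\delta^{\epsilon,n+1}_T=\bigvee_i\Sigma\delta^{\epsilon,n}_{T_i}$. **Standard constructions** for a pasting context $\Delta$: $\mathcal C^n_\Delta=\mathsf{coh}(\Delta:\mathcal U^n_\Delta)[\mathrm{id}]$; $\mathcal T^n_\Delta=d_n$ if $\Delta=D^n$, otherwise $\mathcal T^n_\Delta=\mathcal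 C^n_\Delta$; $\mathcal U^0_\Delta=\star$; $\mathcal U^{n+1}_\Delta=\mathcal T^n_{\partial_n\Delta}[\![\delta^{-,n}_\Delta]\!]\to_{\mathcal U^n_\Delta}\mathcal T^n_{\partial_n\Delta}[\![\delta^{+,n}_\Delta]\!]$. **Typing and equality in $\mathsf{Catt}_{\mathcal R}$.** A set $\mathcal R$ of equality generators is a set of triples $(\Gamma,s,t)$ with $s,t$ terms over $\Gamma$. Typing and equality judgements are generated mutually. Typing: $\emptyset\vdash$; $\Gamma,(x:A)\vdash$ if $\Gamma\vdash$ and $\Gamma\vdash A$; $\Gamma\vdash\star$; $\Gamma\vdash s\to_At$ if $\Gamma\vdash A$, $\Gamma\vdash s:A$, $\Gamma\vdash t:A$; $\Gamma\vdash x:A$ if $\Gamma\vdash$ and $(x:A)\in\Gamma$; $\Delta\vdash\langle\rangle:\emptyset$; $\Delta\vdash\langle\sigma,x\mapsto t\rangle:(\Gamma,x:A)$ if $\Delta\vdash\sigma:\Gamma$, $\Gamma\vdash A$, $\Delta\vdash t:A[\![\sigma]\!]$; $\Gamma\vdash\mathsf{coh}(\Delta:s\to_At)[\sigma]:(s\to_At)[\![\sigma]\!]$ if $\Delta\vdash_p$, $\Delta\vdash s\to_At$, $\Gamma\vdash\sigma:\Delta$ and either $\mathrm{supp}(s)=\mathrm{supp}(\delta^{-,\dim\Delta-1}_\Delta)$ and $\mathrm{supp}(t)=\mathrm{supp}(\delta^{+,\dim\Delta-1}_\Delta)$, or $\mathrm{supp}(s)=\mathrm{supp}(t)=\Delta$;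 and conversion: $\Gamma\vdash s:B$ if $\Gamma\vdash s:A$ and $\Gamma\vdash A=B$. Equality (of terms, types, substitutions over $\Gamma$) is the equivalence relation generated by the congruence rules for all constructors (for coherences: $\Delta\vdash A=B$ and $\Gamma\vdash\sigma=\tau$ give $\Gamma\vdash\mathsf{coh}(\Delta:A)[\sigma]=\mathsf{coh}(\Delta:B)[\tau]$) together with: if $(\Gamma,s,t)\in\mathcal R$ and $\Gamma\vdash s:A$ for some $A$, then $\Gamma\vdash s=t$. $\mathcal R$ is *tame* if for every $(\Gamma,s,t)\in\mathcal R$: $((\Gamma,x:A),s,t)\in\mathcal R$ for all types $A$ over $\Gamma$; $(\Delta,s[\![\sigma]\!],t[\![\sigma]\!])\in\mathcal R$ whenever $\Delta\vdash\sigma:\Gamma$; and $(\Sigma\Gamma,\Sigma s,\Sigma t)\in\mathcal R$. For tame $\mathcal R$, $\mathsf{Catt}_{\mathcal R}$ also denotes the category whose objects are contexts $\Gamma$ with $\Gamma\vdash$ and whose morphisms $\Delta\to\Gamma$ are substitutions $\sigma:\Delta\to\Gamma$ with $\Gamma\vdash\sigma:\Delta$, modulo $\Gamma\vdash\sigma=\tau$. **Insertion.** A branch $P$ of a tree $S$ is a non-empty index list such that the subtree $S^P$ is linear; $\lfloor P\rfloor$ is the variable of $\lfloor S\rfloor$ given by the unique locally maximal (top-dimensional) variable of $\lfloor S^P\rfloor$. Branch height $\mathrm{bh}(P)=\mathrm{length}(P)-1$; leaf height $\mathrm{lh}(P)=\dim\lfloor P\rfloor$. An insertion point is a triple $(S,P,T)$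 with $S,T$ trees and $P$ a branch of $S$ with $\mathrm{bh}(P)\le\mathrm{th}(T)$ and $\mathrm{lh}(P)\ge\dim(T)$. With $S=[S_1,\dots,S_n]$: if $P=[k]$, then $S\ll_PT=[S_1,\dots,S_{k-1}]\mathbin{+\!+}T\mathbin{+\!+}[S_{k+1},\dots,S_n]$ (list concatenation); if $P=k::P'$ with $P'$ non-empty then $T=[T_1]$ and $S\ll_PT=[S_1,\dots,S_{k-1},\,S_k\ll_{P'}T_1,\,S_{k+1},\dots,S_n]$. Interior substitution $\iota_{S,P,T}:T\to S\ll_PT$: for $P=[k]$ the inclusion of the wedge factor $\lfloor T\rfloor$; for $P=k::P'$, $\Sigma\iota_{S_k,P',T_1}$ followed by the inclusion of the wedge factor $\Sigma\lfloor S_k\ll_{P'}T_1\rfloor$. Exterior substitution $\kappa_{S,P,T}:S\to S\ll_PT$: the wedge of identities on $[S_1,\dots,S_{k-1}]$ and $[S_{k+1},\dots,S_n]$ with, on the factor $\Sigma S_k$, the substitution $\{\mathcal U^{\mathrm{lh}(P)}_T,\mathcal C^{\mathrm{lh}(P)}_T\}:\Sigma S_k\to T$ if $P=[k]$ (here $\Sigma\lfloor S_k\rfloor=D^{\mathrm{lh}(P)}$), and $\Sigma\kappa_{S_k,P',T_1}$ if $P=k::P'$. *)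

theory Defs
  imports Main
begin

section \<open>Raw syntax\<close>

text \<open>
  Variables are de Bruijn levels: the variable \<open>i\<close> of a context \<open>\<Gamma>\<close> is the one declared by the
  entry \<open>\<Gamma> ! i\<close>. Contexts inside coherences bind their own variables, so syntactic equality is
  equality up to renaming, and weakening leaves types and terms unchanged. A substitution out of
  \<open>\<Delta>\<close> lists the images of the variables of \<open>\<Delta>\<close> in order.
\<close>

datatype ty = Star | Arr tm ty tm
     and tm = Var nat | Coh "ty list" ty "tm list"

type_synonym ctx = "ty list"
type_synonym sub = "tm list"

inductive is_ctx :: "ctx \<Rightarrow> bool"
      and is_ty :: "ctx \<Rightarrow> ty \<Rightarrow> bool"
      and is_tm :: "ctx \<Rightarrow> tm \<Rightarrow> bool"
      and is_sub :: "ctx \<Rightarrow> ctx \<Rightarrow> sub \<Rightarrow> bool"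
  where
  is_ctx_empty: "is_ctx []"
| is_ctx_ext: "is_ty \<Gamma> A \<Longrightarrow> is_ctx (\<Gamma> @ [A])"
| is_ty_Star: "is_ctx \<Gamma> \<Longrightarrow> is_ty \<Gamma> Star"
| is_ty_Arr: "is_tm \<Gamma> s \<Longrightarrow> is_ty \<Gamma> A \<Longrightarrow> is_tm \<Gamma> t \<Longrightarrow> is_ty \<Gamma> (Arr s A t)"
| is_tm_Var: "is_ctx \<Gamma> \<Longrightarrow> i < length \<Gamma> \<Longrightarrow> is_tm \<Gamma> (Var i)"
| is_tm_Coh: "is_ty \<Delta> A \<Longrightarrow> is_sub \<Delta> \<Gamma> \<sigma> \<Longrightarrow> is_tm \<Gamma> (Coh \<Delta> A \<sigma>)"
| is_sub_empty: "is_ctx \<Gamma> \<Longrightarrow> is_sub [] \<Gamma> []"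
| is_sub_ext: "is_sub \<Delta> \<Gamma> \<sigma> \<Longrightarrow> is_ty \<Delta> A \<Longrightarrow> is_tm \<Gamma> t \<Longrightarrow> is_sub (\<Delta> @ [A]) \<Gamma> (\<sigma> @ [t])"

fun subst_ty :: "ty \<Rightarrow> sub \<Rightarrow> ty" and subst_tm :: "tm \<Rightarrow> sub \<Rightarrow> tm" where
  "subst_ty Star \<sigma> = Star"
| "subst_ty (Arr s A t) \<sigma> = Arr (subst_tm s \<sigma>) (subst_ty A \<sigma>) (subst_tm t \<sigma>)"
| "subst_tm (Var i) \<sigma> = \<sigma> ! i"
| "subst_tm (Coh \<Theta> A \<tau>) \<sigma> = Coh \<Theta> A (map (\<lambda>t. subst_tm t \<sigma>) \<tau>)"

text \<open>Composition is written in diagrammatic order: \<open>\<tau>\<close> first, then \<open>\<sigma>\<close>.\<close>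

definition comp_sub :: "sub \<Rightarrow> sub \<Rightarrow> sub" where
  "comp_sub \<tau> \<sigma> = map (\<lambda>t. subst_tm t \<sigma>) \<tau>"

definition id_sub :: "ctx \<Rightarrow> sub" where
  "id_sub \<Gamma> = map Var [0..<length \<Gamma>]"

fun dim_ty :: "ty \<Rightarrow> nat" where
  "dim_ty Star = 0"
| "dim_ty (Arr s A t) = Suc (dim_ty A)"

definition dim_ctx :: "ctx \<Rightarrow> nat" where
  "dim_ctx \<Gamma> = Max (insert 0 (dim_ty ` set \<Gamma>))"

fun fv_ty :: "ty \<Rightarrow> nat set" and fv_tm :: "tm \<Rightarrow> nat set" where
  "fv_ty Star = {}"
| "fv_ty (Arr s A t) = fv_tm s \<union> fv_ty A \<union> fv_tm t"
| "fv_tm (Var i) = {i}"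
| "fv_tm (Coh \<Delta> A \<sigma>) = (\<Union>t\<in>set \<sigma>. fv_tm t)"

inductive_set down_closure :: "ctx \<Rightarrow> nat set \<Rightarrow> nat set" for \<Gamma> :: ctx and V :: "nat set" where
  base: "i \<in> V \<Longrightarrow> i \<in> down_closure \<Gamma> V"
| step: "i \<in> down_closure \<Gamma> V \<Longrightarrow> i < length \<Gamma> \<Longrightarrow> j \<in> fv_ty (\<Gamma> ! i) \<Longrightarrow> j \<in> down_closure \<Gamma> V"

definition supp_tm :: "ctx \<Rightarrow> tm \<Rightarrow> nat set" where
  "supp_tm \<Gamma> t = down_closure \<Gamma> (fv_tm t)"

definition supp_sub :: "ctx \<Rightarrow> sub \<Rightarrow> nat set" where
  "supp_sub \<Gamma> \<sigma> = down_closure \<Gamma> (\<Union>t\<in>set \<sigma>. fv_tm t)"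


section \<open>Suspension and wedge\<close>

text \<open>The suspension points \<open>N\<close> and \<open>S\<close> become the variables 0 and 1; the others shift by two.\<close>

fun susp_ty :: "ty \<Rightarrow> ty" and susp_tm :: "tm \<Rightarrow> tm" where
  "susp_ty Star = Arr (Var 0) Star (Var 1)"
| "susp_ty (Arr s A t) = Arr (susp_tm s) (susp_ty A) (susp_tm t)"
| "susp_tm (Var i) = Var (i + 2)"
| "susp_tm (Coh \<Delta> A \<sigma>) =
     Coh ([Star, Star] @ map susp_ty \<Delta>) (susp_ty A) ([Var 0, Var 1] @ map susp_tm \<sigma>)"

definition susp_ctx :: "ctx \<Rightarrow> ctx" where
  "susp_ctx \<Gamma> = [Star, Star] @ map susp_ty \<Gamma>"

definition susp_sub :: "sub \<Rightarrow> sub" where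
  "susp_sub \<sigma> = [Var 0, Var 1] @ map susp_tm \<sigma>"

definition last_point :: "ctx \<Rightarrow> nat" where
  "last_point \<Gamma> = Max {i \<in> {..<length \<Gamma>}. \<Gamma> ! i = Star}"

text \<open>
  In \<open>\<Gamma> \<or> \<Delta>\<close> the variables of \<open>\<Gamma>\<close> keep their levels and are followed by those of \<open>\<Delta>\<close> other than
  its first one, which becomes the last point of \<open>\<Gamma>\<close>.
\<close>

definition wedge_right :: "ctx \<Rightarrow> nat \<Rightarrow> nat" where
  "wedge_right \<Gamma> j = (if j = 0 then last_point \<Gamma> else length \<Gamma> + j - 1)"

definition wedge_inl :: "ctx \<Rightarrow> sub" where
  "wedge_inl \<Gamma> = map Var [0..<length \<Gamma>]"

definition wedge_inr :: "ctx \<Rightarrow> ctx \<Rightarrow> sub" where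
  "wedge_inr \<Gamma> \<Delta> = map (\<lambda>j. Var (wedge_right \<Gamma> j)) [0..<length \<Delta>]"

definition wedge :: "ctx \<Rightarrow> ctx \<Rightarrow> ctx" where
  "wedge \<Gamma> \<Delta> = \<Gamma> @ map (\<lambda>A. subst_ty A (wedge_inr \<Gamma> \<Delta>)) (tl \<Delta>)"

text \<open>The context arguments of a wedge of substitutions are the codomains of the two factors.\<close>

definition wedge_sub :: "ctx \<Rightarrow> ctx \<Rightarrow> sub \<Rightarrow> sub \<Rightarrow> sub" where
  "wedge_sub \<Gamma> \<Delta> \<sigma> \<tau> = comp_sub \<sigma> (wedge_inl \<Gamma>) @ tl (comp_sub \<tau> (wedge_inr \<Gamma> \<Delta>))"

text \<open>
  The one-point context is a strict unit for the wedge (of contexts whose first entry is a point),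
  so ending an iterated wedge with it changes nothing.
\<close>

definition wedges :: "ctx list \<Rightarrow> ctx" where
  "wedges \<Gamma>s = foldr wedge \<Gamma>s [Star]"

fun wedges_sub :: "(ctx \<times> sub) list \<Rightarrow> sub" where
  "wedges_sub [] = [Var 0]"
| "wedges_sub ((\<Gamma>, \<sigma>) # ps) = wedge_sub \<Gamma> (wedges (map fst ps)) \<sigma> (wedges_sub ps)"

definition wedge_mid :: "ctx \<Rightarrow> ctx \<Rightarrow> ctx \<Rightarrow> sub" where
  "wedge_mid \<Gamma> \<Delta> \<Theta> = comp_sub (wedge_inl \<Delta>) (wedge_inr \<Gamma> (wedge \<Delta> \<Theta>))"


section \<open>Trees and pasting contexts\<close>

datatype tree = Node (subtrees: "tree list")

fun dim_tree :: "tree \<Rightarrow> nat" where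
  "dim_tree (Node Ts) = (if Ts = [] then 0 else Suc (Max (set (map dim_tree Ts))))"

fun trunk_height :: "tree \<Rightarrow> nat" where
  "trunk_height (Node [T]) = Suc (trunk_height T)"
| "trunk_height T = 0"

definition linear :: "tree \<Rightarrow> bool" where
  "linear T \<longleftrightarrow> trunk_height T = dim_tree T"

fun ctx_of :: "tree \<Rightarrow> ctx"  (\<open>\<lfloor>_\<rfloor>\<^sub>c\<close>) where
  "\<lfloor>Node Ts\<rfloor>\<^sub>c = wedges (map (\<lambda>T. susp_ctx \<lfloor>T\<rfloor>\<^sub>c) Ts)"

fun disc :: "nat \<Rightarrow> tree" where
  "disc 0 = Node []"
| "disc (Suc n) = Node [disc n]"

text \<open>
  The variables of the disc context of dimension \<open>n\<close> are, in order, \<open>d\<^sub>0\<^sup>-, d\<^sub>0\<^sup>+, d\<^sub>1\<^sup>-, d\<^sub>1\<^sup>+, \<dots>, d\<^sub>n\<close>.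
\<close>

definition disc_top :: "nat \<Rightarrow> nat" where
  "disc_top n = 2 * n"

fun disc_boundary_sub :: "ty \<Rightarrow> sub" where
  "disc_boundary_sub Star = []"
| "disc_boundary_sub (Arr s A t) = disc_boundary_sub A @ [s, t]"

definition disc_sub :: "ty \<Rightarrow> tm \<Rightarrow> sub" where
  "disc_sub A t = disc_boundary_sub A @ [t]"

fun bdry :: "nat \<Rightarrow> tree \<Rightarrow> tree" where
  "bdry 0 T = Node []"
| "bdry (Suc n) (Node Ts) = Node (map (bdry n) Ts)"

datatype sign = Minus | Plus

fun bdry_inc :: "sign \<Rightarrow> nat \<Rightarrow> tree \<Rightarrow> sub" where
  "bdry_inc Minus 0 T = [Var 0]"
| "bdry_inc Plus 0 T = [Var (last_point \<lfloor>T\<rfloor>\<^sub>c)]"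
| "bdry_inc \<epsilon> (Suc n) (Node Ts) =
     wedges_sub (map (\<lambda>T. (susp_ctx \<lfloor>T\<rfloor>\<^sub>c, susp_sub (bdry_inc \<epsilon> n T))) Ts)"

fun std_ty :: "nat \<Rightarrow> tree \<Rightarrow> ty"
and std_coh :: "nat \<Rightarrow> tree \<Rightarrow> tm"
and std_tm :: "nat \<Rightarrow> tree \<Rightarrow> tm" where
  "std_ty 0 T = Star"
| "std_ty (Suc n) T =
     Arr (subst_tm (std_tm n (bdry n T)) (bdry_inc Minus n T))
         (std_ty n T)
         (subst_tm (std_tm n (bdry n T)) (bdry_inc Plus n T))"
| "std_coh n T = Coh \<lfloor>T\<rfloor>\<^sub>c (std_ty n T) (id_sub \<lfloor>T\<rfloor>\<^sub>c)"
| "std_tm n T = (if T = disc n then Var (disc_top n) else std_coh n T)"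


section \<open>Typing and equality\<close>

type_synonym eq_gens = "(ctx \<times> tm \<times> tm) set"

text \<open>
  Boundary inclusions are defined on trees, so the side condition of the coherence rule takes the
  tree \<open>T\<close> presenting the pasting context \<open>\<Delta>\<close>. Its first alternative refers to the boundary of
  dimension \<open>dim \<Delta> - 1\<close> and is therefore only available when \<open>dim \<Delta> > 0\<close>.
\<close>

definition coh_supp_cond :: "tree \<Rightarrow> tm \<Rightarrow> tm \<Rightarrow> bool" where
  "coh_supp_cond T s t \<longleftrightarrow> (let \<Delta> = \<lfloor>T\<rfloor>\<^sub>c; d = dim_ctx \<Delta> in
     0 < d \<and> supp_tm \<Delta> s = supp_sub \<Delta> (bdry_inc Minus (d - 1) T)
           \<and> supp_tm \<Delta> t = supp_sub \<Delta> (bdry_inc Plus (d - 1) T)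
   \<or> supp_tm \<Delta> s = {..<length \<Delta>} \<and> supp_tm \<Delta> t = {..<length \<Delta>})"

text \<open>
  \<open>sub_ok R \<Gamma> \<sigma> \<Delta>\<close> is \<open>\<Gamma> \<turnstile> \<sigma> : \<Delta>\<close>, and \<open>eq_sub R \<Delta> \<Gamma> \<sigma> \<tau>\<close> is \<open>\<Gamma> \<turnstile> \<sigma> = \<tau>\<close> for raw substitutions
  \<open>\<sigma>, \<tau> : \<Delta> \<rightarrow> \<Gamma>\<close>. Premises about raw syntax record that the judgements only concern raw contexts,
  types, terms and substitutions over the stated contexts.
\<close>

inductive ctx_ok :: "eq_gens \<Rightarrow> ctx \<Rightarrow> bool"
      and ty_ok :: "eq_gens \<Rightarrow> ctx \<Rightarrow> ty \<Rightarrow> bool"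
      and tm_ok :: "eq_gens \<Rightarrow> ctx \<Rightarrow> tm \<Rightarrow> ty \<Rightarrow> bool"
      and sub_ok :: "eq_gens \<Rightarrow> ctx \<Rightarrow> sub \<Rightarrow> ctx \<Rightarrow> bool"
      and eq_ty :: "eq_gens \<Rightarrow> ctx \<Rightarrow> ty \<Rightarrow> ty \<Rightarrow> bool"
      and eq_tm :: "eq_gens \<Rightarrow> ctx \<Rightarrow> tm \<Rightarrow> tm \<Rightarrow> bool"
      and eq_sub :: "eq_gens \<Rightarrow> ctx \<Rightarrow> ctx \<Rightarrow> sub \<Rightarrow> sub \<Rightarrow> bool"
  for R :: eq_gens
  where
  ctx_empty: "ctx_ok R []"
| ctx_ext: "ctx_ok R \<Gamma> \<Longrightarrow> ty_ok R \<Gamma> A \<Longrightarrow> ctx_ok R (\<Gamma> @ [A])"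

| ty_Star: "is_ctx \<Gamma> \<Longrightarrow> ty_ok R \<Gamma> Star"
| ty_Arr: "ty_ok R \<Gamma> A \<Longrightarrow> tm_ok R \<Gamma> s A \<Longrightarrow> tm_ok R \<Gamma> t A \<Longrightarrow> ty_ok R \<Gamma> (Arr s A t)"

| tm_Var: "ctx_ok R \<Gamma> \<Longrightarrow> i < length \<Gamma> \<Longrightarrow> tm_ok R \<Gamma> (Var i) (\<Gamma> ! i)"
| tm_Coh: "ty_ok R \<lfloor>T\<rfloor>\<^sub>c (Arr s A t) \<Longrightarrow> sub_ok R \<Gamma> \<sigma> \<lfloor>T\<rfloor>\<^sub>c \<Longrightarrow> coh_supp_cond T s t
    \<Longrightarrow> tm_ok R \<Gamma> (Coh \<lfloor>T\<rfloor>\<^sub>c (Arr s A t) \<sigma>) (subst_ty (Arr s A t) \<sigma>)"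
| tm_conv: "tm_ok R \<Gamma> s A \<Longrightarrow> eq_ty R \<Gamma> A B \<Longrightarrow> tm_ok R \<Gamma> s B"

| sub_empty: "is_ctx \<Delta> \<Longrightarrow> sub_ok R \<Delta> [] []"
| sub_ext: "sub_ok R \<Delta> \<sigma> \<Gamma> \<Longrightarrow> ty_ok R \<Gamma> A \<Longrightarrow> tm_ok R \<Delta> t (subst_ty A \<sigma>)
    \<Longrightarrow> sub_ok R \<Delta> (\<sigma> @ [t]) (\<Gamma> @ [A])"

| eq_ty_refl: "is_ty \<Gamma> A \<Longrightarrow> eq_ty R \<Gamma> A A"
| eq_ty_sym: "eq_ty R \<Gamma> A B \<Longrightarrow> eq_ty R \<Gamma> B A"
| eq_ty_trans: "eq_ty R \<Gamma> A B \<Longrightarrow> eq_ty R \<Gamma> B C \<Longrightarrow> eq_ty R \<Gamma> A C"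
| eq_ty_Arr: "eq_tm R \<Gamma> s s' \<Longrightarrow> eq_ty R \<Gamma> A A' \<Longrightarrow> eq_tm R \<Gamma> t t'
    \<Longrightarrow> eq_ty R \<Gamma> (Arr s A t) (Arr s' A' t')"

| eq_tm_refl: "is_tm \<Gamma> s \<Longrightarrow> eq_tm R \<Gamma> s s"
| eq_tm_sym: "eq_tm R \<Gamma> s t \<Longrightarrow> eq_tm R \<Gamma> t s"
| eq_tm_trans: "eq_tm R \<Gamma> s t \<Longrightarrow> eq_tm R \<Gamma> t u \<Longrightarrow> eq_tm R \<Gamma> s u"
| eq_tm_Coh: "eq_ty R \<Delta> A B \<Longrightarrow> eq_sub R \<Delta> \<Gamma> \<sigma> \<tau> \<Longrightarrow> eq_tm R \<Gamma> (Coh \<Delta> A \<sigma>) (Coh \<Delta> B \<tau>)"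
| eq_tm_gen: "(\<Gamma>, s, t) \<in> R \<Longrightarrow> tm_ok R \<Gamma> s A \<Longrightarrow> eq_tm R \<Gamma> s t"

| eq_sub_refl: "is_sub \<Delta> \<Gamma> \<sigma> \<Longrightarrow> eq_sub R \<Delta> \<Gamma> \<sigma> \<sigma>"
| eq_sub_sym: "eq_sub R \<Delta> \<Gamma> \<sigma> \<tau> \<Longrightarrow> eq_sub R \<Delta> \<Gamma> \<tau> \<sigma>"
| eq_sub_trans: "eq_sub R \<Delta> \<Gamma> \<sigma> \<tau> \<Longrightarrow> eq_sub R \<Delta> \<Gamma> \<tau> \<rho> \<Longrightarrow> eq_sub R \<Delta> \<Gamma> \<sigma> \<rho>"
| eq_sub_empty: "is_ctx \<Gamma> \<Longrightarrow> eq_sub R [] \<Gamma> [] []"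
| eq_sub_ext: "eq_sub R \<Delta> \<Gamma> \<sigma> \<tau> \<Longrightarrow> is_ty \<Delta> A \<Longrightarrow> eq_tm R \<Gamma> s t
    \<Longrightarrow> eq_sub R (\<Delta> @ [A]) \<Gamma> (\<sigma> @ [s]) (\<tau> @ [t])"

definition eq_generators :: "eq_gens \<Rightarrow> bool" where
  "eq_generators R \<longleftrightarrow> (\<forall>(\<Gamma>, s, t) \<in> R. is_tm \<Gamma> s \<and> is_tm \<Gamma> t)"

definition tame :: "eq_gens \<Rightarrow> bool" where
  "tame R \<longleftrightarrow> (\<forall>(\<Gamma>, s, t) \<in> R.
      (\<forall>A. is_ty \<Gamma> A \<longrightarrow> (\<Gamma> @ [A], s, t) \<in> R)
    \<and> (\<forall>\<Delta> \<sigma>. sub_ok R \<Delta> \<sigma> \<Gamma> \<longrightarrow> (\<Delta>, subst_tm s \<sigma>, subst_tm t \<sigma>) \<in> R)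
    \<and> (susp_ctx \<Gamma>, susp_tm s, susp_tm t) \<in> R)"


section \<open>Pushouts and the syntactic category\<close>

text \<open>
  \<open>Comp C X Y Z f g\<close> is the composite of \<open>f : X \<rightarrow> Y\<close> followed by \<open>g : Y \<rightarrow> Z\<close>. The objects are
  arguments because morphisms do not determine their domain and codomain.
\<close>

record ('o, 'm) cat =
  Obj :: "'o set"
  Hom :: "'o \<Rightarrow> 'o \<Rightarrow> 'm set"
  Comp :: "'o \<Rightarrow> 'o \<Rightarrow> 'o \<Rightarrow> 'm \<Rightarrow> 'm \<Rightarrow> 'm"

definition commutative_square ::
  "('o, 'm) cat \<Rightarrow> 'o \<Rightarrow> 'o \<Rightarrow> 'o \<Rightarrow> 'o \<Rightarrow> 'm \<Rightarrow> 'm \<Rightarrow> 'm \<Rightarrow> 'm \<Rightarrow> bool" where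
  "commutative_square C W X Y Z f g h k \<longleftrightarrow>
     W \<in> Obj C \<and> X \<in> Obj C \<and> Y \<in> Obj C \<and> Z \<in> Obj C \<and>
     f \<in> Hom C W X \<and> g \<in> Hom C W Y \<and> h \<in> Hom C X Z \<and> k \<in> Hom C Y Z \<and>
     Comp C W X Z f h = Comp C W Y Z g k"

definition pushout_square ::
  "('o, 'm) cat \<Rightarrow> 'o \<Rightarrow> 'o \<Rightarrow> 'o \<Rightarrow> 'o \<Rightarrow> 'm \<Rightarrow> 'm \<Rightarrow> 'm \<Rightarrow> 'm \<Rightarrow> bool" where
  "pushout_square C W X Y Q f g p q \<longleftrightarrow>
     commutative_square C W X Y Q f g p q \<and>
     (\<forall>Z h k. commutative_square C W X Y Z f g h k \<longrightarrow>
        (\<exists>!u. u \<in> Hom C Q Z \<and> Comp C X Q Z p u = h \<and> Comp C Y Q Z q u = k))"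

definition sub_rel :: "eq_gens \<Rightarrow> ctx \<Rightarrow> ctx \<Rightarrow> (sub \<times> sub) set" where
  "sub_rel R \<Delta> \<Gamma> = {(\<sigma>, \<tau>). sub_ok R \<Gamma> \<sigma> \<Delta> \<and> sub_ok R \<Gamma> \<tau> \<Delta> \<and> eq_sub R \<Delta> \<Gamma> \<sigma> \<tau>}"

definition sub_class :: "eq_gens \<Rightarrow> ctx \<Rightarrow> ctx \<Rightarrow> sub \<Rightarrow> sub set" where
  "sub_class R \<Delta> \<Gamma> \<sigma> = sub_rel R \<Delta> \<Gamma> `` {\<sigma>}"

definition Catt :: "eq_gens \<Rightarrow> (ctx, sub set) cat" where
  "Catt R = \<lparr>
     Obj = {\<Gamma>. ctx_ok R \<Gamma>},
     Hom = (\<lambda>\<Delta> \<Gamma>. {\<sigma>. sub_ok R \<Gamma> \<sigma> \<Delta>} // sub_rel R \<Delta> \<Gamma>),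
     Comp = (\<lambda>\<Delta> \<Gamma> \<Theta> f g. \<Union>\<sigma>\<in>f. \<Union>\<tau>\<in>g. sub_class R \<Delta> \<Theta> (comp_sub \<sigma> \<tau>)) \<rparr>"


section \<open>Insertion\<close>

text \<open>Branches are index lists with indices counted from 0.\<close>

fun is_path :: "tree \<Rightarrow> nat list \<Rightarrow> bool" where
  "is_path T [] \<longleftrightarrow> True"
| "is_path (Node Ts) (k # P) \<longleftrightarrow> k < length Ts \<and> is_path (Ts ! k) P"

fun subtree :: "tree \<Rightarrow> nat list \<Rightarrow> tree" where
  "subtree T [] = T"
| "subtree (Node Ts) (k # P) = subtree (Ts ! k) P"

definition is_branch :: "tree \<Rightarrow> nat list \<Rightarrow> bool" where
  "is_branch S P \<longleftrightarrow> P \<noteq> [] \<and> is_path S P \<and> linear (subtree S P)"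

text \<open>
  The level of the variable given by a branch: the top variable of the disc at its end, transported
  along one suspension and one wedge inclusion for each index.
\<close>

fun branch_var :: "tree \<Rightarrow> nat list \<Rightarrow> nat" where
  "branch_var S [] = disc_top (dim_tree S)"
| "branch_var (Node Ss) (k # P) =
     wedge_right \<lfloor>Node (take k Ss)\<rfloor>\<^sub>c (branch_var (Ss ! k) P + 2)"

definition branch_height :: "nat list \<Rightarrow> nat" where
  "branch_height P = length P - 1"

definition leaf_height :: "tree \<Rightarrow> nat list \<Rightarrow> nat" where
  "leaf_height S P = dim_ty (\<lfloor>S\<rfloor>\<^sub>c ! branch_var S P)"

definition insertion_point :: "tree \<Rightarrow> nat list \<Rightarrow> tree \<Rightarrow> bool" where
  "insertion_point S P T \<longleftrightarrow>
     is_branch S P \<and> branch_height P \<le> trunk_height T \<and> leaf_height S P \<ge> dim_tree T"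

text \<open>The following functions are only meaningful at insertion points, where the cases are exhaustive.\<close>

fun insertion :: "tree \<Rightarrow> nat list \<Rightarrow> tree \<Rightarrow> tree" where
  "insertion (Node Ss) [k] (Node Ts) = Node (take k Ss @ Ts @ drop (Suc k) Ss)"
| "insertion (Node Ss) (k # k' # P) (Node [T]) =
     Node (take k Ss @ [insertion (Ss ! k) (k' # P) T] @ drop (Suc k) Ss)"

fun interior :: "tree \<Rightarrow> nat list \<Rightarrow> tree \<Rightarrow> sub" where
  "interior (Node Ss) [k] T =
     wedge_mid \<lfloor>Node (take k Ss)\<rfloor>\<^sub>c \<lfloor>T\<rfloor>\<^sub>c \<lfloor>Node (drop (Suc k) Ss)\<rfloor>\<^sub>c"
| "interior (Node Ss) (k # k' # P) (Node [T]) =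
     comp_sub (susp_sub (interior (Ss ! k) (k' # P) T))
       (wedge_mid \<lfloor>Node (take k Ss)\<rfloor>\<^sub>c (susp_ctx \<lfloor>insertion (Ss ! k) (k' # P) T\<rfloor>\<^sub>c)
          \<lfloor>Node (drop (Suc k) Ss)\<rfloor>\<^sub>c)"

fun exterior :: "tree \<Rightarrow> nat list \<Rightarrow> tree \<Rightarrow> sub" where
  "exterior (Node Ss) [k] T =
     (let L = \<lfloor>Node (take k Ss)\<rfloor>\<^sub>c; R = \<lfloor>Node (drop (Suc k) Ss)\<rfloor>\<^sub>c; n = leaf_height (Node Ss) [k] in
      wedges_sub [(L, id_sub L),
                  (\<lfloor>T\<rfloor>\<^sub>c, disc_sub (std_ty n T) (std_coh n T)),
                  (R, id_sub R)])"
| "exterior (Node Ss) (k # k' # P) (Node [T]) =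
     (let L = \<lfloor>Node (take k Ss)\<rfloor>\<^sub>c; R = \<lfloor>Node (drop (Suc k) Ss)\<rfloor>\<^sub>c in
      wedges_sub [(L, id_sub L),
                  (susp_ctx \<lfloor>insertion (Ss ! k) (k' # P) T\<rfloor>\<^sub>c,
                   susp_sub (exterior (Ss ! k) (k' # P) T)),
                  (R, id_sub R)])"

end

theory Submission
  imports Defs
begin

text \<open>
  The square satisfies a purely syntactic criterion (locale \<open>gluing\<close>): the maps from the disc to
  \<open>S\<close> and from \<open>T\<close> to the insertion \<open>Q\<close> are type-preserving renamings, and \<open>\<kappa>\<close> restricts to a
  type-preserving bijection from the variables of \<open>S\<close> outside the disc to the variables of \<open>Q\<close> outside
  \<open>T\<close>. A map out of \<open>Q\<close> is then determined by its values on these variables and on those of \<open>T\<close>, and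
  its composite with \<open>\<kappa>\<close> is right on the disc inside \<open>S\<close> because the outer square commutes. Unlike the
  pushout property, the criterion is inherited by suspensions and wedges, so it follows by induction
  on the branch from the square in which the disc is all of \<open>S\<close> and \<open>T\<close> is all of \<open>Q\<close>.
\<close>


section \<open>Raw syntax and admissibility of substitution\<close>

text \<open>The universal property does not transfer along suspension formally: a cocone under a
  suspended square need not itself be a suspension, so the original square says nothing about it. A
  second obstacle is that \<kappa> is not a renaming, because it sends the branch variable to a
  coherence. Hence the criterion asks a renaming only of the two maps i and \<iota> and lets
  commutativity dictate \<kappa> on the disc. Equality modulo R matters in the universal property
  because the outer square commutes only up to it. The induced map therefore restricts to T on the
  nose but along \<kappa> only up to equality, and typing it takes the conversion rule. Tameness
  makes typing and equality stable under substitution, hence composition well defined on classes.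
  The two bounds of an insertion point act separately: bh(P) \<le> th(T) allows one suspension to be
  peeled off T for every index of the branch but the last, and lh(P) \<ge> dim(T) makes the
  coherence well typed.\<close>

lemma length_comp_sub [simp]: "length (comp_sub \<sigma> \<tau>) = length \<sigma>"
  by (simp add: comp_sub_def)

lemma nth_comp_sub [simp]: "i < length \<sigma> \<Longrightarrow> comp_sub \<sigma> \<tau> ! i = subst_tm (\<sigma> ! i) \<tau>"
  by (simp add: comp_sub_def)

lemma length_id_sub [simp]: "length (id_sub \<Gamma>) = length \<Gamma>"
  by (simp add: id_sub_def)

lemma nth_id_sub [simp]: "i < length \<Gamma> \<Longrightarrow> id_sub \<Gamma> ! i = Var i"
  by (simp add: id_sub_def)

lemma subst_cong:
  "(\<And>i. i \<in> fv_ty A \<Longrightarrow> \<sigma> ! i = \<tau> ! i) \<Longrightarrow> subst_ty A \<sigma> = subst_ty A \<tau>"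
  "(\<And>i. i \<in> fv_tm t \<Longrightarrow> \<sigma> ! i = \<tau> ! i) \<Longrightarrow> subst_tm t \<sigma> = subst_tm t \<tau>"
  by (induction A \<sigma> and t \<sigma> rule: subst_ty_subst_tm.induct) auto

text \<open>The bound on free variables is there because list lookup is unspecified beyond the end:
  outside \<sigma> the composite list and the iterated substitution need not agree.\<close>

lemma subst_comp:
  "fv_ty A \<subseteq> {..<length \<sigma>} \<Longrightarrow> subst_ty A (comp_sub \<sigma> \<tau>) = subst_ty (subst_ty A \<sigma>) \<tau>"
  "fv_tm t \<subseteq> {..<length \<sigma>} \<Longrightarrow> subst_tm t (comp_sub \<sigma> \<tau>) = subst_tm (subst_tm t \<sigma>) \<tau>"
  by (induction A \<sigma> and t \<sigma> rule: subst_ty_subst_tm.induct) (auto simp: UN_subset_iff)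

lemma subst_id:
  "fv_ty A \<subseteq> {..<length \<Gamma>} \<Longrightarrow> subst_ty A (id_sub \<Gamma>) = A"
  "fv_tm t \<subseteq> {..<length \<Gamma>} \<Longrightarrow> subst_tm t (id_sub \<Gamma>) = t"
  by (induction A and t rule: fv_ty_fv_tm.induct) (auto simp: UN_subset_iff map_idI)

lemma fv_subst:
  "fv_ty (subst_ty A \<sigma>) = (\<Union>i\<in>fv_ty A. fv_tm (\<sigma> ! i))"
  "fv_tm (subst_tm t \<sigma>) = (\<Union>i\<in>fv_tm t. fv_tm (\<sigma> ! i))"
  by (induction A \<sigma> and t \<sigma> rule: subst_ty_subst_tm.induct) auto

lemma dim_subst [simp]: "dim_ty (subst_ty A \<sigma>) = dim_ty A"
  by (induction A rule: dim_ty.induct) auto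

text \<open>With levels, all that the laws of composition need to know about the target context is
  its length. This lets the combinatorics of suspension and wedge proceed without any raw or typing
  judgement.\<close>

definition scoped :: "nat \<Rightarrow> sub \<Rightarrow> bool" where
  "scoped n \<sigma> \<longleftrightarrow> (\<forall>t\<in>set \<sigma>. fv_tm t \<subseteq> {..<n})"

lemma scoped_nth: "scoped n \<sigma> \<Longrightarrow> i < length \<sigma> \<Longrightarrow> fv_tm (\<sigma> ! i) \<subseteq> {..<n}"
  by (auto simp: scoped_def)

lemma scopedI: "(\<And>i. i < length \<sigma> \<Longrightarrow> fv_tm (\<sigma> ! i) \<subseteq> {..<n}) \<Longrightarrow> scoped n \<sigma>"
  by (metis in_set_conv_nth scoped_def)

lemma fv_subst_scoped:
  assumes "scoped n \<sigma>"
  shows "fv_ty A \<subseteq> {..<length \<sigma>} \<Longrightarrow> fv_ty (subst_ty A \<sigma>) \<subseteq> {..<n}"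
    and "fv_tm t \<subseteq> {..<length \<sigma>} \<Longrightarrow> fv_tm (subst_tm t \<sigma>) \<subseteq> {..<n}"
  using scoped_nth[OF assms] by (fastforce simp: fv_subst)+

lemma scoped_comp: "scoped (length \<tau>) \<sigma> \<Longrightarrow> scoped n \<tau> \<Longrightarrow> scoped n (comp_sub \<sigma> \<tau>)"
  by (rule scopedI) (simp add: fv_subst_scoped scoped_nth)

lemma comp_sub_assoc:
  assumes "scoped (length \<tau>) \<sigma>"
  shows "comp_sub (comp_sub \<sigma> \<tau>) \<rho> = comp_sub \<sigma> (comp_sub \<tau> \<rho>)"
  by (rule nth_equalityI) (use assms scoped_nth in \<open>auto simp: subst_comp\<close>)

lemma comp_id_right: "scoped (length \<Gamma>) \<sigma> \<Longrightarrow> comp_sub \<sigma> (id_sub \<Gamma>) = \<sigma>"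
  by (rule nth_equalityI) (use scoped_nth in \<open>auto simp: subst_id\<close>)

lemma comp_id_left: "length \<sigma> = length \<Gamma> \<Longrightarrow> comp_sub (id_sub \<Gamma>) \<sigma> = \<sigma>"
  by (rule nth_equalityI) auto

definition scoped_ctx :: "ctx \<Rightarrow> bool" where
  "scoped_ctx \<Gamma> \<longleftrightarrow> (\<forall>i<length \<Gamma>. fv_ty (\<Gamma> ! i) \<subseteq> {..<i})"

text \<open>The presupposed contexts belong to the induction statement: the rule extending a context
  has a judgement on a type as its premise, and scoping of the shorter context comes from
  there.\<close>

lemma raw_scoped:
  "is_ctx \<Gamma> \<Longrightarrow> scoped_ctx \<Gamma>"
  "is_ty \<Gamma> A \<Longrightarrow> is_ctx \<Gamma> \<and> scoped_ctx \<Gamma> \<and> fv_ty A \<subseteq> {..<length \<Gamma>}"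
  "is_tm \<Gamma> t \<Longrightarrow> is_ctx \<Gamma> \<and> scoped_ctx \<Gamma> \<and> fv_tm t \<subseteq> {..<length \<Gamma>}"
  "is_sub \<Delta> \<Gamma> \<sigma> \<Longrightarrow> is_ctx \<Delta> \<and> is_ctx \<Gamma> \<and> scoped_ctx \<Gamma> \<and> length \<sigma> = length \<Delta> \<and> scoped (length \<Gamma>) \<sigma>"
proof (induction rule: is_ctx_is_ty_is_tm_is_sub.inducts)
  case (is_ctx_ext \<Gamma> A)
  then show ?case
    by (simp add: scoped_ctx_def nth_append less_Suc_eq)
next
  case is_ctx_empty
  show ?case by (simp add: scoped_ctx_def)
qed (auto simp: scoped_def intro: is_ctx_is_ty_is_tm_is_sub.intros)

lemma scoped_ctx_nth: "scoped_ctx \<Gamma> \<Longrightarrow> i < length \<Gamma> \<Longrightarrow> fv_ty (\<Gamma> ! i) \<subseteq> {..<length \<Gamma>}"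
  by (fastforce simp: scoped_ctx_def)

lemma is_ctx_snocD:
  assumes "is_ctx (\<Gamma> @ [A])"
  shows "is_ty \<Gamma> A" "is_ctx \<Gamma>"
proof -
  from assms show "is_ty \<Gamma> A" by cases auto
  then show "is_ctx \<Gamma>" using raw_scoped(2) by blast
qed

text \<open>The trivial first claim fills the slot that the simultaneous induction reserves for
  contexts; the same device recurs in the later inductions.\<close>

lemma raw_weaken:
  "is_ctx \<Gamma> \<Longrightarrow> True"
  "is_ty \<Gamma> A \<Longrightarrow> is_ty \<Gamma> B \<longrightarrow> is_ty (\<Gamma> @ [B]) A"
  "is_tm \<Gamma> t \<Longrightarrow> is_ty \<Gamma> B \<longrightarrow> is_tm (\<Gamma> @ [B]) t"
  "is_sub \<Delta> \<Gamma> \<sigma> \<Longrightarrow> is_ty \<Gamma> B \<longrightarrow> is_sub \<Delta> (\<Gamma> @ [B]) \<sigma>"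
  by (induction rule: is_ctx_is_ty_is_tm_is_sub.inducts)
     (auto intro: is_ctx_is_ty_is_tm_is_sub.intros)

lemma is_ty_nth: "is_ctx \<Gamma> \<Longrightarrow> i < length \<Gamma> \<Longrightarrow> is_ty \<Gamma> (\<Gamma> ! i)"
proof (induction \<Gamma> rule: rev_induct)
  case (snoc A \<Gamma>)
  then show ?case
    using is_ctx_snocD[OF snoc.prems(1)] raw_weaken(2) by (auto simp: nth_append less_Suc_eq)
qed simp

lemma is_sub_nth: "is_sub \<Delta> \<Gamma> \<sigma> \<Longrightarrow> i < length \<Delta> \<Longrightarrow> is_tm \<Gamma> (\<sigma> ! i)"
  by (induction \<Delta> \<Gamma> \<sigma> rule: is_ctx_is_ty_is_tm_is_sub.inducts(4)
        [where ?P1.0 = "\<lambda>_. True" and ?P2.0 = "\<lambda>_ _. True" and ?P3.0 = "\<lambda>_ _. True"])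
     (auto simp: nth_append less_Suc_eq dest: raw_scoped(4))

lemma raw_subst:
  "is_ctx \<Gamma> \<Longrightarrow> True"
  "is_ty \<Gamma> A \<Longrightarrow> is_sub \<Gamma> \<Delta> \<sigma> \<longrightarrow> is_ty \<Delta> (subst_ty A \<sigma>)"
  "is_tm \<Gamma> t \<Longrightarrow> is_sub \<Gamma> \<Delta> \<sigma> \<longrightarrow> is_tm \<Delta> (subst_tm t \<sigma>)"
  "is_sub \<Theta> \<Gamma> \<tau> \<Longrightarrow> is_sub \<Gamma> \<Delta> \<sigma> \<longrightarrow> is_sub \<Theta> \<Delta> (comp_sub \<tau> \<sigma>)"
  by (induction rule: is_ctx_is_ty_is_tm_is_sub.inducts)
     (auto simp: comp_sub_def is_sub_nth dest: raw_scoped(4)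
           intro: is_ctx_is_ty_is_tm_is_sub.intros)

section \<open>Typing and equality judgements, entry by entry and under substitution\<close>

lemma judgements_raw:
  assumes "eq_generators R"
  shows
  "ctx_ok R \<Gamma> \<Longrightarrow> is_ctx \<Gamma>"
  "ty_ok R \<Gamma> A \<Longrightarrow> is_ty \<Gamma> A"
  "tm_ok R \<Gamma> t A \<Longrightarrow> is_tm \<Gamma> t \<and> is_ty \<Gamma> A"
  "sub_ok R \<Gamma> \<sigma> \<Delta> \<Longrightarrow> is_sub \<Delta> \<Gamma> \<sigma>"
  "eq_ty R \<Gamma> A B \<Longrightarrow> is_ty \<Gamma> A \<and> is_ty \<Gamma> B"
  "eq_tm R \<Gamma> s t \<Longrightarrow> is_tm \<Gamma> s \<and> is_tm \<Gamma> t"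
  "eq_sub R \<Delta> \<Gamma> \<sigma> \<tau> \<Longrightarrow> is_sub \<Delta> \<Gamma> \<sigma> \<and> is_sub \<Delta> \<Gamma> \<tau>"
proof (induction rule: ctx_ok_ty_ok_tm_ok_sub_ok_eq_ty_eq_tm_eq_sub.inducts)
  case (tm_Coh T s A t \<Gamma> \<sigma>)
  then show ?case
    using raw_subst(2)[of "\<lfloor>T\<rfloor>\<^sub>c" "Arr s A t" \<Gamma> \<sigma>] by (auto intro: is_tm_Coh)
next
  \<comment> \<open>The generator rule types only its left-hand side; that the right-hand side is a
    term over the same context has to come from \<open>eq_generators\<close>.\<close>
  case (eq_tm_gen \<Gamma> s t A)
  then show ?case
    using assms by (auto simp: eq_generators_def)
qed (auto simp: is_ty_nth intro: is_ctx_is_ty_is_tm_is_sub.intros)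

lemma sub_ok_nth:
  assumes R: "eq_generators R"
  shows "sub_ok R \<Delta> \<sigma> \<Gamma> \<Longrightarrow> i < length \<Gamma> \<Longrightarrow> tm_ok R \<Delta> (\<sigma> ! i) (subst_ty (\<Gamma> ! i) \<sigma>)"
proof (induction \<Gamma> arbitrary: \<sigma> rule: rev_induct)
  case (snoc A \<Gamma>)
  from snoc.prems(1) obtain \<tau> t where \<sigma>: "\<sigma> = \<tau> @ [t]" and \<tau>: "sub_ok R \<Delta> \<tau> \<Gamma>"
    and A: "ty_ok R \<Gamma> A" and t: "tm_ok R \<Delta> t (subst_ty A \<tau>)"
    by cases auto
  have A': "is_ctx \<Gamma>" "fv_ty A \<subseteq> {..<length \<Gamma>}"
    using raw_scoped(2) judgements_raw(2)[OF R A] by auto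
  have len: "length \<tau> = length \<Gamma>"
    using raw_scoped(4) judgements_raw(4)[OF R \<tau>] by auto
  show ?case
  proof (cases "i < length \<Gamma>")
    case True
    then have "fv_ty (\<Gamma> ! i) \<subseteq> {..<length \<Gamma>}" using scoped_ctx_nth raw_scoped(1)[OF A'(1)] by blast
    then have "subst_ty (\<Gamma> ! i) \<sigma> = subst_ty (\<Gamma> ! i) \<tau>"
      by (intro subst_cong) (auto simp: \<sigma> nth_append len)
    with snoc.IH[OF \<tau> True] True show ?thesis by (simp add: \<sigma> nth_append len)
  next
    case False
    then have "i = length \<Gamma>" using snoc.prems(2) by simp
    moreover have "subst_ty A \<sigma> = subst_ty A \<tau>"
      using A'(2) by (intro subst_cong) (auto simp: \<sigma> nth_append len)
    ultimately show ?thesis using t by (simp add: \<sigma> nth_append len)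
  qed
qed simp

text \<open>Together with \<open>sub_ok_nth\<close> this trades the inductive typing of
  substitutions for an entrywise one in which all of \<sigma> acts on every type: an entry's type
  mentions only earlier variables, where \<sigma> and its prefixes agree.\<close>

lemma sub_okI:
  assumes R: "eq_generators R"
  shows "ctx_ok R \<Gamma> \<Longrightarrow> is_ctx \<Delta> \<Longrightarrow> length \<sigma> = length \<Gamma>
    \<Longrightarrow> (\<And>i. i < length \<Gamma> \<Longrightarrow> tm_ok R \<Delta> (\<sigma> ! i) (subst_ty (\<Gamma> ! i) \<sigma>)) \<Longrightarrow> sub_ok R \<Delta> \<sigma> \<Gamma>"
proof (induction \<Gamma> arbitrary: \<sigma> rule: rev_induct)
  case Nil
  then show ?case by (simp add: sub_empty)
next
  case (snoc A \<Gamma>)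
  from snoc.prems(1) have ok: "ctx_ok R \<Gamma>" "ty_ok R \<Gamma> A"
    by (cases; simp)+
  have fv: "is_ctx \<Gamma>" "fv_ty A \<subseteq> {..<length \<Gamma>}"
    using raw_scoped(2) judgements_raw(2)[OF R ok(2)] by auto
  obtain \<tau> t where \<sigma>: "\<sigma> = \<tau> @ [t]"
    using snoc.prems(3) by (cases \<sigma> rule: rev_cases) auto
  have len: "length \<tau> = length \<Gamma>" using snoc.prems(3) \<sigma> by simp
  have eq: "subst_ty B \<sigma> = subst_ty B \<tau>" if "fv_ty B \<subseteq> {..<length \<Gamma>}" for B
    using that by (intro subst_cong) (auto simp: \<sigma> nth_append len)
  have "sub_ok R \<Delta> \<tau> \<Gamma>"
  proof (rule snoc.IH[OF ok(1) snoc.prems(2) len])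
    fix i assume i: "i < length \<Gamma>"
    then have "fv_ty (\<Gamma> ! i) \<subseteq> {..<length \<Gamma>}" using scoped_ctx_nth raw_scoped(1)[OF fv(1)] by blast
    then show "tm_ok R \<Delta> (\<tau> ! i) (subst_ty (\<Gamma> ! i) \<tau>)"
      using snoc.prems(4)[of i] i eq by (simp add: \<sigma> nth_append len)
  qed
  moreover have "tm_ok R \<Delta> t (subst_ty A \<tau>)"
    using snoc.prems(4)[of "length \<Gamma>"] eq[OF fv(2)] by (simp add: \<sigma> nth_append len)
  ultimately show ?case unfolding \<sigma> using ok(2) by (intro sub_ext)
qed

lemma sub_ok_id:
  assumes "eq_generators R" "ctx_ok R \<Gamma>"
  shows "sub_ok R \<Gamma> (id_sub \<Gamma>) \<Gamma>"
proof (rule sub_okI)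
  have c: "is_ctx \<Gamma>" using assms by (rule judgements_raw(1))
  show "is_ctx \<Gamma>" by (rule c)
  fix i assume i: "i < length \<Gamma>"
  have "fv_ty (\<Gamma> ! i) \<subseteq> {..<length \<Gamma>}" using scoped_ctx_nth raw_scoped(1)[OF c] i by blast
  then show "tm_ok R \<Gamma> (id_sub \<Gamma> ! i) (subst_ty (\<Gamma> ! i) (id_sub \<Gamma>))"
    using tm_Var[OF assms(2) i] i by (simp add: subst_id)
qed (use assms in auto)

text \<open>In the coherence case the substitution reaches only the argument, since the type and the
  support condition live over the pasting context. In the generator case the equation survives
  because \<open>tame\<close> closes R under well-typed substitutions.\<close>

lemma judgements_subst:
  assumes R: "eq_generators R" and tame: "tame R"
  shows
  "ctx_ok R \<Gamma> \<Longrightarrow> True"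
  "ty_ok R \<Gamma> A \<Longrightarrow> \<forall>\<Delta> \<sigma>. sub_ok R \<Delta> \<sigma> \<Gamma> \<longrightarrow> ty_ok R \<Delta> (subst_ty A \<sigma>)"
  "tm_ok R \<Gamma> t A \<Longrightarrow> \<forall>\<Delta> \<sigma>. sub_ok R \<Delta> \<sigma> \<Gamma> \<longrightarrow> tm_ok R \<Delta> (subst_tm t \<sigma>) (subst_ty A \<sigma>)"
  "sub_ok R \<Gamma> \<tau> \<Theta> \<Longrightarrow> \<forall>\<Delta> \<sigma>. sub_ok R \<Delta> \<sigma> \<Gamma> \<longrightarrow> sub_ok R \<Delta> (comp_sub \<tau> \<sigma>) \<Theta>"
  "eq_ty R \<Gamma> A B \<Longrightarrow> \<forall>\<Delta> \<sigma>. sub_ok R \<Delta> \<sigma> \<Gamma> \<longrightarrow> eq_ty R \<Delta> (subst_ty A \<sigma>) (subst_ty B \<sigma>)"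
  "eq_tm R \<Gamma> s t \<Longrightarrow> \<forall>\<Delta> \<sigma>. sub_ok R \<Delta> \<sigma> \<Gamma> \<longrightarrow> eq_tm R \<Delta> (subst_tm s \<sigma>) (subst_tm t \<sigma>)"
  "eq_sub R \<Theta> \<Gamma> \<rho> \<tau> \<Longrightarrow> \<forall>\<Delta> \<sigma>. sub_ok R \<Delta> \<sigma> \<Gamma> \<longrightarrow> eq_sub R \<Theta> \<Delta> (comp_sub \<rho> \<sigma>) (comp_sub \<tau> \<sigma>)"
proof (induction rule: ctx_ok_ty_ok_tm_ok_sub_ok_eq_ty_eq_tm_eq_sub.inducts)
  case (ty_Star \<Gamma>)
  then show ?case
    using judgements_raw(4)[OF R] raw_scoped(4) by (fastforce intro: ctx_ok_ty_ok_tm_ok_sub_ok_eq_ty_eq_tm_eq_sub.ty_Star)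
next
  case (ty_Arr \<Gamma> A s t)
  then show ?case by (auto intro: ctx_ok_ty_ok_tm_ok_sub_ok_eq_ty_eq_tm_eq_sub.ty_Arr)
next
  case (tm_Var \<Gamma> i)
  then show ?case by (auto intro: sub_ok_nth[OF R])
next
  case (tm_Coh T s A t \<Gamma> \<sigma>)
  show ?case
  proof (intro allI impI)
    fix \<Delta> \<rho> assume \<rho>: "sub_ok R \<Delta> \<rho> \<Gamma>"
    have "is_ty \<lfloor>T\<rfloor>\<^sub>c (Arr s A t)" "is_sub \<lfloor>T\<rfloor>\<^sub>c \<Gamma> \<sigma>"
      using judgements_raw(2)[OF R tm_Coh(1)] judgements_raw(4)[OF R tm_Coh(3)] .
    then have "fv_ty (Arr s A t) \<subseteq> {..<length \<sigma>}" using raw_scoped(2,4) by fastforce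
    then have eq: "subst_ty (subst_ty (Arr s A t) \<sigma>) \<rho> = subst_ty (Arr s A t) (comp_sub \<sigma> \<rho>)"
      by (rule subst_comp(1)[symmetric])
    have "tm_ok R \<Delta> (Coh \<lfloor>T\<rfloor>\<^sub>c (Arr s A t) (comp_sub \<sigma> \<rho>)) (subst_ty (Arr s A t) (comp_sub \<sigma> \<rho>))"
      using tm_Coh \<rho> by (intro ctx_ok_ty_ok_tm_ok_sub_ok_eq_ty_eq_tm_eq_sub.tm_Coh) auto
    then show "tm_ok R \<Delta> (subst_tm (Coh \<lfloor>T\<rfloor>\<^sub>c (Arr s A t) \<sigma>) \<rho>) (subst_ty (subst_ty (Arr s A t) \<sigma>) \<rho>)"
      unfolding eq by (simp add: comp_sub_def)
  qed
next
  case (tm_conv \<Gamma> s A B)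
  then show ?case by (blast intro: ctx_ok_ty_ok_tm_ok_sub_ok_eq_ty_eq_tm_eq_sub.tm_conv)
next
  case (sub_empty \<Gamma>)
  show ?case
    using judgements_raw(4)[OF R] raw_scoped(4)
    by (fastforce simp: comp_sub_def intro: ctx_ok_ty_ok_tm_ok_sub_ok_eq_ty_eq_tm_eq_sub.sub_empty)
next
  case (sub_ext \<Gamma> \<tau> \<Theta> A t)
  show ?case
  proof (intro allI impI)
    fix \<Delta> \<rho> assume \<rho>: "sub_ok R \<Delta> \<rho> \<Gamma>"
    have "is_ty \<Theta> A" "is_sub \<Theta> \<Gamma> \<tau>"
      using judgements_raw(2)[OF R sub_ext(3)] judgements_raw(4)[OF R sub_ext(1)] .
    then have "fv_ty A \<subseteq> {..<length \<tau>}" using raw_scoped(2,4) by fastforce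
    then have eq: "subst_ty A (comp_sub \<tau> \<rho>) = subst_ty (subst_ty A \<tau>) \<rho>"
      by (rule subst_comp(1))
    have "sub_ok R \<Delta> (comp_sub \<tau> \<rho> @ [subst_tm t \<rho>]) (\<Theta> @ [A])"
      using sub_ext \<rho> by (intro ctx_ok_ty_ok_tm_ok_sub_ok_eq_ty_eq_tm_eq_sub.sub_ext) (auto simp: eq)
    then show "sub_ok R \<Delta> (comp_sub (\<tau> @ [t]) \<rho>) (\<Theta> @ [A])"
      by (simp add: comp_sub_def)
  qed
next
  case (eq_ty_refl \<Gamma> A)
  then show ?case
    using judgements_raw(4)[OF R] raw_subst(2)
    by (blast intro: ctx_ok_ty_ok_tm_ok_sub_ok_eq_ty_eq_tm_eq_sub.eq_ty_refl)
next
  case (eq_ty_sym \<Gamma> A B)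
  then show ?case by (blast intro: ctx_ok_ty_ok_tm_ok_sub_ok_eq_ty_eq_tm_eq_sub.eq_ty_sym)
next
  case (eq_ty_trans \<Gamma> A B C)
  then show ?case by (blast intro: ctx_ok_ty_ok_tm_ok_sub_ok_eq_ty_eq_tm_eq_sub.eq_ty_trans)
next
  case (eq_ty_Arr \<Gamma> s s' A A' t t')
  then show ?case by (auto intro: ctx_ok_ty_ok_tm_ok_sub_ok_eq_ty_eq_tm_eq_sub.eq_ty_Arr)
next
  case (eq_tm_refl \<Gamma> s)
  then show ?case
    using judgements_raw(4)[OF R] raw_subst(3)
    by (blast intro: ctx_ok_ty_ok_tm_ok_sub_ok_eq_ty_eq_tm_eq_sub.eq_tm_refl)
next
  case (eq_tm_sym \<Gamma> s t)
  then show ?case by (blast intro: ctx_ok_ty_ok_tm_ok_sub_ok_eq_ty_eq_tm_eq_sub.eq_tm_sym)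
next
  case (eq_tm_trans \<Gamma> s t u)
  then show ?case by (blast intro: ctx_ok_ty_ok_tm_ok_sub_ok_eq_ty_eq_tm_eq_sub.eq_tm_trans)
next
  case (eq_tm_Coh \<Delta> A B \<Gamma> \<sigma> \<tau>)
  then show ?case
    by (auto simp: comp_sub_def intro: ctx_ok_ty_ok_tm_ok_sub_ok_eq_ty_eq_tm_eq_sub.eq_tm_Coh)
next
  case (eq_tm_gen \<Gamma> s t A)
  show ?case
  proof (intro allI impI)
    fix \<Delta> \<rho> assume \<rho>: "sub_ok R \<Delta> \<rho> \<Gamma>"
    then have "(\<Delta>, subst_tm s \<rho>, subst_tm t \<rho>) \<in> R"
      using tame eq_tm_gen(1) unfolding tame_def by fast
    then show "eq_tm R \<Delta> (subst_tm s \<rho>) (subst_tm t \<rho>)"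
      using eq_tm_gen(3) \<rho> by (blast intro: ctx_ok_ty_ok_tm_ok_sub_ok_eq_ty_eq_tm_eq_sub.eq_tm_gen)
  qed
next
  case (eq_sub_refl \<Delta> \<Gamma> \<sigma>)
  then show ?case
    using judgements_raw(4)[OF R] raw_subst(4)
    by (blast intro: ctx_ok_ty_ok_tm_ok_sub_ok_eq_ty_eq_tm_eq_sub.eq_sub_refl)
next
  case (eq_sub_sym \<Delta> \<Gamma> \<sigma> \<tau>)
  then show ?case by (blast intro: ctx_ok_ty_ok_tm_ok_sub_ok_eq_ty_eq_tm_eq_sub.eq_sub_sym)
next
  case (eq_sub_trans \<Delta> \<Gamma> \<sigma> \<tau> \<rho>)
  then show ?case by (blast intro: ctx_ok_ty_ok_tm_ok_sub_ok_eq_ty_eq_tm_eq_sub.eq_sub_trans)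
next
  case (eq_sub_empty \<Gamma>)
  show ?case
    using judgements_raw(4)[OF R] raw_scoped(4)
    by (fastforce simp: comp_sub_def intro: ctx_ok_ty_ok_tm_ok_sub_ok_eq_ty_eq_tm_eq_sub.eq_sub_empty)
next
  case (eq_sub_ext \<Delta> \<Gamma> \<sigma> \<tau> A s t)
  then show ?case
    by (auto simp: comp_sub_def intro!: ctx_ok_ty_ok_tm_ok_sub_ok_eq_ty_eq_tm_eq_sub.eq_sub_ext)
qed simp_all

lemmas comp_sub_ok = judgements_subst(4)[rule_format]

lemma eq_sub_nth:
  assumes R: "eq_generators R"
  shows "eq_sub R \<Delta> \<Gamma> \<sigma> \<tau> \<Longrightarrow> i < length \<Delta> \<Longrightarrow> eq_tm R \<Gamma> (\<sigma> ! i) (\<tau> ! i)"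
proof (induction \<Delta> \<Gamma> \<sigma> \<tau> rule: ctx_ok_ty_ok_tm_ok_sub_ok_eq_ty_eq_tm_eq_sub.inducts(7)
   [where ?P1.0 = "\<lambda>_. True" and ?P2.0 = "\<lambda>_ _. True" and ?P3.0 = "\<lambda>_ _ _. True"
      and ?P4.0 = "\<lambda>_ _ _. True" and ?P5.0 = "\<lambda>_ _ _. True" and ?P6.0 = "\<lambda>_ _ _. True"])
  case (eq_sub_refl \<Delta> \<Gamma> \<sigma>)
  then show ?case by (auto intro: eq_tm_refl is_sub_nth)
next
  case (eq_sub_ext \<Delta> \<Gamma> \<sigma> \<tau> A s t)
  then have "length \<sigma> = length \<Delta>" "length \<tau> = length \<Delta>"
    using judgements_raw(7)[OF R] raw_scoped(4) by blast+
  with eq_sub_ext show ?case by (auto simp: nth_append less_Suc_eq)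
qed (auto intro: eq_tm_sym eq_tm_trans)

lemma eq_subI:
  "is_ctx \<Delta> \<Longrightarrow> is_ctx \<Gamma> \<Longrightarrow> length \<sigma> = length \<Delta> \<Longrightarrow> length \<tau> = length \<Delta>
    \<Longrightarrow> (\<And>i. i < length \<Delta> \<Longrightarrow> eq_tm R \<Gamma> (\<sigma> ! i) (\<tau> ! i)) \<Longrightarrow> eq_sub R \<Delta> \<Gamma> \<sigma> \<tau>"
proof (induction \<Delta> arbitrary: \<sigma> \<tau> rule: rev_induct)
  case Nil
  then show ?case by (simp add: eq_sub_empty)
next
  case (snoc A \<Delta>)
  obtain \<sigma>' s where \<sigma>: "\<sigma> = \<sigma>' @ [s]"
    using snoc.prems(3) by (cases \<sigma> rule: rev_cases) auto
  obtain \<tau>' t where \<tau>: "\<tau> = \<tau>' @ [t]"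
    using snoc.prems(4) by (cases \<tau> rule: rev_cases) auto
  have len: "length \<sigma>' = length \<Delta>" "length \<tau>' = length \<Delta>" using snoc.prems(3,4) \<sigma> \<tau> by auto
  have "eq_tm R \<Gamma> (\<sigma>' ! i) (\<tau>' ! i)" if "i < length \<Delta>" for i
    using snoc.prems(5)[of i] that by (simp add: \<sigma> \<tau> nth_append len)
  moreover have "eq_tm R \<Gamma> s t"
    using snoc.prems(5)[of "length \<Delta>"] by (simp add: \<sigma> \<tau> nth_append len)
  ultimately show ?case
    unfolding \<sigma> \<tau> using snoc is_ctx_snocD[OF snoc.prems(1)] len by (auto intro!: eq_sub_ext)
qed

text \<open>The induction runs over raw syntax, as every constructor has a congruence rule that asks
  for no typing; \<sigma> and \<tau> are compared at the variables. The equation \<Gamma>' =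
  \<Gamma> stays in the claim because \<Gamma> is already fixed by the assumed equality.\<close>

lemma subst_eq_sub:
  assumes R: "eq_generators R" and eq: "eq_sub R \<Gamma> \<Delta> \<sigma> \<tau>"
  shows
  "is_ctx \<Gamma> \<Longrightarrow> True"
  "is_ty \<Gamma>' A \<Longrightarrow> \<Gamma>' = \<Gamma> \<longrightarrow> eq_ty R \<Delta> (subst_ty A \<sigma>) (subst_ty A \<tau>)"
  "is_tm \<Gamma>' t \<Longrightarrow> \<Gamma>' = \<Gamma> \<longrightarrow> eq_tm R \<Delta> (subst_tm t \<sigma>) (subst_tm t \<tau>)"
  "is_sub \<Theta> \<Gamma>' \<rho> \<Longrightarrow> \<Gamma>' = \<Gamma> \<longrightarrow> eq_sub R \<Theta> \<Delta> (comp_sub \<rho> \<sigma>) (comp_sub \<rho> \<tau>)"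
proof (induction rule: is_ctx_is_ty_is_tm_is_sub.inducts)
  case (is_ty_Star \<Gamma>')
  have "is_ctx \<Delta>" using judgements_raw(7)[OF R eq] raw_scoped(4) by blast
  then show ?case by (auto intro: eq_ty_refl is_ctx_is_ty_is_tm_is_sub.is_ty_Star)
next
  case (is_sub_empty \<Gamma>')
  have "is_ctx \<Delta>" using judgements_raw(7)[OF R eq] raw_scoped(4) by blast
  then show ?case by (auto simp: comp_sub_def intro: eq_sub_empty)
next
  case (is_tm_Coh \<Theta> A \<Gamma>' \<rho>)
  then show ?case by (auto simp: comp_sub_def intro: eq_tm_Coh eq_ty_refl)
next
  case (is_tm_Var \<Gamma>' i)
  then show ?case using eq_sub_nth[OF R eq] by auto
next
  case (is_sub_ext \<Theta> \<Gamma>' \<rho> A t)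
  then show ?case by (auto simp: comp_sub_def intro!: eq_sub_ext)
qed (auto intro: eq_ty_Arr)


section \<open>The syntactic category and a pushout criterion\<close>

definition ren :: "ctx \<Rightarrow> ctx \<Rightarrow> sub \<Rightarrow> bool" where
  "ren \<Gamma> \<Delta> \<rho> \<longleftrightarrow> length \<rho> = length \<Gamma> \<and>
     (\<forall>i<length \<Gamma>. \<exists>v<length \<Delta>. \<rho> ! i = Var v \<and> \<Delta> ! v = subst_ty (\<Gamma> ! i) \<rho>)"

lemma ren_length: "ren \<Gamma> \<Delta> \<rho> \<Longrightarrow> length \<rho> = length \<Gamma>"
  by (simp add: ren_def)

lemma ren_nthE:
  assumes "ren \<Gamma> \<Delta> \<rho>" "i < length \<Gamma>"
  obtains v where "v < length \<Delta>" "\<rho> ! i = Var v" "\<Delta> ! v = subst_ty (\<Gamma> ! i) \<rho>"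
  using assms by (auto simp: ren_def)

lemma ren_scoped: "ren \<Gamma> \<Delta> \<rho> \<Longrightarrow> scoped (length \<Delta>) \<rho>"
  by (rule scopedI) (auto simp: ren_def)

lemma ren_comp:
  assumes "ren \<Gamma> \<Delta> \<rho>" "ren \<Delta> \<Theta> \<tau>" "scoped_ctx \<Gamma>"
  shows "ren \<Gamma> \<Theta> (comp_sub \<rho> \<tau>)"
  unfolding ren_def
proof (intro conjI allI impI)
  fix i assume i: "i < length \<Gamma>"
  obtain v where v: "v < length \<Delta>" "\<rho> ! i = Var v" "\<Delta> ! v = subst_ty (\<Gamma> ! i) \<rho>"
    using assms(1) i by (rule ren_nthE)
  obtain w where w: "w < length \<Theta>" "\<tau> ! v = Var w" "\<Theta> ! w = subst_ty (\<Delta> ! v) \<tau>"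
    using assms(2) v(1) by (rule ren_nthE)
  have "\<Theta> ! w = subst_ty (\<Gamma> ! i) (comp_sub \<rho> \<tau>)"
    using w(3) v(3) scoped_ctx_nth[OF assms(3) i] ren_length[OF assms(1)] by (simp add: subst_comp)
  then show "\<exists>w<length \<Theta>. comp_sub \<rho> \<tau> ! i = Var w \<and> \<Theta> ! w = subst_ty (\<Gamma> ! i) (comp_sub \<rho> \<tau>)"
    using v w i ren_length[OF assms(1)] by auto
qed (simp add: ren_length[OF assms(1)])

lemma ren_id: "scoped_ctx \<Gamma> \<Longrightarrow> ren \<Gamma> \<Gamma> (id_sub \<Gamma>)"
  by (simp add: ren_def subst_id scoped_ctx_nth)

text \<open>Types match syntactically, so the variable rule alone types every entry, without
  conversion.\<close>

lemma ren_sub_ok: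
  assumes "eq_generators R" "ctx_ok R \<Gamma>" "ctx_ok R \<Delta>" "ren \<Gamma> \<Delta> \<rho>"
  shows "sub_ok R \<Delta> \<rho> \<Gamma>"
proof (rule sub_okI[OF assms(1,2)])
  fix i assume "i < length \<Gamma>"
  with assms(4) obtain v where "v < length \<Delta>" "\<rho> ! i = Var v" "\<Delta> ! v = subst_ty (\<Gamma> ! i) \<rho>"
    by (rule ren_nthE)
  then show "tm_ok R \<Delta> (\<rho> ! i) (subst_ty (\<Gamma> ! i) \<rho>)"
    using tm_Var[OF assms(3)] by metis
qed (use assms judgements_raw(1) ren_length in auto)

section \<open>Morphisms as classes of substitutions\<close>

lemma Obj_Catt: "\<Gamma> \<in> Obj (Catt R) \<longleftrightarrow> ctx_ok R \<Gamma>"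
  by (simp add: Catt_def)

context
  fixes R :: eq_gens
  assumes gens: "eq_generators R" and tame: "tame R"
begin

lemma sub_rel_equiv: "equiv {\<sigma>. sub_ok R \<Gamma> \<sigma> \<Delta>} (sub_rel R \<Delta> \<Gamma>)"
proof (rule equivI)
  show "refl_on {\<sigma>. sub_ok R \<Gamma> \<sigma> \<Delta>} (sub_rel R \<Delta> \<Gamma>)"
    by (auto simp: refl_on_def sub_rel_def intro: eq_sub_refl judgements_raw(4)[OF gens])
  show "sym (sub_rel R \<Delta> \<Gamma>)"
    by (auto simp: sym_def sub_rel_def intro: eq_sub_sym)
  show "trans (sub_rel R \<Delta> \<Gamma>)"
    by (auto simp: trans_def sub_rel_def intro: eq_sub_trans)
qed (auto simp: sub_rel_def)

lemma sub_class_eq_iff: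
  assumes "sub_ok R \<Gamma> \<sigma> \<Delta>" "sub_ok R \<Gamma> \<tau> \<Delta>"
  shows "sub_class R \<Delta> \<Gamma> \<sigma> = sub_class R \<Delta> \<Gamma> \<tau> \<longleftrightarrow> eq_sub R \<Delta> \<Gamma> \<sigma> \<tau>"
  unfolding sub_class_def using eq_equiv_class_iff[OF sub_rel_equiv, of \<sigma> \<Gamma> \<Delta> \<tau>] assms
  by (simp add: sub_rel_def)

lemma sub_class_Hom: "sub_ok R \<Gamma> \<sigma> \<Delta> \<Longrightarrow> sub_class R \<Delta> \<Gamma> \<sigma> \<in> Hom (Catt R) \<Delta> \<Gamma>"
  by (auto simp: Catt_def sub_class_def intro: quotientI)

lemma HomE:
  assumes "f \<in> Hom (Catt R) \<Delta> \<Gamma>"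
  obtains \<sigma> where "sub_ok R \<Gamma> \<sigma> \<Delta>" "f = sub_class R \<Delta> \<Gamma> \<sigma>"
  using assms by (auto simp: Catt_def sub_class_def elim!: quotientE)

lemma eq_sub_comp:
  assumes "sub_ok R \<Gamma> \<sigma> \<Delta>" "sub_ok R \<Gamma> \<sigma>' \<Delta>" "eq_sub R \<Delta> \<Gamma> \<sigma> \<sigma>'"
    and "sub_ok R \<Theta> \<tau> \<Gamma>" "eq_sub R \<Gamma> \<Theta> \<tau> \<tau>'"
  shows "eq_sub R \<Delta> \<Theta> (comp_sub \<sigma> \<tau>) (comp_sub \<sigma>' \<tau>')"
proof (rule eq_sub_trans)
  show "eq_sub R \<Delta> \<Theta> (comp_sub \<sigma> \<tau>) (comp_sub \<sigma>' \<tau>)"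
    using judgements_subst(7)[OF gens tame assms(3)] assms(4) by blast
  show "eq_sub R \<Delta> \<Theta> (comp_sub \<sigma>' \<tau>) (comp_sub \<sigma>' \<tau>')"
    using subst_eq_sub(4)[OF gens assms(5)] judgements_raw(4)[OF gens assms(2)] by blast
qed

text \<open>Composition is a union over all pairs of representatives. It collapses to a single class
  because all these composites are equal to one another and both classes are inhabited.\<close>

lemma Comp_class:
  assumes "sub_ok R \<Gamma> \<sigma> \<Delta>" "sub_ok R \<Theta> \<tau> \<Gamma>"
  shows "Comp (Catt R) \<Delta> \<Gamma> \<Theta> (sub_class R \<Delta> \<Gamma> \<sigma>) (sub_class R \<Gamma> \<Theta> \<tau>)
    = sub_class R \<Delta> \<Theta> (comp_sub \<sigma> \<tau>)"
proof -
  have "sub_class R \<Delta> \<Theta> (comp_sub \<sigma>' \<tau>') = sub_class R \<Delta> \<Theta> (comp_sub \<sigma> \<tau>)"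
    if "\<sigma>' \<in> sub_class R \<Delta> \<Gamma> \<sigma>" "\<tau>' \<in> sub_class R \<Gamma> \<Theta> \<tau>" for \<sigma>' \<tau>'
  proof -
    have \<sigma>': "sub_ok R \<Gamma> \<sigma>' \<Delta>" "eq_sub R \<Delta> \<Gamma> \<sigma> \<sigma>'"
      and \<tau>': "sub_ok R \<Theta> \<tau>' \<Gamma>" "eq_sub R \<Gamma> \<Theta> \<tau> \<tau>'"
      using that by (auto simp: sub_class_def sub_rel_def)
    have "eq_sub R \<Delta> \<Theta> (comp_sub \<sigma>' \<tau>') (comp_sub \<sigma> \<tau>)"
      using eq_sub_comp[OF assms(1) \<sigma>' assms(2) \<tau>'(2)] by (rule eq_sub_sym)
    moreover have "sub_ok R \<Theta> (comp_sub \<sigma>' \<tau>') \<Delta>" "sub_ok R \<Theta> (comp_sub \<sigma> \<tau>) \<Delta>"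
      using comp_sub_ok[OF gens tame] assms \<sigma>' \<tau>' by blast+
    ultimately show ?thesis by (simp add: sub_class_eq_iff)
  qed
  moreover have "\<sigma> \<in> sub_class R \<Delta> \<Gamma> \<sigma>" "\<tau> \<in> sub_class R \<Gamma> \<Theta> \<tau>"
    using assms by (auto simp: sub_class_def sub_rel_def intro: eq_sub_refl judgements_raw(4)[OF gens])
  ultimately have "(\<Union>\<sigma>'\<in>sub_class R \<Delta> \<Gamma> \<sigma>. \<Union>\<tau>'\<in>sub_class R \<Gamma> \<Theta> \<tau>.
      sub_class R \<Delta> \<Theta> (comp_sub \<sigma>' \<tau>')) = sub_class R \<Delta> \<Theta> (comp_sub \<sigma> \<tau>)"
    by blast
  then show ?thesis by (simp add: Catt_def)
qed

end

text \<open>Of j and \<kappa> only scoping is asked, as both may send variables to coherences; on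
  the image of i, \<open>commutes\<close> fixes \<kappa>. Commutation and the matching of types hold
  on the nose and R does not occur, so operations on raw syntax such as suspension and wedge can
  preserve the conditions.\<close>

locale gluing =
  fixes D S T Q :: ctx and i j \<kappa> \<iota> :: sub
  assumes i_ren: "ren D S i"
    and \<iota>_ren: "ren T Q \<iota>"
    and \<iota>_distinct: "distinct \<iota>"
    and j_length: "length j = length D" and j_scoped: "scoped (length T) j"
    and \<kappa>_length: "length \<kappa> = length S" and \<kappa>_scoped: "scoped (length Q) \<kappa>"
    and commutes: "comp_sub i \<kappa> = comp_sub j \<iota>"
    and fresh: "\<And>y. y < length S \<Longrightarrow> Var y \<notin> set i \<Longrightarrow>
      \<exists>v<length Q. \<kappa> ! y = Var v \<and> Q ! v = subst_ty (S ! y) \<kappa> \<and> Var v \<notin> set \<iota>"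
    and fresh_inj: "\<And>y z. y < length S \<Longrightarrow> z < length S \<Longrightarrow> Var y \<notin> set i \<Longrightarrow> Var z \<notin> set i \<Longrightarrow>
      \<kappa> ! y = \<kappa> ! z \<Longrightarrow> y = z"
    and cover: "\<And>v. v < length Q \<Longrightarrow> Var v \<notin> set \<iota> \<Longrightarrow> \<exists>y<length S. Var y \<notin> set i \<and> \<kappa> ! y = Var v"
begin

lemma \<kappa>_on_i:
  assumes "y < length S" "Var y \<in> set i"
  obtains d where "d < length D" "i ! d = Var y" "S ! y = subst_ty (D ! d) i"
    "\<kappa> ! y = subst_tm (j ! d) \<iota>"
proof -
  obtain d where d: "d < length D" "i ! d = Var y"
    using assms(2) ren_length[OF i_ren] by (auto simp: in_set_conv_nth)
  have "S ! y = subst_ty (D ! d) i"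
    using i_ren d by (auto elim: ren_nthE)
  moreover have "comp_sub i \<kappa> ! d = comp_sub j \<iota> ! d"
    by (simp add: commutes)
  then have "\<kappa> ! y = subst_tm (j ! d) \<iota>"
    using d j_length ren_length[OF i_ren] by simp
  ultimately show ?thesis using that d by blast
qed

text \<open>Off the image of i the variable rule applies. On it, \<kappa> is j followed by \<iota>,
  so its typing is that of j carried along \<iota>, and \<open>commutes\<close> identifies the two
  ways of computing the type.\<close>

lemma \<kappa>_ok:
  assumes gens: "eq_generators R" and tame: "tame R"
    and ok: "ctx_ok R D" "ctx_ok R S" "ctx_ok R T" "ctx_ok R Q" and j_ok: "sub_ok R T j D"
  shows "sub_ok R Q \<kappa> S"
proof (rule sub_okI[OF gens ok(2) judgements_raw(1)[OF gens ok(4)] \<kappa>_length])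
  fix y assume y: "y < length S"
  have \<iota>_ok: "sub_ok R Q \<iota> T"
    using gens ok(3,4) \<iota>_ren by (rule ren_sub_ok)
  show "tm_ok R Q (\<kappa> ! y) (subst_ty (S ! y) \<kappa>)"
  proof (cases "Var y \<in> set i")
    case False
    with fresh[OF y] obtain v where "v < length Q" "\<kappa> ! y = Var v" "Q ! v = subst_ty (S ! y) \<kappa>"
      by blast
    then show ?thesis using tm_Var[OF ok(4)] by metis
  next
    case True
    from y True obtain d where d: "d < length D" "S ! y = subst_ty (D ! d) i"
      "\<kappa> ! y = subst_tm (j ! d) \<iota>" by (rule \<kappa>_on_i)
    have fv: "fv_ty (D ! d) \<subseteq> {..<length D}"
      using scoped_ctx_nth[OF raw_scoped(1)[OF judgements_raw(1)[OF gens ok(1)]] d(1)] .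
    have "tm_ok R Q (subst_tm (j ! d) \<iota>) (subst_ty (subst_ty (D ! d) j) \<iota>)"
      using judgements_subst(3)[OF gens tame sub_ok_nth[OF gens j_ok d(1)]] \<iota>_ok by blast
    also have "subst_ty (subst_ty (D ! d) j) \<iota> = subst_ty (D ! d) (comp_sub j \<iota>)"
      using fv j_length by (simp add: subst_comp)
    also have "\<dots> = subst_ty (S ! y) \<kappa>"
      using fv ren_length[OF i_ren] by (simp add: d(2) subst_comp flip: commutes)
    finally show ?thesis by (simp add: d(3))
  qed
qed

lemma pushout:
  assumes gens: "eq_generators R" and tame: "tame R"
    and ok: "ctx_ok R D" "ctx_ok R S" "ctx_ok R T" "ctx_ok R Q" and j_ok: "sub_ok R T j D"
  shows "pushout_square (Catt R) D S T Q
    (sub_class R D S i) (sub_class R D T j) (sub_class R S Q \<kappa>) (sub_class R T Q \<iota>)"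
proof -
  note ctx_raw = judgements_raw(1)[OF gens]
  note sc = raw_scoped(1)[OF ctx_raw]
  have i_ok: "sub_ok R S i D" using gens ok(1,2) i_ren by (rule ren_sub_ok)
  have \<iota>_ok: "sub_ok R Q \<iota> T" using gens ok(3,4) \<iota>_ren by (rule ren_sub_ok)
  have k_ok: "sub_ok R Q \<kappa> S" using assms by (rule \<kappa>_ok)
  note lens = ren_length[OF i_ren] ren_length[OF \<iota>_ren] j_length \<kappa>_length
  note Comp = Comp_class[OF gens tame] and class_eq = sub_class_eq_iff[OF gens tame]
    and comp_ok = comp_sub_ok[OF gens tame]
  have commutative: "commutative_square (Catt R) D S T Q
    (sub_class R D S i) (sub_class R D T j) (sub_class R S Q \<kappa>) (sub_class R T Q \<iota>)"
    unfolding commutative_square_def using ok i_ok j_ok k_ok \<iota>_ok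
    by (simp add: Obj_Catt sub_class_Hom[OF gens tame] Comp commutes)
  have "\<exists>!u. u \<in> Hom (Catt R) Q Z \<and> Comp (Catt R) S Q Z (sub_class R S Q \<kappa>) u = h
      \<and> Comp (Catt R) T Q Z (sub_class R T Q \<iota>) u = k"
    if sq: "commutative_square (Catt R) D S T Z (sub_class R D S i) (sub_class R D T j) h k" for Z h k
  proof -
    have Z: "ctx_ok R Z" using sq by (simp add: commutative_square_def Obj_Catt)
    have "h \<in> Hom (Catt R) S Z" "k \<in> Hom (Catt R) T Z"
      using sq by (simp_all add: commutative_square_def)
    then obtain h0 k0 where h0: "sub_ok R Z h0 S" "h = sub_class R S Z h0"
      and k0: "sub_ok R Z k0 T" "k = sub_class R T Z k0"
      by (meson HomE[OF gens tame])
    have "eq_sub R D Z (comp_sub i h0) (comp_sub j k0)"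
      using sq i_ok j_ok h0 k0 comp_ok
      by (simp add: commutative_square_def Comp class_eq)
    then have hk: "eq_tm R Z (subst_tm (i ! d) h0) (subst_tm (j ! d) k0)" if "d < length D" for d
      using eq_sub_nth[OF gens, of D Z _ _ d] that lens by fastforce
    have h0_raw: "is_sub S Z h0" and k0_raw: "is_sub T Z k0"
      using judgements_raw(4)[OF gens] h0 k0 by blast+
    then have h0_len: "length h0 = length S" and k0_len: "length k0 = length T"
      using raw_scoped(4) by blast+
    \<comment> \<open>Both choices are of unique elements: \<open>\<iota>_distinct\<close> and
      \<open>fresh_inj\<close> rule out a second preimage, and \<open>cover\<close> provides one for
      each variable outside T.\<close>
    define u where "u = map (\<lambda>v. if Var v \<in> set \<iota> then k0 ! (SOME x. x < length T \<and> \<iota> ! x = Var v)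
      else h0 ! (SOME y. y < length S \<and> Var y \<notin> set i \<and> \<kappa> ! y = Var v)) [0..<length Q]"
    have u_len: "length u = length Q" by (simp add: u_def)
    have u_\<iota>: "u ! v = k0 ! x" if "v < length Q" "x < length T" "\<iota> ! x = Var v" for v x
    proof -
      have "(SOME x. x < length T \<and> \<iota> ! x = Var v) = x"
      proof (rule some_equality)
        fix x' assume "x' < length T \<and> \<iota> ! x' = Var v"
        then show "x' = x" using that \<iota>_distinct lens by (metis nth_eq_iff_index_eq)
      qed (use that in simp)
      moreover have "Var v \<in> set \<iota>" using that lens by (metis nth_mem)
      ultimately show ?thesis using that by (simp add: u_def)
    qed
    have u_\<kappa>: "u ! v = h0 ! y"
      if "v < length Q" "y < length S" "Var y \<notin> set i" "\<kappa> ! y = Var v" "Var v \<notin> set \<iota>" for v y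
    proof -
      have "(SOME y. y < length S \<and> Var y \<notin> set i \<and> \<kappa> ! y = Var v) = y"
        by (rule some_equality) (use that fresh_inj in auto)
      then show ?thesis using that by (simp add: u_def)
    qed
    have \<iota>_cases: "\<exists>x<length T. \<iota> ! x = Var v" if "Var v \<in> set \<iota>" for v
      using that lens by (metis in_set_conv_nth)
    have u_raw: "is_tm Z (u ! v)" if "v < length Q" for v
    proof (cases "Var v \<in> set \<iota>")
      case True
      then show ?thesis using \<iota>_cases u_\<iota>[OF that] is_sub_nth[OF k0_raw] by metis
    next
      case False
      then show ?thesis using cover[OF that False] u_\<kappa>[OF that] is_sub_nth[OF h0_raw] by metis
    qed
    have \<iota>u: "comp_sub \<iota> u = k0"
    proof (rule nth_equalityI)
      fix x assume x: "x < length (comp_sub \<iota> u)"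
      then have x': "x < length T" by (simp add: lens)
      with \<iota>_ren obtain v where "v < length Q" "\<iota> ! x = Var v" by (rule ren_nthE)
      then show "comp_sub \<iota> u ! x = k0 ! x" using u_\<iota> x' lens by simp
    qed (simp add: lens k0_len)
    \<comment> \<open>Equality modulo R is unavoidable here: on the disc \<kappa> followed by u
      computes to j followed by k0, which the outer square relates to i followed by h0 only up to
      equality. Off the disc the two sides coincide.\<close>
    have \<kappa>u: "eq_tm R Z (subst_tm (\<kappa> ! y) u) (h0 ! y)" if y: "y < length S" for y
    proof (cases "Var y \<in> set i")
      case True
      with y obtain d where d: "d < length D" "i ! d = Var y" "\<kappa> ! y = subst_tm (j ! d) \<iota>"
        by (rule \<kappa>_on_i)
      have "subst_tm (\<kappa> ! y) u = subst_tm (j ! d) (comp_sub \<iota> u)"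
        using scoped_nth[OF j_scoped, of d] d lens by (simp add: subst_comp)
      then show ?thesis using hk[OF d(1)] d(2) by (simp add: \<iota>u eq_tm_sym)
    next
      case False
      with fresh[OF y] obtain v where "v < length Q" "\<kappa> ! y = Var v" "Var v \<notin> set \<iota>" by blast
      then show ?thesis
        using u_\<kappa>[OF _ y False] is_sub_nth[OF h0_raw y] by (simp add: eq_tm_refl)
    qed
    have \<kappa>u_eq: "eq_sub R S Z (comp_sub \<kappa> u) h0"
      using \<kappa>u lens h0_len ctx_raw ok Z by (intro eq_subI) auto
    have u_ok: "sub_ok R Z u Q"
    proof (rule sub_okI[OF gens ok(4) ctx_raw[OF Z] u_len])
      fix v assume v: "v < length Q"
      show "tm_ok R Z (u ! v) (subst_ty (Q ! v) u)"
      proof (cases "Var v \<in> set \<iota>")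
        case True
        then obtain x where x: "x < length T" "\<iota> ! x = Var v" using \<iota>_cases by blast
        then have "Q ! v = subst_ty (T ! x) \<iota>" using \<iota>_ren by (auto elim: ren_nthE)
        then have "subst_ty (Q ! v) u = subst_ty (T ! x) (comp_sub \<iota> u)"
          using scoped_ctx_nth[OF sc[OF ok(3)] x(1)] lens by (simp add: subst_comp)
        then show ?thesis using sub_ok_nth[OF gens k0(1) x(1)] by (simp add: u_\<iota>[OF v x] \<iota>u)
      next
        case False
        obtain y where y: "y < length S" "Var y \<notin> set i" "\<kappa> ! y = Var v"
          using cover[OF v False] by blast
        then have "Q ! v = subst_ty (S ! y) \<kappa>" using fresh[OF y(1,2)] by auto
        then have eq: "subst_ty (Q ! v) u = subst_ty (S ! y) (comp_sub \<kappa> u)"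
          using scoped_ctx_nth[OF sc[OF ok(2)] y(1)] lens by (simp add: subst_comp)
        \<comment> \<open>The entry taken from h0 has its type computed with h0, whereas the
          declared type is computed with \<kappa> followed by u; these types are merely equal, so
          the conversion rule is applied.\<close>
        have "eq_ty R Z (subst_ty (S ! y) h0) (subst_ty (S ! y) (comp_sub \<kappa> u))"
          using subst_eq_sub(2)[OF gens \<kappa>u_eq] is_ty_nth[OF ctx_raw[OF ok(2)] y(1)]
          by (blast intro: eq_ty_sym)
        then show ?thesis
          using tm_conv[OF sub_ok_nth[OF gens h0(1) y(1)]] by (simp add: u_\<kappa>[OF v y False] eq)
      qed
    qed
    show ?thesis
    proof (rule ex1I[of _ "sub_class R Q Z u"])
      have "eq_sub R T Z (comp_sub \<iota> u) k0"
        using k0_raw by (simp add: \<iota>u eq_sub_refl)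
      then show "sub_class R Q Z u \<in> Hom (Catt R) Q Z
          \<and> Comp (Catt R) S Q Z (sub_class R S Q \<kappa>) (sub_class R Q Z u) = h
          \<and> Comp (Catt R) T Q Z (sub_class R T Q \<iota>) (sub_class R Q Z u) = k"
        using u_ok k_ok \<iota>_ok \<kappa>u_eq h0 k0 comp_ok
        by (simp add: sub_class_Hom[OF gens tame] Comp class_eq)
    next
      fix w assume w: "w \<in> Hom (Catt R) Q Z
          \<and> Comp (Catt R) S Q Z (sub_class R S Q \<kappa>) w = h
          \<and> Comp (Catt R) T Q Z (sub_class R T Q \<iota>) w = k"
      then obtain u' where u': "sub_ok R Z u' Q" "w = sub_class R Q Z u'"
        using HomE[OF gens tame] by blast
      have h': "eq_sub R S Z (comp_sub \<kappa> u') h0" and k': "eq_sub R T Z (comp_sub \<iota> u') k0"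
        using w u' k_ok \<iota>_ok h0 k0 comp_ok by (simp_all add: Comp class_eq)
      have u'_raw: "is_sub Q Z u'" using judgements_raw(4)[OF gens u'(1)] .
      \<comment> \<open>Each variable of Q is the value of \<iota> or \<kappa> at some variable, so
        the competitor's entry there can be read off from one of the two composites.\<close>
      have "eq_tm R Z (u' ! v) (u ! v)" if v: "v < length Q" for v
      proof (cases "Var v \<in> set \<iota>")
        case True
        then obtain x where x: "x < length T" "\<iota> ! x = Var v" using \<iota>_cases by blast
        then show ?thesis using eq_sub_nth[OF gens k' x(1)] u_\<iota>[OF v x] lens by simp
      next
        case False
        obtain y where y: "y < length S" "Var y \<notin> set i" "\<kappa> ! y = Var v"
          using cover[OF v False] by blast
        then show ?thesis using eq_sub_nth[OF gens h' y(1)] u_\<kappa>[OF v y False] lens by simp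
      qed
      then have "eq_sub R Q Z u' u"
        using u_len raw_scoped(4)[OF u'_raw] by (intro eq_subI) auto
      then show "w = sub_class R Q Z u" using u' u_ok by (simp add: class_eq)
    qed
  qed
  then show ?thesis using commutative unfolding pushout_square_def by blast
qed

end


section \<open>Globular contexts, suspension and wedge\<close>

text \<open>The arrow repeats the declared type of its source, and the target has the same one, so
  such a context is well typed by construction. The first entry is forced to be a point, having no
  earlier variables.\<close>

definition globular :: "ctx \<Rightarrow> bool" where
  "globular \<Gamma> \<longleftrightarrow> \<Gamma> \<noteq> [] \<and> (\<forall>i<length \<Gamma>. \<Gamma> ! i = Star \<or>
     (\<exists>a<i. \<exists>b<i. \<Gamma> ! i = Arr (Var a) (\<Gamma> ! a) (Var b) \<and> \<Gamma> ! b = \<Gamma> ! a))"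

lemma globular_nonempty: "globular \<Gamma> \<Longrightarrow> \<Gamma> \<noteq> []"
  by (simp add: globular_def)

lemma globular_length: "globular \<Gamma> \<Longrightarrow> 0 < length \<Gamma>"
  by (simp add: globular_def)

lemma globular_zero: "globular \<Gamma> \<Longrightarrow> \<Gamma> ! 0 = Star"
  by (auto simp: globular_def)

lemma globular_cases:
  assumes "globular \<Gamma>" "i < length \<Gamma>"
  obtains "\<Gamma> ! i = Star"
  | a b where "a < i" "b < i" "\<Gamma> ! i = Arr (Var a) (\<Gamma> ! a) (Var b)" "\<Gamma> ! b = \<Gamma> ! a"
  using assms by (auto simp: globular_def)

lemma globular_scoped:
  assumes "globular \<Gamma>"
  shows "scoped_ctx \<Gamma>"
proof -
  have "i < length \<Gamma> \<longrightarrow> fv_ty (\<Gamma> ! i) \<subseteq> {..<i}" for i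
  proof (induction i rule: less_induct)
    case (less i)
    show ?case
    proof
      assume i: "i < length \<Gamma>"
      from assms i show "fv_ty (\<Gamma> ! i) \<subseteq> {..<i}"
      proof (cases rule: globular_cases)
        case (2 a b)
        then have "fv_ty (\<Gamma> ! a) \<subseteq> {..<a}" using less[of a] i by simp
        then show ?thesis using 2 by auto
      qed simp
    qed
  qed
  then show ?thesis by (simp add: scoped_ctx_def)
qed

lemma globular_ctx_ok:
  assumes gens: "eq_generators R" and \<Gamma>: "globular \<Gamma>"
  shows "ctx_ok R \<Gamma>"
proof -
  \<comment> \<open>The claim covers every prefix containing the variables before i, not just the
    shortest: the type of i contains that of some a < i, which must be typed over the same prefix.
    This generality takes the place of weakening.\<close>
  have ty: "i < length \<Gamma> \<longrightarrow> i \<le> n \<longrightarrow> ty_ok R (take n \<Gamma>) (\<Gamma> ! i)" if ok: "ctx_ok R (take n \<Gamma>)" for n i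
  proof (induction i rule: less_induct)
    case (less i)
    show ?case
    proof (intro impI)
      assume i: "i < length \<Gamma>" "i \<le> n"
      from \<Gamma> i(1) show "ty_ok R (take n \<Gamma>) (\<Gamma> ! i)"
      proof (cases rule: globular_cases)
        case 1
        then show ?thesis using judgements_raw(1)[OF gens ok] by (simp add: ty_Star)
      next
        case (2 a b)
        have "ty_ok R (take n \<Gamma>) (\<Gamma> ! a)" using less[of a] 2 i by simp
        moreover have "tm_ok R (take n \<Gamma>) (Var a) (\<Gamma> ! a)" "tm_ok R (take n \<Gamma>) (Var b) (\<Gamma> ! b)"
          using tm_Var[OF ok, of a] tm_Var[OF ok, of b] 2 i by simp_all
        ultimately show ?thesis using 2 by (simp add: ty_Arr)
      qed
    qed
  qed
  have "n \<le> length \<Gamma> \<longrightarrow> ctx_ok R (take n \<Gamma>)" for n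
  proof (induction n)
    case (Suc n)
    show ?case
      using Suc ty[of n n] ctx_ext[of R "take n \<Gamma>" "\<Gamma> ! n"] by (auto simp: take_Suc_conv_app_nth)
  qed (simp add: ctx_empty)
  from this[of "length \<Gamma>"] show ?thesis by simp
qed

lemma globular_point: "globular [Star]"
  by (simp add: globular_def)

section \<open>Suspension\<close>

lemma susp_ctx_nth [simp]:
  "susp_ctx \<Gamma> ! 0 = Star" "susp_ctx \<Gamma> ! Suc 0 = Star"
  "i < length \<Gamma> \<Longrightarrow> susp_ctx \<Gamma> ! Suc (Suc i) = susp_ty (\<Gamma> ! i)"
  by (simp_all add: susp_ctx_def)

lemma length_susp_ctx [simp]: "length (susp_ctx \<Gamma>) = Suc (Suc (length \<Gamma>))"
  by (simp add: susp_ctx_def)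

lemma susp_sub_nth [simp]:
  "susp_sub \<sigma> ! 0 = Var 0" "susp_sub \<sigma> ! Suc 0 = Var 1"
  "i < length \<sigma> \<Longrightarrow> susp_sub \<sigma> ! Suc (Suc i) = susp_tm (\<sigma> ! i)"
  by (simp_all add: susp_sub_def)

lemma length_susp_sub [simp]: "length (susp_sub \<sigma>) = Suc (Suc (length \<sigma>))"
  by (simp add: susp_sub_def)

lemma less_Suc_Suc_cases:
  assumes "i < Suc (Suc n)"
  obtains "i = 0" | "i = Suc 0" | k where "i = Suc (Suc k)" "k < n"
  using assms by (cases i; cases "i - 1") auto

lemma susp_subst:
  "fv_ty A \<subseteq> {..<length \<sigma>} \<Longrightarrow> susp_ty (subst_ty A \<sigma>) = subst_ty (susp_ty A) (susp_sub \<sigma>)"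
  "fv_tm t \<subseteq> {..<length \<sigma>} \<Longrightarrow> susp_tm (subst_tm t \<sigma>) = subst_tm (susp_tm t) (susp_sub \<sigma>)"
  by (induction A \<sigma> and t \<sigma> rule: subst_ty_subst_tm.induct) (auto simp: UN_subset_iff)

lemma fv_susp:
  "fv_ty A \<subseteq> {..<n} \<Longrightarrow> fv_ty (susp_ty A) \<subseteq> {..<Suc (Suc n)}"
  "fv_tm t \<subseteq> {..<n} \<Longrightarrow> fv_tm (susp_tm t) \<subseteq> {..<Suc (Suc n)}"
  by (induction A and t rule: fv_ty_fv_tm.induct) (auto simp: UN_subset_iff)

lemma dim_susp [simp]: "dim_ty (susp_ty A) = Suc (dim_ty A)"
  by (induction A rule: dim_ty.induct) auto

lemma scoped_susp: "scoped n \<sigma> \<Longrightarrow> scoped (Suc (Suc n)) (susp_sub \<sigma>)"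
  by (rule scopedI) (auto elim!: less_Suc_Suc_cases dest: fv_susp(2)[OF scoped_nth, THEN subsetD])

lemma susp_comp: "scoped (length \<tau>) \<sigma> \<Longrightarrow> susp_sub (comp_sub \<sigma> \<tau>) = comp_sub (susp_sub \<sigma>) (susp_sub \<tau>)"
  by (rule nth_equalityI) (auto simp: susp_subst scoped_nth elim!: less_Suc_Suc_cases)

lemma susp_id: "susp_sub (id_sub \<Gamma>) = id_sub (susp_ctx \<Gamma>)"
  by (rule nth_equalityI) (auto elim!: less_Suc_Suc_cases)

lemma globular_susp:
  assumes "globular \<Gamma>"
  shows "globular (susp_ctx \<Gamma>)"
  unfolding globular_def
proof (intro conjI allI impI)
  fix i assume "i < length (susp_ctx \<Gamma>)"
  then have "i < Suc (Suc (length \<Gamma>))" by simp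
  then show "susp_ctx \<Gamma> ! i = Star \<or> (\<exists>a<i. \<exists>b<i. susp_ctx \<Gamma> ! i = Arr (Var a) (susp_ctx \<Gamma> ! a) (Var b)
      \<and> susp_ctx \<Gamma> ! b = susp_ctx \<Gamma> ! a)"
  proof (cases rule: less_Suc_Suc_cases)
    case (3 k)
    from assms 3(2) show ?thesis
    proof (cases rule: globular_cases)
      case 1
      \<comment> \<open>A point becomes an arrow between the suspension points, at levels 0 and
        1.\<close>
      then show ?thesis using 3 by (intro disjI2 exI[of _ 0] exI[of _ "Suc 0"] conjI) simp_all
    next
      case (2 a b)
      then show ?thesis
        using 3 by (intro disjI2 exI[of _ "Suc (Suc a)"] exI[of _ "Suc (Suc b)"] conjI) simp_all
    qed
  qed simp_all
qed (simp add: susp_ctx_def)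

lemma ren_susp:
  assumes "ren \<Gamma> \<Delta> \<rho>" "scoped_ctx \<Gamma>"
  shows "ren (susp_ctx \<Gamma>) (susp_ctx \<Delta>) (susp_sub \<rho>)"
  unfolding ren_def
proof (intro conjI allI impI)
  show "length (susp_sub \<rho>) = length (susp_ctx \<Gamma>)" using ren_length[OF assms(1)] by simp
  fix i assume "i < length (susp_ctx \<Gamma>)"
  then have "i < Suc (Suc (length \<Gamma>))" by simp
  then show "\<exists>v<length (susp_ctx \<Delta>). susp_sub \<rho> ! i = Var v
      \<and> susp_ctx \<Delta> ! v = subst_ty (susp_ctx \<Gamma> ! i) (susp_sub \<rho>)"
  proof (cases rule: less_Suc_Suc_cases)
    case 1
    then show ?thesis by (intro exI[of _ 0]) simp
  next
    case 2
    then show ?thesis by (intro exI[of _ "Suc 0"]) simp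
  next
    case (3 k)
    from assms(1) 3(2) obtain v where "v < length \<Delta>" "\<rho> ! k = Var v" "\<Delta> ! v = subst_ty (\<Gamma> ! k) \<rho>"
      by (rule ren_nthE)
    then show ?thesis
      using 3 scoped_ctx_nth[OF assms(2) 3(2)] ren_length[OF assms(1)]
      by (intro exI[of _ "Suc (Suc v)"]) (simp add: susp_subst)
  qed
qed

section \<open>Wedges of contexts\<close>

lemma last_point_props:
  assumes "globular \<Gamma>"
  shows "last_point \<Gamma> < length \<Gamma>" "\<Gamma> ! last_point \<Gamma> = Star"
    "i < length \<Gamma> \<Longrightarrow> \<Gamma> ! i = Star \<Longrightarrow> i \<le> last_point \<Gamma>"
proof -
  let ?P = "{i \<in> {..<length \<Gamma>}. \<Gamma> ! i = Star}"
  have "0 \<in> ?P" using assms by (simp add: globular_nonempty globular_zero)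
  then have "last_point \<Gamma> \<in> ?P" unfolding last_point_def by (intro Max_in) auto
  then show "last_point \<Gamma> < length \<Gamma>" "\<Gamma> ! last_point \<Gamma> = Star" by auto
  show "i < length \<Gamma> \<Longrightarrow> \<Gamma> ! i = Star \<Longrightarrow> i \<le> last_point \<Gamma>"
    unfolding last_point_def by (intro Max_ge) auto
qed

lemma last_point_eqI:
  assumes "p < length \<Gamma>" "\<Gamma> ! p = Star" "\<And>i. i < length \<Gamma> \<Longrightarrow> \<Gamma> ! i = Star \<Longrightarrow> i \<le> p"
  shows "last_point \<Gamma> = p"
  unfolding last_point_def by (rule Max_eqI) (use assms in auto)

lemma last_point_point: "last_point [Star] = 0"
  by (rule last_point_eqI) auto

lemma susp_ty_neq_Star [simp]: "susp_ty A \<noteq> Star"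
  by (cases A) auto

lemma last_point_susp: "last_point (susp_ctx \<Gamma>) = Suc 0"
  by (rule last_point_eqI) (auto elim!: less_Suc_Suc_cases)

lemma wedge_inl_id: "wedge_inl \<Gamma> = id_sub \<Gamma>"
  by (simp add: wedge_inl_def id_sub_def)

lemma length_wedge_inr [simp]: "length (wedge_inr \<Gamma> \<Delta>) = length \<Delta>"
  by (simp add: wedge_inr_def)

lemma nth_wedge_inr [simp]: "j < length \<Delta> \<Longrightarrow> wedge_inr \<Gamma> \<Delta> ! j = Var (wedge_right \<Gamma> j)"
  by (simp add: wedge_inr_def)

lemma length_wedge: "\<Delta> \<noteq> [] \<Longrightarrow> length (wedge \<Gamma> \<Delta>) = length \<Gamma> + length \<Delta> - 1"
  by (cases \<Delta>) (simp_all add: wedge_def)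

lemma wedge_right_less:
  "globular \<Gamma> \<Longrightarrow> j < length \<Delta> \<Longrightarrow> wedge_right \<Gamma> j < length (wedge \<Gamma> \<Delta>)"
  using last_point_props(1)[of \<Gamma>] by (cases \<Delta>) (auto simp: wedge_right_def length_wedge)

lemma wedge_right_mono:
  assumes "globular \<Gamma>" "a < b"
  shows "wedge_right \<Gamma> a < wedge_right \<Gamma> b"
  using last_point_props(1)[OF assms(1)] assms(2) by (auto simp: wedge_right_def)

lemma wedge_right_inj: "globular \<Gamma> \<Longrightarrow> wedge_right \<Gamma> a = wedge_right \<Gamma> b \<longleftrightarrow> a = b"
  using wedge_right_mono[of \<Gamma> a b] wedge_right_mono[of \<Gamma> b a] by (cases a b rule: linorder_cases) auto

lemma wedge_right_left: "wedge_right \<Gamma> j < length \<Gamma> \<Longrightarrow> wedge_right \<Gamma> j = last_point \<Gamma>"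
  by (auto simp: wedge_right_def split: if_splits)

lemma wedge_nth_left: "v < length \<Gamma> \<Longrightarrow> wedge \<Gamma> \<Delta> ! v = \<Gamma> ! v"
  by (simp add: wedge_def nth_append)

text \<open>The case j = 0 is included although that variable is declared in the left factor: the
  identified variables are both points, and substitution fixes \<open>Star\<close>.\<close>

lemma wedge_nth_right:
  assumes "globular \<Gamma>" "globular \<Delta>" "j < length \<Delta>"
  shows "wedge \<Gamma> \<Delta> ! wedge_right \<Gamma> j = subst_ty (\<Delta> ! j) (wedge_inr \<Gamma> \<Delta>)"
proof (cases j)
  case 0
  then show ?thesis
    using last_point_props[OF assms(1)] globular_zero[OF assms(2)]
    by (simp add: wedge_right_def wedge_nth_left)
next
  case (Suc k)
  then show ?thesis
    using assms(3) by (cases \<Delta>) (simp_all add: wedge_right_def wedge_def nth_append)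
qed

lemma wedge_cases:
  assumes "v < length (wedge \<Gamma> \<Delta>)"
  obtains "v < length \<Gamma>" | j where "0 < j" "j < length \<Delta>" "v = wedge_right \<Gamma> j"
proof (cases "v < length \<Gamma>")
  case False
  then show ?thesis
    using assms that(2)[of "v - length \<Gamma> + 1"] by (auto simp: wedge_def wedge_right_def)
qed (use that in blast)

text \<open>\<open>wedge_cases\<close> counts the wedge point with the left factor; here it is
  counted with the right one, as suits a gluing square sitting on the right.\<close>

lemma wedge_cases':
  assumes "v < length (wedge \<Gamma> \<Delta>)" "\<Delta> \<noteq> []"
  obtains "v < length \<Gamma>" "\<And>j. v \<noteq> wedge_right \<Gamma> j" | j where "j < length \<Delta>" "v = wedge_right \<Gamma> j"
  using assms(1)
proof (cases rule: wedge_cases)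
  case 1
  show ?thesis
  proof (cases "v = last_point \<Gamma>")
    case True
    then show ?thesis using that(2)[of 0] assms(2) by (simp add: wedge_right_def)
  next
    case False
    then show ?thesis using that(1) wedge_right_left 1 by blast
  qed
qed (use that in blast)

lemma globular_wedge:
  assumes "globular \<Gamma>" "globular \<Delta>"
  shows "globular (wedge \<Gamma> \<Delta>)"
  unfolding globular_def
proof (intro conjI allI impI)
  fix v assume "v < length (wedge \<Gamma> \<Delta>)"
  then show "wedge \<Gamma> \<Delta> ! v = Star \<or> (\<exists>a<v. \<exists>b<v. wedge \<Gamma> \<Delta> ! v = Arr (Var a) (wedge \<Gamma> \<Delta> ! a) (Var b)
      \<and> wedge \<Gamma> \<Delta> ! b = wedge \<Gamma> \<Delta> ! a)"
  proof (cases rule: wedge_cases)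
    case 1
    from assms(1) 1 show ?thesis
    proof (cases rule: globular_cases)
      case (2 a b)
      then show ?thesis using 1 by (intro disjI2 exI[of _ a] exI[of _ b]) (simp add: wedge_nth_left)
    qed (use 1 in \<open>simp add: wedge_nth_left\<close>)
  next
    case (2 j)
    from assms(2) 2(2) show ?thesis
    proof (cases rule: globular_cases)
      case 1
      then show ?thesis using 2 by (simp add: wedge_nth_right assms)
    next
      case (2 a b)
      then show ?thesis
        using \<open>v = _\<close> \<open>j < _\<close> wedge_right_mono[OF assms(1)]
        by (intro disjI2 exI[of _ "wedge_right \<Gamma> a"] exI[of _ "wedge_right \<Gamma> b"])
           (simp add: wedge_nth_right assms)
    qed
  qed
qed (use assms in \<open>simp add: wedge_def globular_nonempty\<close>)

lemma ren_wedge_inr: "globular \<Gamma> \<Longrightarrow> globular \<Delta> \<Longrightarrow> ren \<Delta> (wedge \<Gamma> \<Delta>) (wedge_inr \<Gamma> \<Delta>)"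
  by (auto simp: ren_def wedge_nth_right wedge_right_less)

lemma subst_ty_eq_Star_iff [simp]: "subst_ty A \<sigma> = Star \<longleftrightarrow> A = Star"
  by (cases A) auto

text \<open>Points of the left factor come no later than the wedge point, which is the image of the
  first point on the right, and \<open>wedge_right\<close> is monotone.\<close>

lemma last_point_wedge:
  assumes "globular \<Gamma>" "globular \<Delta>"
  shows "last_point (wedge \<Gamma> \<Delta>) = wedge_right \<Gamma> (last_point \<Delta>)"
proof (rule last_point_eqI)
  fix v assume v: "v < length (wedge \<Gamma> \<Delta>)" "wedge \<Gamma> \<Delta> ! v = Star"
  have mono: "wedge_right \<Gamma> a \<le> wedge_right \<Gamma> b" if "a \<le> b" for a b
    using wedge_right_mono[OF assms(1), of a b] that by (cases "a = b") auto
  from v(1) show "v \<le> wedge_right \<Gamma> (last_point \<Delta>)"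
  proof (cases rule: wedge_cases)
    case 1
    then have "v \<le> wedge_right \<Gamma> 0"
      using v last_point_props(3)[OF assms(1)] by (simp add: wedge_nth_left wedge_right_def)
    then show ?thesis using mono[of 0 "last_point \<Delta>"] by simp
  next
    case (2 j)
    then show ?thesis
      using v last_point_props(3)[OF assms(2)] by (auto simp: wedge_nth_right assms intro: mono)
  qed
qed (use last_point_props[OF assms(2)] in \<open>auto simp: wedge_right_less wedge_nth_right assms\<close>)

lemma wedge_point_right: "wedge \<Gamma> [Star] = \<Gamma>"
  by (simp add: wedge_def)

lemma wedge_point_left:
  assumes "globular \<Delta>"
  shows "wedge [Star] \<Delta> = \<Delta>"
proof -
  have w: "wedge_right [Star] j = j" for j
    by (simp add: wedge_right_def last_point_point)
  have id: "wedge_inr [Star] \<Delta> = id_sub \<Delta>" by (rule nth_equalityI) (simp_all add: w)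
  show ?thesis
  proof (rule nth_equalityI)
    fix v assume "v < length (wedge [Star] \<Delta>)"
    then have "v < length \<Delta>" using globular_nonempty[OF assms] by (simp add: length_wedge)
    then show "wedge [Star] \<Delta> ! v = \<Delta> ! v"
      using wedge_nth_right[OF globular_point assms] scoped_ctx_nth[OF globular_scoped[OF assms]]
      by (simp add: w id subst_id)
  qed (simp add: length_wedge globular_nonempty[OF assms])
qed

lemma wedge_right_wedge:
  assumes "globular A" "globular B"
  shows "wedge_right (wedge A B) j = wedge_right A (wedge_right B j)"
proof (cases j)
  case 0
  then show ?thesis using last_point_wedge[OF assms] by (simp add: wedge_right_def)
next
  case (Suc k)
  then show ?thesis
    using globular_nonempty[OF assms(2)] by (cases B) (simp_all add: wedge_right_def length_wedge)
qed

lemma wedge_inr_wedge: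
  assumes "globular A" "globular B" "globular C"
  shows "comp_sub (wedge_inr B C) (wedge_inr A (wedge B C)) = wedge_inr (wedge A B) C"
  by (rule nth_equalityI) (simp_all add: wedge_right_less wedge_right_wedge assms)

text \<open>Associativity is strict: both bracketings list the variables of A, then those of B and
  of C without their first points, and \<open>wedge_right_wedge\<close> shows that both renumber the
  variables of C alike.\<close>

lemma wedge_assoc:
  assumes "globular A" "globular B" "globular C"
  shows "wedge (wedge A B) C = wedge A (wedge B C)"
proof (rule nth_equalityI)
  note ne = assms[THEN globular_nonempty]
  have ne2: "wedge B C \<noteq> []" using ne by (simp add: wedge_def)
  show "length (wedge (wedge A B) C) = length (wedge A (wedge B C))"
    using ne ne2 by (cases B) (simp_all add: length_wedge)
  have sc: "fv_ty (\<Gamma> ! i) \<subseteq> {..<length \<Gamma>}" if "globular \<Gamma>" "i < length \<Gamma>" for \<Gamma> i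
    using that globular_scoped scoped_ctx_nth by blast
  fix v assume "v < length (wedge (wedge A B) C)"
  then show "wedge (wedge A B) C ! v = wedge A (wedge B C) ! v"
  proof (cases rule: wedge_cases)
    case 1
    then show ?thesis
    proof (cases rule: wedge_cases)
      case left: 1
      then show ?thesis using 1 by (simp add: wedge_nth_left)
    next
      case (2 j)
      have jl: "j < length (wedge B C)" using 2 by (simp add: wedge_def)
      \<comment> \<open>The two inclusions have different lengths but agree on the variables of B,
        and the type of a variable of B mentions no others.\<close>
      have "subst_ty (B ! j) (wedge_inr A B) = subst_ty (B ! j) (wedge_inr A (wedge B C))"
        using sc[OF assms(2) 2(2)] by (intro subst_cong) (force simp: wedge_def)
      then show ?thesis
        using 1 2 jl by (simp add: wedge_nth_left wedge_nth_right globular_wedge assms)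
    qed
  next
    case (2 j)
    have "subst_ty (subst_ty (C ! j) (wedge_inr B C)) (wedge_inr A (wedge B C))
        = subst_ty (C ! j) (wedge_inr (wedge A B) C)"
      using sc[OF assms(3) 2(2)] by (simp add: subst_comp flip: wedge_inr_wedge[OF assms])
    moreover have "wedge A (wedge B C) ! v = subst_ty (wedge B C ! wedge_right B j) (wedge_inr A (wedge B C))"
      using 2 by (simp add: wedge_right_wedge wedge_nth_right wedge_right_less globular_wedge assms)
    ultimately show ?thesis
      using 2 by (simp add: wedge_nth_right globular_wedge assms)
  qed
qed

text \<open>Wedging two substitutions requires agreement at the shared point, the last on the left
  and the first on the right. Asking both ends of each factor makes the condition itself stable
  under wedge.\<close>

definition bipointed :: "ctx \<Rightarrow> ctx \<Rightarrow> sub \<Rightarrow> bool" where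
  "bipointed \<Gamma> \<Delta> \<sigma> \<longleftrightarrow> length \<sigma> = length \<Gamma> \<and> scoped (length \<Delta>) \<sigma> \<and>
     \<sigma> ! 0 = Var 0 \<and> \<sigma> ! last_point \<Gamma> = Var (last_point \<Delta>)"

lemma bipointed_id: "globular \<Gamma> \<Longrightarrow> bipointed \<Gamma> \<Gamma> (id_sub \<Gamma>)"
  using last_point_props(1)[of \<Gamma>] globular_length[of \<Gamma>]
  by (auto simp: bipointed_def intro: scopedI)

lemma bipointed_susp:
  "length \<sigma> = length \<Gamma> \<Longrightarrow> scoped (length \<Delta>) \<sigma> \<Longrightarrow> bipointed (susp_ctx \<Gamma>) (susp_ctx \<Delta>) (susp_sub \<sigma>)"
  by (auto simp: bipointed_def last_point_susp scoped_susp)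

section \<open>Wedges of bipointed substitutions\<close>

context
  fixes \<Gamma> \<Gamma>' \<Delta> \<Delta>' :: ctx and \<sigma> \<tau> :: sub
  assumes glob: "globular \<Gamma>" "globular \<Gamma>'" "globular \<Delta>" "globular \<Delta>'"
    and \<sigma>: "bipointed \<Gamma> \<Gamma>' \<sigma>" and \<tau>: "bipointed \<Delta> \<Delta>' \<tau>"
begin

lemma wedge_sub_eq: "wedge_sub \<Gamma>' \<Delta>' \<sigma> \<tau> = \<sigma> @ tl (comp_sub \<tau> (wedge_inr \<Gamma>' \<Delta>'))"
  using \<sigma> by (simp add: wedge_sub_def wedge_inl_id comp_id_right bipointed_def)

lemma length_wedge_sub: "length (wedge_sub \<Gamma>' \<Delta>' \<sigma> \<tau>) = length (wedge \<Gamma> \<Delta>)"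
  using \<sigma> \<tau> globular_nonempty[OF glob(3)]
  by (cases \<Delta>) (simp_all add: wedge_sub_eq length_wedge bipointed_def)

lemma wedge_sub_nth_left: "v < length \<Gamma> \<Longrightarrow> wedge_sub \<Gamma>' \<Delta>' \<sigma> \<tau> ! v = \<sigma> ! v"
  using \<sigma> by (simp add: wedge_sub_eq nth_append bipointed_def)

text \<open>At j = 0 the entry is supplied by \<sigma>, not \<tau>. It is the right one because
  \<sigma> preserves the last point and \<tau> the first.\<close>

lemma wedge_sub_nth_right:
  assumes "j < length \<Delta>"
  shows "wedge_sub \<Gamma>' \<Delta>' \<sigma> \<tau> ! wedge_right \<Gamma> j = subst_tm (\<tau> ! j) (wedge_inr \<Gamma>' \<Delta>')"
proof (cases j)
  case 0
  then show ?thesis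
    using \<sigma> \<tau> last_point_props(1)[OF glob(1)] globular_length[OF glob(4)]
    by (simp add: wedge_right_def wedge_sub_nth_left bipointed_def)
next
  case (Suc k)
  then show ?thesis
    using \<sigma> \<tau> assms by (simp add: wedge_sub_eq bipointed_def wedge_right_def nth_append nth_tl)
qed

lemma wedge_sub_left:
  "fv_ty A \<subseteq> {..<length \<Gamma>} \<Longrightarrow> subst_ty A (wedge_sub \<Gamma>' \<Delta>' \<sigma> \<tau>) = subst_ty A \<sigma>"
  "fv_tm t \<subseteq> {..<length \<Gamma>} \<Longrightarrow> subst_tm t (wedge_sub \<Gamma>' \<Delta>' \<sigma> \<tau>) = subst_tm t \<sigma>"
  by (rule subst_cong; force intro: wedge_sub_nth_left)+

text \<open>Naturality of the right inclusion; the types of the right factor are transported through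
  it.\<close>

lemma wedge_inr_wedge_sub:
  "comp_sub (wedge_inr \<Gamma> \<Delta>) (wedge_sub \<Gamma>' \<Delta>' \<sigma> \<tau>) = comp_sub \<tau> (wedge_inr \<Gamma>' \<Delta>')"
  using \<tau> by (intro nth_equalityI) (auto simp: bipointed_def wedge_sub_nth_right)

lemma wedge_sub_right:
  "fv_ty A \<subseteq> {..<length \<Delta>} \<Longrightarrow> subst_ty (subst_ty A (wedge_inr \<Gamma> \<Delta>)) (wedge_sub \<Gamma>' \<Delta>' \<sigma> \<tau>)
    = subst_ty (subst_ty A \<tau>) (wedge_inr \<Gamma>' \<Delta>')"
  "fv_tm t \<subseteq> {..<length \<Delta>} \<Longrightarrow> subst_tm (subst_tm t (wedge_inr \<Gamma> \<Delta>)) (wedge_sub \<Gamma>' \<Delta>' \<sigma> \<tau>)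
    = subst_tm (subst_tm t \<tau>) (wedge_inr \<Gamma>' \<Delta>')"
  using wedge_inr_wedge_sub \<tau> by (simp_all add: bipointed_def flip: subst_comp)

lemma scoped_wedge_sub: "scoped (length (wedge \<Gamma>' \<Delta>')) (wedge_sub \<Gamma>' \<Delta>' \<sigma> \<tau>)"
proof (rule scopedI)
  fix v assume "v < length (wedge_sub \<Gamma>' \<Delta>' \<sigma> \<tau>)"
  then have "v < length (wedge \<Gamma> \<Delta>)" by (simp add: length_wedge_sub)
  then show "fv_tm (wedge_sub \<Gamma>' \<Delta>' \<sigma> \<tau> ! v) \<subseteq> {..<length (wedge \<Gamma>' \<Delta>')}"
  proof (cases rule: wedge_cases)
    case 1
    have "fv_tm (\<sigma> ! v) \<subseteq> {..<length \<Gamma>'}"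
      using \<sigma> 1 scoped_nth[of "length \<Gamma>'" \<sigma> v] by (simp add: bipointed_def)
    then show ?thesis using 1 by (auto simp: wedge_sub_nth_left wedge_def)
  next
    case (2 j)
    have "scoped (length (wedge \<Gamma>' \<Delta>')) (wedge_inr \<Gamma>' \<Delta>')"
      using glob by (intro ren_scoped[OF ren_wedge_inr])
    moreover have "fv_tm (\<tau> ! j) \<subseteq> {..<length (wedge_inr \<Gamma>' \<Delta>')}"
      using \<tau> 2 scoped_nth[of "length \<Delta>'" \<tau> j] by (simp add: bipointed_def)
    ultimately show ?thesis using 2 by (simp add: wedge_sub_nth_right fv_subst_scoped)
  qed
qed

lemma bipointed_wedge_sub: "bipointed (wedge \<Gamma> \<Delta>) (wedge \<Gamma>' \<Delta>') (wedge_sub \<Gamma>' \<Delta>' \<sigma> \<tau>)"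
  using \<sigma> \<tau> globular_length[OF glob(1)] last_point_props(1)[OF glob(3)] last_point_props(1)[OF glob(4)]
  by (simp add: bipointed_def length_wedge_sub scoped_wedge_sub last_point_wedge glob
      wedge_sub_nth_left wedge_sub_nth_right)

lemma ren_wedge_sub:
  assumes "ren \<Gamma> \<Gamma>' \<sigma>" "ren \<Delta> \<Delta>' \<tau>"
  shows "ren (wedge \<Gamma> \<Delta>) (wedge \<Gamma>' \<Delta>') (wedge_sub \<Gamma>' \<Delta>' \<sigma> \<tau>)"
  unfolding ren_def
proof (intro conjI allI impI)
  have sc: "fv_ty (\<Gamma> ! i) \<subseteq> {..<length \<Gamma>}" if "globular \<Gamma>" "i < length \<Gamma>" for \<Gamma> i
    using that globular_scoped scoped_ctx_nth by blast
  fix v assume "v < length (wedge \<Gamma> \<Delta>)"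
  then show "\<exists>w<length (wedge \<Gamma>' \<Delta>'). wedge_sub \<Gamma>' \<Delta>' \<sigma> \<tau> ! v = Var w
      \<and> wedge \<Gamma>' \<Delta>' ! w = subst_ty (wedge \<Gamma> \<Delta> ! v) (wedge_sub \<Gamma>' \<Delta>' \<sigma> \<tau>)"
  proof (cases rule: wedge_cases)
    case 1
    from assms(1) 1 obtain w where "w < length \<Gamma>'" "\<sigma> ! v = Var w" "\<Gamma>' ! w = subst_ty (\<Gamma> ! v) \<sigma>"
      by (rule ren_nthE)
    then show ?thesis
      using 1 sc[OF glob(1) 1]
      by (intro exI[of _ w]) (simp add: wedge_sub_nth_left wedge_nth_left wedge_sub_left, simp add: wedge_def)
  next
    case (2 j)
    from assms(2) 2(2) obtain w where "w < length \<Delta>'" "\<tau> ! j = Var w" "\<Delta>' ! w = subst_ty (\<Delta> ! j) \<tau>"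
      by (rule ren_nthE)
    then show ?thesis
      using 2 sc[OF glob(3) 2(2)]
      by (intro exI[of _ "wedge_right \<Gamma>' w"])
         (simp add: wedge_sub_nth_right wedge_nth_right wedge_sub_right wedge_right_less glob)
  qed
qed (simp add: length_wedge_sub)

end

text \<open>The interchange law, by which composites of boundary inclusions are computed one subtree
  at a time.\<close>

lemma wedge_sub_comp:
  assumes glob: "globular \<Gamma>" "globular \<Gamma>'" "globular \<Gamma>''" "globular \<Delta>" "globular \<Delta>'" "globular \<Delta>''"
    and \<sigma>: "bipointed \<Gamma> \<Gamma>' \<sigma>" "bipointed \<Gamma>' \<Gamma>'' \<sigma>'" and \<tau>: "bipointed \<Delta> \<Delta>' \<tau>" "bipointed \<Delta>' \<Delta>'' \<tau>'"
  shows "comp_sub (wedge_sub \<Gamma>' \<Delta>' \<sigma> \<tau>) (wedge_sub \<Gamma>'' \<Delta>'' \<sigma>' \<tau>')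
    = wedge_sub \<Gamma>'' \<Delta>'' (comp_sub \<sigma> \<sigma>') (comp_sub \<tau> \<tau>')"
    (is "comp_sub ?st ?st' = ?c")
proof -
  have bip: "bipointed \<Gamma> \<Gamma>'' (comp_sub \<sigma> \<sigma>')" "bipointed \<Delta> \<Delta>'' (comp_sub \<tau> \<tau>')"
    using \<sigma> \<tau> glob[THEN globular_length] glob[THEN last_point_props(1)]
    by (simp_all add: bipointed_def scoped_comp)
  have len: "length ?st = length (wedge \<Gamma> \<Delta>)" "length ?c = length (wedge \<Gamma> \<Delta>)"
    by (rule length_wedge_sub[OF glob(1,2,4,5) \<sigma>(1) \<tau>(1)], rule length_wedge_sub[OF glob(1,3,4,6) bip])
  show ?thesis
  proof (rule nth_equalityI)
    fix v assume "v < length (comp_sub ?st ?st')"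
    then have v: "v < length (wedge \<Gamma> \<Delta>)" by (simp add: len)
    then show "comp_sub ?st ?st' ! v = ?c ! v"
    proof (cases rule: wedge_cases)
      case 1
      have "fv_tm (\<sigma> ! v) \<subseteq> {..<length \<Gamma>'}"
        using \<sigma>(1) 1 scoped_nth[of "length \<Gamma>'" \<sigma> v] by (simp add: bipointed_def)
      then have "subst_tm (\<sigma> ! v) ?st' = subst_tm (\<sigma> ! v) \<sigma>'"
        using glob \<sigma>(2) \<tau>(2) by (intro wedge_sub_left(2))
      then show ?thesis
        using 1 v \<sigma>(1) by (simp add: len wedge_sub_nth_left[OF glob(1,2,4,5) \<sigma>(1) \<tau>(1)]
            wedge_sub_nth_left[OF glob(1,3,4,6) bip] bipointed_def)
    next
      case (2 j)
      have fv: "fv_tm (\<tau> ! j) \<subseteq> {..<length \<Delta>'}"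
        using \<tau>(1) 2 scoped_nth[of "length \<Delta>'" \<tau> j] by (simp add: bipointed_def)
      have "comp_sub ?st ?st' ! v = subst_tm (subst_tm (\<tau> ! j) (wedge_inr \<Gamma>' \<Delta>')) ?st'"
        using v 2 by (simp add: len wedge_sub_nth_right[OF glob(1,2,4,5) \<sigma>(1) \<tau>(1)])
      also have "\<dots> = subst_tm (subst_tm (\<tau> ! j) \<tau>') (wedge_inr \<Gamma>'' \<Delta>'')"
        using fv by (rule wedge_sub_right(2)[OF glob(2,3,5,6) \<sigma>(2) \<tau>(2)])
      also have "\<dots> = ?c ! v"
        using 2 \<tau>(1) by (simp add: wedge_sub_nth_right[OF glob(1,3,4,6) bip] bipointed_def)
      finally show ?thesis .
    qed
  qed (simp add: len)
qed


section \<open>Stability of gluing squares\<close>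

lemma globular_nth_fv: "globular \<Gamma> \<Longrightarrow> i < length \<Gamma> \<Longrightarrow> fv_ty (\<Gamma> ! i) \<subseteq> {..<length \<Gamma>}"
  using globular_scoped scoped_ctx_nth by blast

lemma ren_mem_Var:
  assumes "ren \<Gamma> \<Delta> \<rho>" "t \<in> set \<rho>"
  shows "\<exists>v<length \<Delta>. t = Var v"
proof -
  obtain a where "a < length \<Gamma>" "\<rho> ! a = t"
    using assms ren_length[OF assms(1)] by (auto simp: in_set_conv_nth)
  then show ?thesis using assms(1) by (metis ren_nthE)
qed

lemma ren_mem_less: "ren \<Gamma> \<Delta> \<rho> \<Longrightarrow> Var v \<in> set \<rho> \<Longrightarrow> v < length \<Delta>"
  using ren_mem_Var by fastforce

lemma ren_mem_wedge_inr:
  assumes "ren \<Gamma> \<Delta> \<rho>"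
  shows "Var v \<in> set (comp_sub \<rho> (wedge_inr \<Theta> \<Delta>)) \<longleftrightarrow> (\<exists>x<length \<Delta>. v = wedge_right \<Theta> x \<and> Var x \<in> set \<rho>)"
proof
  assume "Var v \<in> set (comp_sub \<rho> (wedge_inr \<Theta> \<Delta>))"
  then obtain a where a: "a < length \<rho>" "subst_tm (\<rho> ! a) (wedge_inr \<Theta> \<Delta>) = Var v"
    by (auto simp: comp_sub_def in_set_conv_nth)
  then obtain x where "x < length \<Delta>" "\<rho> ! a = Var x"
    using assms ren_length[OF assms] by (auto elim: ren_nthE)
  with a show "\<exists>x<length \<Delta>. v = wedge_right \<Theta> x \<and> Var x \<in> set \<rho>"
    by (metis nth_mem nth_wedge_inr subst_tm.simps(1) tm.inject(1))
next
  assume "\<exists>x<length \<Delta>. v = wedge_right \<Theta> x \<and> Var x \<in> set \<rho>"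
  then show "Var v \<in> set (comp_sub \<rho> (wedge_inr \<Theta> \<Delta>))"
    by (force simp: comp_sub_def image_iff)
qed

lemma distinct_wedge_inr:
  assumes "ren \<Gamma> \<Delta> \<rho>" "distinct \<rho>" "globular \<Theta>"
  shows "distinct (comp_sub \<rho> (wedge_inr \<Theta> \<Delta>))"
  unfolding distinct_conv_nth
proof (intro allI impI)
  fix a b assume ab: "a < length (comp_sub \<rho> (wedge_inr \<Theta> \<Delta>))" "b < length (comp_sub \<rho> (wedge_inr \<Theta> \<Delta>))" "a \<noteq> b"
  obtain x where x: "x < length \<Delta>" "\<rho> ! a = Var x"
    using assms(1) ab(1) ren_length[OF assms(1)] by (auto elim: ren_nthE)
  obtain y where y: "y < length \<Delta>" "\<rho> ! b = Var y"
    using assms(1) ab(2) ren_length[OF assms(1)] by (auto elim: ren_nthE)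
  have "x \<noteq> y" using ab x y nth_eq_iff_index_eq[OF assms(2), of a b] by auto
  then show "comp_sub \<rho> (wedge_inr \<Theta> \<Delta>) ! a \<noteq> comp_sub \<rho> (wedge_inr \<Theta> \<Delta>) ! b"
    using ab x y by (simp add: wedge_right_inj[OF assms(3)])
qed

text \<open>The two suspension points lie in the disc and in T alike, so the variables outside them
  are precisely the shifted old ones and the conditions carry over by shifting.\<close>

lemma gluing_susp:
  assumes "gluing D S T Q i j \<kappa> \<iota>" and scoped: "scoped_ctx D" "scoped_ctx S" "scoped_ctx T"
  shows "gluing (susp_ctx D) (susp_ctx S) (susp_ctx T) (susp_ctx Q)
    (susp_sub i) (susp_sub j) (susp_sub \<kappa>) (susp_sub \<iota>)"
proof -
  interpret gluing D S T Q i j \<kappa> \<iota> by fact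
  have mem: "Var (Suc (Suc v)) \<in> set (susp_sub \<rho>) \<longleftrightarrow> Var v \<in> set \<rho>"
    if r: "ren \<Gamma> \<Delta> \<rho>" for \<Gamma> \<Delta> \<rho> v
  proof
    assume "Var (Suc (Suc v)) \<in> set (susp_sub \<rho>)"
    then obtain t where t: "t \<in> set \<rho>" "susp_tm t = Var (Suc (Suc v))"
      by (auto simp: susp_sub_def)
    then obtain x where "t = Var x"
      using ren_mem_Var[OF r] by blast
    then show "Var v \<in> set \<rho>" using t by simp
  next
    assume "Var v \<in> set \<rho>"
    then show "Var (Suc (Suc v)) \<in> set (susp_sub \<rho>)" by (force simp: susp_sub_def image_iff)
  qed
  have mem01: "Var 0 \<in> set (susp_sub \<rho>)" "Var (Suc 0) \<in> set (susp_sub \<rho>)" for \<rho>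
    by (simp_all add: susp_sub_def)
  have old: "\<exists>x. y = Suc (Suc x) \<and> x < length \<Gamma> \<and> Var x \<notin> set \<rho>"
    if "ren \<Gamma>' \<Gamma> \<rho>" "y < length (susp_ctx \<Gamma>)" "Var y \<notin> set (susp_sub \<rho>)" for \<Gamma> \<Gamma>' y \<rho>
  proof -
    from that(2) have "y < Suc (Suc (length \<Gamma>))" by simp
    then show ?thesis
      by (cases rule: less_Suc_Suc_cases) (use that mem[OF that(1)] mem01[of \<rho>] in auto)
  qed
  show ?thesis
  proof (rule gluing.intro)
    show "ren (susp_ctx D) (susp_ctx S) (susp_sub i)" "ren (susp_ctx T) (susp_ctx Q) (susp_sub \<iota>)"
      using i_ren \<iota>_ren scoped by (simp_all add: ren_susp)
    show "distinct (susp_sub \<iota>)"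
    proof -
      have var: "\<exists>v. t = Var v" if "t \<in> set \<iota>" for t
        using ren_mem_Var[OF \<iota>_ren that] by blast
      have "inj_on susp_tm (set \<iota>)"
      proof (rule inj_onI)
        fix s t assume "s \<in> set \<iota>" "t \<in> set \<iota>" "susp_tm s = susp_tm t"
        with var[of s] var[of t] show "s = t" by auto
      qed
      moreover have "Var 0 \<notin> susp_tm ` set \<iota>" "Var (Suc 0) \<notin> susp_tm ` set \<iota>"
        using var by fastforce+
      ultimately show ?thesis
        using \<iota>_distinct by (simp add: susp_sub_def distinct_map)
    qed
    show "length (susp_sub j) = length (susp_ctx D)" "length (susp_sub \<kappa>) = length (susp_ctx S)"
      using j_length \<kappa>_length by simp_all
    show "scoped (length (susp_ctx T)) (susp_sub j)" "scoped (length (susp_ctx Q)) (susp_sub \<kappa>)"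
      using j_scoped \<kappa>_scoped by (simp_all add: scoped_susp)
    have "scoped (length \<kappa>) i" "scoped (length \<iota>) j"
      using ren_scoped[OF i_ren] \<kappa>_length j_scoped ren_length[OF \<iota>_ren] by simp_all
    then show "comp_sub (susp_sub i) (susp_sub \<kappa>) = comp_sub (susp_sub j) (susp_sub \<iota>)"
      using commutes by (simp flip: susp_comp)
  next
    fix y assume "y < length (susp_ctx S)" "Var y \<notin> set (susp_sub i)"
    then obtain x where x: "y = Suc (Suc x)" "x < length S" "Var x \<notin> set i" using old[OF i_ren] by blast
    then obtain v where "v < length Q" "\<kappa> ! x = Var v" "Q ! v = subst_ty (S ! x) \<kappa>" "Var v \<notin> set \<iota>"
      using fresh by blast
    then show "\<exists>v<length (susp_ctx Q). susp_sub \<kappa> ! y = Var v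
        \<and> susp_ctx Q ! v = subst_ty (susp_ctx S ! y) (susp_sub \<kappa>) \<and> Var v \<notin> set (susp_sub \<iota>)"
      using x scoped_ctx_nth[OF scoped(2) x(2)] \<kappa>_length mem[OF \<iota>_ren]
      by (intro exI[of _ "Suc (Suc v)"]) (simp add: susp_subst)
  next
    fix y z assume yz: "y < length (susp_ctx S)" "z < length (susp_ctx S)"
      "Var y \<notin> set (susp_sub i)" "Var z \<notin> set (susp_sub i)" "susp_sub \<kappa> ! y = susp_sub \<kappa> ! z"
    then obtain x w where x: "y = Suc (Suc x)" "x < length S" "Var x \<notin> set i"
      and w: "z = Suc (Suc w)" "w < length S" "Var w \<notin> set i"
      using old[OF i_ren] by meson
    \<comment> \<open>Off the disc both values are variables, and suspension is injective on
      these.\<close>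
    moreover have "\<kappa> ! x = \<kappa> ! w"
      using yz(5) fresh[OF x(2,3)] fresh[OF w(2,3)] x w \<kappa>_length by auto
    ultimately show "y = z" using fresh_inj by blast
  next
    fix v assume "v < length (susp_ctx Q)" "Var v \<notin> set (susp_sub \<iota>)"
    then obtain w where w: "v = Suc (Suc w)" "w < length Q" "Var w \<notin> set \<iota>" using old[OF \<iota>_ren] by blast
    then obtain y where "y < length S" "Var y \<notin> set i" "\<kappa> ! y = Var w" using cover by blast
    then show "\<exists>y<length (susp_ctx S). Var y \<notin> set (susp_sub i) \<and> susp_sub \<kappa> ! y = Var v"
      using w \<kappa>_length mem[OF i_ren] by (intro exI[of _ "Suc (Suc y)"]) simp
  qed
qed

text \<open>The variables of L other than the wedge point become new variables outside the disc and
  outside T, and \<kappa> fixes them. The wedge point is the first variable of S or Q, so the given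
  square decides on which side it falls.\<close>

lemma gluing_wedge_left:
  assumes "gluing D S T Q i j \<kappa> \<iota>" and bip: "bipointed S Q \<kappa>"
    and glob: "globular L" "globular D" "globular S" "globular T" "globular Q"
  shows "gluing D (wedge L S) T (wedge L Q) (comp_sub i (wedge_inr L S)) j
    (wedge_sub L Q (id_sub L) \<kappa>) (comp_sub \<iota> (wedge_inr L Q))"
proof -
  interpret gluing D S T Q i j \<kappa> \<iota> by fact
  let ?\<kappa> = "wedge_sub L Q (id_sub L) \<kappa>"
  note W = glob(1) glob(1) glob(3) glob(5) bipointed_id[OF glob(1)] bip
  note left = wedge_sub_nth_left[OF W] and right = wedge_sub_nth_right[OF W]
  note mem = ren_mem_wedge_inr[OF i_ren] ren_mem_wedge_inr[OF \<iota>_ren]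
  note nonempty = globular_nonempty[OF glob(3)] globular_nonempty[OF glob(5)]
  have len: "length L \<le> length (wedge L \<Gamma>)" for \<Gamma> by (simp add: wedge_def)
  show ?thesis
  proof (rule gluing.intro)
    show "ren D (wedge L S) (comp_sub i (wedge_inr L S))" "ren T (wedge L Q) (comp_sub \<iota> (wedge_inr L Q))"
      using ren_comp[OF i_ren ren_wedge_inr] ren_comp[OF \<iota>_ren ren_wedge_inr] glob globular_scoped by blast+
    show "distinct (comp_sub \<iota> (wedge_inr L Q))"
      using \<iota>_ren \<iota>_distinct glob(1) by (rule distinct_wedge_inr)
    show "length j = length D" "scoped (length T) j" by (fact j_length j_scoped)+
    show "length ?\<kappa> = length (wedge L S)" "scoped (length (wedge L Q)) ?\<kappa>"
      using length_wedge_sub[OF W] scoped_wedge_sub[OF W] by blast+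
    show "comp_sub (comp_sub i (wedge_inr L S)) ?\<kappa> = comp_sub j (comp_sub \<iota> (wedge_inr L Q))"
      using ren_scoped[OF i_ren] ren_scoped[OF \<iota>_ren] j_scoped \<kappa>_length ren_length[OF \<iota>_ren]
      by (simp add: comp_sub_assoc wedge_inr_wedge_sub[OF W] flip: commutes)
         (simp add: comp_sub_assoc commutes flip: comp_sub_assoc)
  next
    fix y assume y: "y < length (wedge L S)" "Var y \<notin> set (comp_sub i (wedge_inr L S))"
    from y(1) nonempty(1) show "\<exists>v<length (wedge L Q). ?\<kappa> ! y = Var v
        \<and> wedge L Q ! v = subst_ty (wedge L S ! y) ?\<kappa> \<and> Var v \<notin> set (comp_sub \<iota> (wedge_inr L Q))"
    proof (cases rule: wedge_cases')
      case 1
      then show ?thesis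
        using globular_nth_fv[OF glob(1) 1(1)] len[of Q]
        by (intro exI[of _ y]) (simp add: left wedge_nth_left wedge_sub_left[OF W] subst_id mem)
    next
      case (2 x)
      then have "Var x \<notin> set i" using y(2) by (auto simp: mem)
      with fresh[OF 2(1)] obtain v where v: "v < length Q" "\<kappa> ! x = Var v"
        "Q ! v = subst_ty (S ! x) \<kappa>" "Var v \<notin> set \<iota>" by blast
      then show ?thesis
        using 2 globular_nth_fv[OF glob(3) 2(1)]
        by (intro exI[of _ "wedge_right L v"])
           (auto simp: right wedge_nth_right glob wedge_right_less wedge_sub_right[OF W] mem wedge_right_inj)
    qed
  next
    fix y z assume yz: "y < length (wedge L S)" "z < length (wedge L S)"
      "Var y \<notin> set (comp_sub i (wedge_inr L S))" "Var z \<notin> set (comp_sub i (wedge_inr L S))"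
      "?\<kappa> ! y = ?\<kappa> ! z"
    \<comment> \<open>A variable of S off the disc lands in the image of Q, hence cannot collide
      with the image of a variable of L other than the wedge point.\<close>
    have img: "\<exists>v. \<kappa> ! x = Var v \<and> ?\<kappa> ! wedge_right L x = Var (wedge_right L v)"
      if "x < length S" "Var (wedge_right L x) \<notin> set (comp_sub i (wedge_inr L S))" for x
    proof -
      have "Var x \<notin> set i" using that by (auto simp: mem)
      with fresh[OF that(1)] show ?thesis using that(1) by (auto simp: right)
    qed
    from yz(1) nonempty(1) show "y = z"
    proof (cases rule: wedge_cases')
      case y: 1
      from yz(2) nonempty(1) show ?thesis
      proof (cases rule: wedge_cases')
        case (2 w)
        then show ?thesis using yz y img[of w] by (auto simp: left)
      qed (use y yz in \<open>simp add: left\<close>)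
    next
      case y: (2 x)
      from yz(2) nonempty(1) show ?thesis
      proof (cases rule: wedge_cases')
        case 1
        then show ?thesis using yz y img[of x] by (auto simp: left)
      next
        case (2 w)
        then have "\<kappa> ! x = \<kappa> ! w"
          using yz y img[of x] img[of w] by (auto simp: wedge_right_inj[OF glob(1)])
        moreover have "Var x \<notin> set i" "Var w \<notin> set i" using y 2 yz by (auto simp: mem)
        ultimately show ?thesis using fresh_inj[OF y(1) 2(1)] y 2 by simp
      qed
    qed
  next
    fix v assume v: "v < length (wedge L Q)" "Var v \<notin> set (comp_sub \<iota> (wedge_inr L Q))"
    from v(1) nonempty(2) show "\<exists>y<length (wedge L S). Var y \<notin> set (comp_sub i (wedge_inr L S)) \<and> ?\<kappa> ! y = Var v"
    proof (cases rule: wedge_cases')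
      case 1
      then show ?thesis using len[of S] by (intro exI[of _ v]) (simp add: left mem)
    next
      case (2 w)
      then have "Var w \<notin> set \<iota>" using v(2) by (auto simp: mem)
      with cover[OF 2(1)] obtain y where "y < length S" "Var y \<notin> set i" "\<kappa> ! y = Var w" by blast
      then show ?thesis
        using 2 by (intro exI[of _ "wedge_right L y"])
           (auto simp: right wedge_right_less glob mem wedge_right_inj)
    qed
  qed
qed

text \<open>S and Q are prefixes of the new contexts, so i and \<iota> remain literally the same
  lists. The variables of N after its first lie outside the disc and T.\<close>

lemma gluing_wedge_right:
  assumes "gluing D S T Q i j \<kappa> \<iota>" and bip: "bipointed S Q \<kappa>"
    and glob: "globular N" "globular D" "globular S" "globular T" "globular Q"
  shows "gluing D (wedge S N) T (wedge Q N) i j (wedge_sub Q N \<kappa> (id_sub N)) \<iota>"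
proof -
  interpret gluing D S T Q i j \<kappa> \<iota> by fact
  let ?\<kappa> = "wedge_sub Q N \<kappa> (id_sub N)"
  note W = glob(3) glob(5) glob(1) glob(1) bip bipointed_id[OF glob(1)]
  note left = wedge_sub_nth_left[OF W] and right = wedge_sub_nth_right[OF W]
  have len: "length \<Gamma> \<le> length (wedge \<Gamma> N)" for \<Gamma> by (simp add: wedge_def)
  have ren: "ren \<Gamma> (wedge \<Delta> N) \<rho>" if "ren \<Gamma> \<Delta> \<rho>" for \<Gamma> \<Delta> \<rho>
    unfolding ren_def
  proof (intro conjI allI impI)
    fix a assume "a < length \<Gamma>"
    with that obtain v where "v < length \<Delta>" "\<rho> ! a = Var v" "\<Delta> ! v = subst_ty (\<Gamma> ! a) \<rho>" by (rule ren_nthE)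
    then show "\<exists>v<length (wedge \<Delta> N). \<rho> ! a = Var v \<and> wedge \<Delta> N ! v = subst_ty (\<Gamma> ! a) \<rho>"
      using len[of \<Delta>] by (intro exI[of _ v]) (simp add: wedge_nth_left)
  qed (rule ren_length[OF that])
  \<comment> \<open>The added variables have levels past the whole left factor, so they occur
    neither in i nor in \<iota> and differ from every variable of S or Q.\<close>
  have big: "length \<Gamma> \<le> wedge_right \<Gamma> x" if "0 < x" for \<Gamma> x
    using that by (simp add: wedge_right_def)
  show ?thesis
  proof (rule gluing.intro)
    show "ren D (wedge S N) i" "ren T (wedge Q N) \<iota>" using i_ren \<iota>_ren by (simp_all add: ren)
    show "distinct \<iota>" "length j = length D" "scoped (length T) j"
      by (fact \<iota>_distinct j_length j_scoped)+
    show "length ?\<kappa> = length (wedge S N)" "scoped (length (wedge Q N)) ?\<kappa>"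
      using length_wedge_sub[OF W] scoped_wedge_sub[OF W] by blast+
    have "comp_sub i ?\<kappa> = comp_sub i \<kappa>"
      using ren_length[OF i_ren] scoped_nth[OF ren_scoped[OF i_ren]]
      by (intro nth_equalityI) (simp_all add: wedge_sub_left[OF W])
    then show "comp_sub i ?\<kappa> = comp_sub j \<iota>" by (simp add: commutes)
  next
    fix y assume y: "y < length (wedge S N)" "Var y \<notin> set i"
    from y(1) show "\<exists>v<length (wedge Q N). ?\<kappa> ! y = Var v
        \<and> wedge Q N ! v = subst_ty (wedge S N ! y) ?\<kappa> \<and> Var v \<notin> set \<iota>"
    proof (cases rule: wedge_cases)
      case 1
      with fresh[OF 1 y(2)] obtain v where "v < length Q" "\<kappa> ! y = Var v"
        "Q ! v = subst_ty (S ! y) \<kappa>" "Var v \<notin> set \<iota>" by blast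
      then show ?thesis
        using 1 globular_nth_fv[OF glob(3) 1] len[of Q]
        by (intro exI[of _ v]) (simp add: left wedge_nth_left wedge_sub_left[OF W])
    next
      case (2 x)
      then show ?thesis
        using globular_nth_fv[OF glob(1) 2(2)] big[of x Q] ren_mem_less[OF \<iota>_ren, of "wedge_right Q x"]
        by (intro exI[of _ "wedge_right Q x"])
           (auto simp: right wedge_right_less wedge_nth_right glob wedge_sub_right[OF W] subst_id)
    qed
  next
    fix y z assume yz: "y < length (wedge S N)" "z < length (wedge S N)"
      "Var y \<notin> set i" "Var z \<notin> set i" "?\<kappa> ! y = ?\<kappa> ! z"
    from yz(1) show "y = z"
    proof (cases rule: wedge_cases)
      case y: 1
      from yz(2) show ?thesis
      proof (cases rule: wedge_cases)
        case 1
        then show ?thesis using fresh_inj y yz by (simp add: left)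
      next
        case (2 w)
        then show ?thesis using yz(5) fresh[OF y yz(3)] big[of w Q] y by (auto simp: left right)
      qed
    next
      case y: (2 x)
      from yz(2) show ?thesis
      proof (cases rule: wedge_cases)
        case 1
        then show ?thesis using yz(5) fresh[OF 1 yz(4)] big[of x Q] y by (auto simp: left right)
      next
        case (2 w)
        then show ?thesis using y yz(5) by (simp add: right wedge_right_inj glob)
      qed
    qed
  next
    fix v assume v: "v < length (wedge Q N)" "Var v \<notin> set \<iota>"
    from v(1) show "\<exists>y<length (wedge S N). Var y \<notin> set i \<and> ?\<kappa> ! y = Var v"
    proof (cases rule: wedge_cases)
      case 1
      with cover[OF 1 v(2)] obtain y where "y < length S" "Var y \<notin> set i" "\<kappa> ! y = Var v" by blast
      then show ?thesis using len[of S] by (intro exI[of _ y]) (simp add: left)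
    next
      case (2 x)
      then show ?thesis
        using big[of x S] ren_mem_less[OF i_ren, of "wedge_right S x"]
        by (intro exI[of _ "wedge_right S x"]) (auto simp: right wedge_right_less glob)
    qed
  qed
qed

lemma wedge_sub_id:
  assumes "globular \<Gamma>" "globular \<Delta>"
  shows "wedge_sub \<Gamma> \<Delta> (id_sub \<Gamma>) (id_sub \<Delta>) = id_sub (wedge \<Gamma> \<Delta>)"
proof (rule nth_equalityI)
  note W = assms(1,1,2,2) bipointed_id[OF assms(1)] bipointed_id[OF assms(2)]
  show "length (wedge_sub \<Gamma> \<Delta> (id_sub \<Gamma>) (id_sub \<Delta>)) = length (id_sub (wedge \<Gamma> \<Delta>))"
    by (simp add: length_wedge_sub[OF W])
  fix v assume "v < length (wedge_sub \<Gamma> \<Delta> (id_sub \<Gamma>) (id_sub \<Delta>))"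
  then have v: "v < length (wedge \<Gamma> \<Delta>)" by (simp add: length_wedge_sub[OF W])
  then show "wedge_sub \<Gamma> \<Delta> (id_sub \<Gamma>) (id_sub \<Delta>) ! v = id_sub (wedge \<Gamma> \<Delta>) ! v"
    by (cases rule: wedge_cases) (use v in \<open>simp_all add: wedge_sub_nth_left[OF W] wedge_sub_nth_right[OF W]\<close>)
qed

lemma wedge_sub_point_right:
  "scoped (length \<Gamma>) \<sigma> \<Longrightarrow> wedge_sub \<Gamma> [Star] \<sigma> [Var 0] = \<sigma>"
  by (simp add: wedge_sub_def wedge_inl_id comp_id_right) (simp add: comp_sub_def)

text \<open>The shape in which insertion presents its maps. As wedges associate to the right, N is
  attached before L; the one-point context that ends \<open>wedges_sub\<close> is absorbed as a
  unit.\<close>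

lemma gluing_wedge_mid:
  assumes gl: "gluing D S T Q i j \<kappa> \<iota>" and bip: "bipointed S Q \<kappa>"
    and glob: "globular L" "globular N" "globular D" "globular S" "globular T" "globular Q"
  shows "gluing D (wedge L (wedge S N)) T (wedge L (wedge Q N)) (comp_sub i (wedge_inr L (wedge S N))) j
    (wedges_sub [(L, id_sub L), (Q, \<kappa>), (N, id_sub N)]) (comp_sub \<iota> (wedge_mid L Q N))"
proof -
  interpret gluing D S T Q i j \<kappa> \<iota> by (fact gl)
  have "wedges_sub [(L, id_sub L), (Q, \<kappa>), (N, id_sub N)]
      = wedge_sub L (wedge Q N) (id_sub L) (wedge_sub Q N \<kappa> (id_sub N))"
    using bipointed_id[OF glob(2)]
    by (simp add: wedges_def wedge_point_right wedge_sub_point_right bipointed_def)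
  moreover have "comp_sub \<iota> (wedge_mid L Q N) = comp_sub \<iota> (wedge_inr L (wedge Q N))"
    using ren_scoped[OF \<iota>_ren]
    by (simp add: wedge_mid_def wedge_inl_id comp_id_right flip: comp_sub_assoc)
  moreover have "bipointed (wedge S N) (wedge Q N) (wedge_sub Q N \<kappa> (id_sub N))"
    using glob bip bipointed_id by (intro bipointed_wedge_sub)
  ultimately show ?thesis
    using gluing_wedge_left[OF gluing_wedge_right[OF gl bip]] glob by (simp add: globular_wedge)
qed

text \<open>Every variable is in the image of an identity, so the conditions on variables outside
  the disc or outside T are vacuous, for any scoped j.\<close>

lemma gluing_id:
  assumes "scoped_ctx D" "scoped_ctx T" "length j = length D" "scoped (length T) j"
  shows "gluing D D T T (id_sub D) j j (id_sub T)"
proof -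
  have "Var v \<in> set (id_sub \<Gamma>)" if "v < length \<Gamma>" for v \<Gamma>
    using that by (auto simp: id_sub_def)
  moreover have "distinct (id_sub T)"
    by (auto simp: id_sub_def distinct_map inj_on_def)
  ultimately show ?thesis
    using assms by unfold_locales (auto simp: ren_id comp_id_left comp_id_right)
qed


section \<open>Trees, discs and standard constructions\<close>

text \<open>This follows the recursion of boundaries: the level drops on entering the first subtree
  and stays while passing to its siblings, so that each step is one suspension and one
  wedge.\<close>

lemma tree_level_induct:
  assumes "\<And>T. P 0 T" and "\<And>n. P (Suc n) (Node [])"
    and "\<And>n T Ts. P n T \<Longrightarrow> P (Suc n) (Node Ts) \<Longrightarrow> P (Suc n) (Node (T # Ts))"
  shows "P n T"
proof (induction n arbitrary: T)
  case (Suc n)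
  have "P (Suc n) (Node Ts)" for Ts
    by (induction Ts) (use assms Suc in auto)
  then show ?case by (cases T) simp
qed (rule assms)

lemma ctx_of_Nil: "\<lfloor>Node []\<rfloor>\<^sub>c = [Star]"
  by (simp add: wedges_def)

lemma ctx_of_Cons: "\<lfloor>Node (T # Ts)\<rfloor>\<^sub>c = wedge (susp_ctx \<lfloor>T\<rfloor>\<^sub>c) \<lfloor>Node Ts\<rfloor>\<^sub>c"
  by (simp add: wedges_def)

lemma ctx_of_single: "\<lfloor>Node [T]\<rfloor>\<^sub>c = susp_ctx \<lfloor>T\<rfloor>\<^sub>c"
  by (simp add: wedges_def wedge_point_right)

declare ctx_of.simps [simp del]

lemma globular_ctx_of: "globular \<lfloor>T\<rfloor>\<^sub>c"
proof (induction T rule: tree.induct)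
  case (Node Ts)
  then show ?case
    by (induction Ts) (simp_all add: ctx_of_Nil ctx_of_Cons globular_point globular_wedge globular_susp)
qed

lemmas ctx_of_scoped = globular_scoped[OF globular_ctx_of]
lemmas ctx_of_ok = globular_ctx_ok[OF _ globular_ctx_of]

text \<open>Insertion splices lists of subtrees; by strict associativity and units, splicing becomes
  wedging of contexts.\<close>

lemma ctx_of_append: "\<lfloor>Node (Xs @ Ys)\<rfloor>\<^sub>c = wedge \<lfloor>Node Xs\<rfloor>\<^sub>c \<lfloor>Node Ys\<rfloor>\<^sub>c"
  by (induction Xs)
     (simp_all add: ctx_of_Nil ctx_of_Cons wedge_point_left wedge_assoc globular_ctx_of globular_susp)

lemma ctx_of_split:
  "\<lfloor>Node (Xs @ Ys @ Zs)\<rfloor>\<^sub>c = wedge \<lfloor>Node Xs\<rfloor>\<^sub>c (wedge \<lfloor>Node Ys\<rfloor>\<^sub>c \<lfloor>Node Zs\<rfloor>\<^sub>c)"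
  by (simp add: ctx_of_append)

lemma dim_tree_le_0: "dim_tree (Node Ts) \<le> 0 \<longleftrightarrow> Ts = []"
  by simp

lemma dim_tree_le_Suc: "dim_tree (Node Ts) \<le> Suc n \<longleftrightarrow> (\<forall>T\<in>set Ts. dim_tree T \<le> n)"
  by auto

declare dim_tree.simps [simp del]

lemma dim_ctx_le: "dim_ctx \<Gamma> \<le> n \<longleftrightarrow> (\<forall>A\<in>set \<Gamma>. dim_ty A \<le> n)"
  by (auto simp: dim_ctx_def)

lemma dim_ctx_wedge_le:
  assumes "globular \<Delta>"
  shows "dim_ctx (wedge \<Gamma> \<Delta>) \<le> n \<longleftrightarrow> dim_ctx \<Gamma> \<le> n \<and> dim_ctx \<Delta> \<le> n"
proof -
  obtain As where \<Delta>: "\<Delta> = Star # As"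
    using globular_nonempty[OF assms] globular_zero[OF assms] by (cases \<Delta>) auto
  then have "set (wedge \<Gamma> \<Delta>) = set \<Gamma> \<union> (\<lambda>A. subst_ty A (wedge_inr \<Gamma> \<Delta>)) ` set As"
    by (simp add: wedge_def)
  moreover have "set \<Delta> = insert Star (set As)" by (simp add: \<Delta>)
  ultimately show ?thesis by (simp add: dim_ctx_le ball_Un)
qed

lemma dim_ctx_susp_le:
  "dim_ctx (susp_ctx \<Gamma>) \<le> Suc n \<longleftrightarrow> dim_ctx \<Gamma> \<le> n"
  "\<Gamma> \<noteq> [] \<Longrightarrow> \<not> dim_ctx (susp_ctx \<Gamma>) \<le> 0"
  unfolding dim_ctx_le susp_ctx_def by (auto simp: neq_Nil_conv)

lemma dim_ctx_of: "dim_ctx \<lfloor>T\<rfloor>\<^sub>c = dim_tree T"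
proof -
  \<comment> \<open>Two numbers with the same upper bounds are equal. Bounds, unlike maxima, pass to
    the parts of a wedge or a list without a case distinction on emptiness.\<close>
  have "dim_ctx \<lfloor>T\<rfloor>\<^sub>c \<le> n \<longleftrightarrow> dim_tree T \<le> n" for n
  proof (induction n T rule: tree_level_induct)
    case (1 T)
    obtain Ts where T: "T = Node Ts" by (cases T)
    show ?case
    proof (cases Ts)
      case Nil
      then show ?thesis by (simp add: T ctx_of_Nil dim_ctx_def dim_tree.simps)
    next
      case (Cons X Xs)
      have "\<not> dim_ctx \<lfloor>T\<rfloor>\<^sub>c \<le> 0"
        unfolding T Cons ctx_of_Cons dim_ctx_wedge_le[OF globular_ctx_of]
        using dim_ctx_susp_le(2)[OF globular_nonempty[OF globular_ctx_of]] by blast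
      then show ?thesis using dim_tree_le_0[of Ts] T Cons by simp
    qed
  next
    case (2 n)
    show ?case by (simp add: ctx_of_Nil dim_ctx_def dim_tree.simps)
  next
    case (3 n T Ts)
    then show ?case
      by (simp add: ctx_of_Cons dim_ctx_wedge_le globular_ctx_of dim_ctx_susp_le dim_tree_le_Suc)
  qed
  then show ?thesis by (meson le_antisym order_refl)
qed

section \<open>Boundaries and their inclusions\<close>

lemma bdry_Node_Suc: "bdry (Suc n) (Node (T # Ts)) = Node (bdry n T # map (bdry n) Ts)"
  by simp

lemma dim_bdry: "dim_tree (bdry n T) \<le> n"
proof (induction n arbitrary: T)
  case 0
  show ?case by (simp add: dim_tree.simps)
next
  case (Suc n)
  then show ?case by (cases T) (simp add: dim_tree_le_Suc)
qed

lemma bdry_bdry: "m \<le> n \<Longrightarrow> bdry m (bdry n T) = bdry m T"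
proof (induction m arbitrary: n T)
  case (Suc m)
  then obtain n' where "n = Suc n'" "m \<le> n'" by (cases n) auto
  then show ?case using Suc.IH by (cases T) simp
qed simp

lemma bdry_inc_Nil: "bdry_inc \<epsilon> (Suc n) (Node []) = [Var 0]"
  by simp

lemma bdry_inc_Cons:
  "bdry_inc \<epsilon> (Suc n) (Node (T # Ts)) =
    wedge_sub (susp_ctx \<lfloor>T\<rfloor>\<^sub>c) \<lfloor>Node Ts\<rfloor>\<^sub>c (susp_sub (bdry_inc \<epsilon> n T)) (bdry_inc \<epsilon> (Suc n) (Node Ts))"
  by (simp add: ctx_of.simps comp_def)

lemma bipointed_point: "bipointed [Star] [Star] [Var 0]"
  by (simp add: bipointed_def last_point_point scoped_def)

text \<open>Level 0 is excluded from the bipointed part since that boundary is a single point, sent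
  to one end only. From level 1 on, wedges of suspensions preserve both ends.\<close>

lemma bdry_inc_props:
  "ren \<lfloor>bdry n T\<rfloor>\<^sub>c \<lfloor>T\<rfloor>\<^sub>c (bdry_inc \<epsilon> n T) \<and>
   (0 < n \<longrightarrow> bipointed \<lfloor>bdry n T\<rfloor>\<^sub>c \<lfloor>T\<rfloor>\<^sub>c (bdry_inc \<epsilon> n T))"
proof (induction n T rule: tree_level_induct)
  case (1 T)
  then show ?case
    using globular_length[OF globular_ctx_of] globular_zero[OF globular_ctx_of] last_point_props[OF globular_ctx_of]
    by (cases \<epsilon>) (simp_all add: ren_def ctx_of_Nil)
next
  case (2 n)
  have "ren [Star] [Star] [Var 0]" by (simp add: ren_def)
  then show ?case by (simp add: ctx_of_Nil bipointed_point)
next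
  case (3 n T Ts)
  then have r: "ren \<lfloor>bdry n T\<rfloor>\<^sub>c \<lfloor>T\<rfloor>\<^sub>c (bdry_inc \<epsilon> n T)" by simp
  have b: "bipointed (susp_ctx \<lfloor>bdry n T\<rfloor>\<^sub>c) (susp_ctx \<lfloor>T\<rfloor>\<^sub>c) (susp_sub (bdry_inc \<epsilon> n T))"
    using r by (intro bipointed_susp ren_scoped ren_length)
  have b': "bipointed \<lfloor>Node (map (bdry n) Ts)\<rfloor>\<^sub>c \<lfloor>Node Ts\<rfloor>\<^sub>c (bdry_inc \<epsilon> (Suc n) (Node Ts))"
    and r': "ren \<lfloor>Node (map (bdry n) Ts)\<rfloor>\<^sub>c \<lfloor>Node Ts\<rfloor>\<^sub>c (bdry_inc \<epsilon> (Suc n) (Node Ts))"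
    using 3(2) by simp_all
  note W = globular_susp[OF globular_ctx_of] globular_susp[OF globular_ctx_of] globular_ctx_of globular_ctx_of b b'
  have r1: "ren (susp_ctx \<lfloor>bdry n T\<rfloor>\<^sub>c) (susp_ctx \<lfloor>T\<rfloor>\<^sub>c) (susp_sub (bdry_inc \<epsilon> n T))"
    using r ctx_of_scoped by (rule ren_susp)
  show ?case
    unfolding bdry_inc_Cons bdry_Node_Suc ctx_of_Cons
    using ren_wedge_sub[OF W r1 r'] bipointed_wedge_sub[OF W] by blast
qed

lemmas bdry_inc_ren = bdry_inc_props[THEN conjunct1]

lemma bdry_inc_bipointed: "bipointed \<lfloor>bdry (Suc n) T\<rfloor>\<^sub>c \<lfloor>T\<rfloor>\<^sub>c (bdry_inc \<epsilon> (Suc n) T)"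
  using bdry_inc_props[of "Suc n" T \<epsilon>] by simp

lemma length_bdry_inc: "length (bdry_inc \<epsilon> n T) = length \<lfloor>bdry n T\<rfloor>\<^sub>c"
  by (rule ren_length[OF bdry_inc_ren])

lemma scoped_bdry_inc: "scoped (length \<lfloor>T\<rfloor>\<^sub>c) (bdry_inc \<epsilon> n T)"
  by (rule ren_scoped[OF bdry_inc_ren])

lemma bdry_inc_susp_bipointed:
  "bipointed (susp_ctx \<lfloor>bdry n T\<rfloor>\<^sub>c) (susp_ctx \<lfloor>T\<rfloor>\<^sub>c) (susp_sub (bdry_inc \<epsilon> n T))"
  by (intro bipointed_susp length_bdry_inc scoped_bdry_inc)

lemma bdry_inc_single: "bdry_inc \<epsilon> (Suc n) (Node [T]) = susp_sub (bdry_inc \<epsilon> n T)"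
  unfolding bdry_inc_Cons ctx_of_Nil bdry_inc_Nil
  using scoped_susp[OF scoped_bdry_inc] by (intro wedge_sub_point_right) simp

text \<open>Globularity: the sign of the lower boundary wins, because an inclusion of positive level
  preserves both end points. The inequality must be strict, since at m = n the inner inclusion is an
  identity and the sign \<epsilon>' would remain.\<close>

lemma bdry_inc_comp:
  "m < n \<Longrightarrow> comp_sub (bdry_inc \<epsilon> m (bdry n T)) (bdry_inc \<epsilon>' n T) = bdry_inc \<epsilon> m T"
proof (induction m T arbitrary: n rule: tree_level_induct)
  case (1 T)
  then obtain n' where "n = Suc n'" by (cases n) auto
  then show ?case
    using bdry_inc_bipointed[of n' T \<epsilon>'] by (cases \<epsilon>) (simp_all add: bipointed_def comp_sub_def)
next
  case (2 m)
  then obtain n' where "n = Suc n'" by (cases n) auto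
  then show ?case by (simp add: comp_sub_def)
next
  case (3 m T Ts)
  then obtain n' where n: "n = Suc n'" "m < n'" by (cases n) auto
  have bb: "bdry m (bdry n' X) = bdry m X" for X using n(2) by (simp add: bdry_bdry)
  have bbs: "map (bdry m \<circ> bdry n') Ts = map (bdry m) Ts" using bb by simp
  have b1: "bipointed (susp_ctx \<lfloor>bdry m T\<rfloor>\<^sub>c) (susp_ctx \<lfloor>bdry n' T\<rfloor>\<^sub>c) (susp_sub (bdry_inc \<epsilon> m (bdry n' T)))"
    using bdry_inc_susp_bipointed[of m "bdry n' T" \<epsilon>] by (simp add: bb)
  have b2: "bipointed (susp_ctx \<lfloor>bdry n' T\<rfloor>\<^sub>c) (susp_ctx \<lfloor>T\<rfloor>\<^sub>c) (susp_sub (bdry_inc \<epsilon>' n' T))"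
    by (rule bdry_inc_susp_bipointed)
  have b3: "bipointed \<lfloor>Node (map (bdry m) Ts)\<rfloor>\<^sub>c \<lfloor>Node (map (bdry n') Ts)\<rfloor>\<^sub>c
      (bdry_inc \<epsilon> (Suc m) (Node (map (bdry n') Ts)))"
    using bdry_inc_bipointed[of m "Node (map (bdry n') Ts)" \<epsilon>] by (simp add: bbs del: bdry_inc.simps)
  have b4: "bipointed \<lfloor>Node (map (bdry n') Ts)\<rfloor>\<^sub>c \<lfloor>Node Ts\<rfloor>\<^sub>c (bdry_inc \<epsilon>' (Suc n') (Node Ts))"
    using bdry_inc_bipointed[of n' "Node Ts" \<epsilon>'] by (simp del: bdry_inc.simps)
  note glob = globular_susp[OF globular_ctx_of] globular_susp[OF globular_ctx_of] globular_susp[OF globular_ctx_of]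
    globular_ctx_of globular_ctx_of globular_ctx_of
  have "comp_sub (bdry_inc \<epsilon> (Suc m) (bdry n (Node (T # Ts)))) (bdry_inc \<epsilon>' n (Node (T # Ts)))
    = wedge_sub (susp_ctx \<lfloor>T\<rfloor>\<^sub>c) \<lfloor>Node Ts\<rfloor>\<^sub>c
        (comp_sub (susp_sub (bdry_inc \<epsilon> m (bdry n' T))) (susp_sub (bdry_inc \<epsilon>' n' T)))
        (comp_sub (bdry_inc \<epsilon> (Suc m) (Node (map (bdry n') Ts))) (bdry_inc \<epsilon>' (Suc n') (Node Ts)))"
    unfolding n bdry_Node_Suc bdry_inc_Cons
    by (rule wedge_sub_comp[OF glob b1 b2 b3 b4])
  also have "comp_sub (susp_sub (bdry_inc \<epsilon> m (bdry n' T))) (susp_sub (bdry_inc \<epsilon>' n' T)) = susp_sub (bdry_inc \<epsilon> m T)"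
    using 3(1)[OF n(2)] scoped_bdry_inc[of "bdry n' T" \<epsilon> m]
    by (simp add: length_bdry_inc flip: susp_comp)
  also have "comp_sub (bdry_inc \<epsilon> (Suc m) (Node (map (bdry n') Ts))) (bdry_inc \<epsilon>' (Suc n') (Node Ts))
      = bdry_inc \<epsilon> (Suc m) (Node Ts)"
    using 3(2)[of "Suc n'"] n by (simp del: bdry_inc.simps)
  finally show ?case by (simp only: bdry_inc_Cons)
qed

lemma bdry_inc_id: "dim_tree T \<le> n \<Longrightarrow> bdry_inc \<epsilon> n T = id_sub \<lfloor>T\<rfloor>\<^sub>c"
proof (induction n T rule: tree_level_induct)
  case (1 T)
  then have "T = Node []" by (cases T) (simp add: dim_tree.simps split: if_splits)
  then show ?case by (cases \<epsilon>) (simp_all add: ctx_of_Nil last_point_point id_sub_def)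
next
  case (2 n)
  show ?case by (simp add: ctx_of_Nil id_sub_def)
next
  case (3 n T Ts)
  then have "bdry_inc \<epsilon> n T = id_sub \<lfloor>T\<rfloor>\<^sub>c" "bdry_inc \<epsilon> (Suc n) (Node Ts) = id_sub \<lfloor>Node Ts\<rfloor>\<^sub>c"
    by (simp_all add: dim_tree_le_Suc del: bdry_inc.simps)
  then show ?case
    by (simp only: bdry_inc_Cons susp_id ctx_of_Cons wedge_sub_id[OF globular_susp[OF globular_ctx_of] globular_ctx_of])
qed

section \<open>Discs and the substitutions classifying a type with a term\<close>

fun sphere :: "nat \<Rightarrow> ty" where
  "sphere 0 = Star"
| "sphere (Suc n) = Arr (Var (2 * n)) (sphere n) (Var (Suc (2 * n)))"

lemma dim_sphere [simp]: "dim_ty (sphere n) = n"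
  by (induction n) auto

lemma susp_sphere: "susp_ty (sphere n) = sphere (Suc n)"
  by (induction n) auto

lemma fv_sphere: "fv_ty (sphere n) = {..<2 * n}"
  by (induction n) (simp_all add: lessThan_Suc)

lemma ctx_of_disc_Suc: "\<lfloor>disc (Suc n)\<rfloor>\<^sub>c = susp_ctx \<lfloor>disc n\<rfloor>\<^sub>c"
  by (simp add: ctx_of_single)

lemma length_ctx_of_disc: "length \<lfloor>disc n\<rfloor>\<^sub>c = Suc (2 * n)"
proof (induction n)
  case 0
  show ?case by (simp add: ctx_of_Nil)
next
  case (Suc n)
  then show ?case by (simp del: disc.simps add: ctx_of_disc_Suc)
qed

text \<open>Levels 2k and 2k+1 hold the two k-dimensional boundary variables, both of type
  \<open>sphere k\<close>; the top variable sits at level 2n with type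
  \<open>sphere n\<close>.\<close>

lemma ctx_of_disc_nth: "i < Suc (2 * n) \<Longrightarrow> \<lfloor>disc n\<rfloor>\<^sub>c ! i = sphere (i div 2)"
proof (induction n arbitrary: i)
  case 0
  then show ?case by (simp add: ctx_of_Nil)
next
  case (Suc n)
  from Suc.prems have "i < Suc (Suc (Suc (2 * n)))" by simp
  then show ?case
  proof (cases rule: less_Suc_Suc_cases)
    case (3 k)
    then have "\<lfloor>disc (Suc n)\<rfloor>\<^sub>c ! i = susp_ty (sphere (k div 2))"
      unfolding ctx_of_disc_Suc using Suc.IH[of k] by (simp add: length_ctx_of_disc)
    then show ?thesis using 3 by (simp only: susp_sphere) simp
  qed (simp_all del: disc.simps add: ctx_of_disc_Suc)
qed

lemma length_disc_boundary [simp]: "length (disc_boundary_sub A) = 2 * dim_ty A"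
  by (induction A rule: disc_boundary_sub.induct) auto

lemma length_disc_sub: "length (disc_sub A t) = Suc (2 * dim_ty A)"
  by (simp add: disc_sub_def)

text \<open>Every type is an instance of the sphere of its dimension, along its own list of sources
  and targets. The suffix \<tau> leaves room for the entries that follow.\<close>

lemma subst_sphere: "subst_ty (sphere (dim_ty A)) (disc_boundary_sub A @ \<tau>) = A"
  by (induction A arbitrary: \<tau> rule: disc_boundary_sub.induct) (auto simp: nth_append)

text \<open>Q and W stand for being a type and being a term of that type; the single fact required
  of them is inversion at an arrow.\<close>

lemma disc_boundary_entries:
  assumes closed: "\<And>s A t. Q (Arr s A t) \<Longrightarrow> Q A \<and> W s A \<and> W t A"
  shows "Q A \<Longrightarrow> i < 2 * dim_ty A \<Longrightarrow>
    W ((disc_boundary_sub A @ \<tau>) ! i) (subst_ty (sphere (i div 2)) (disc_boundary_sub A @ \<tau>))"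
proof (induction A arbitrary: \<tau> rule: disc_boundary_sub.induct)
  case (2 s A t)
  have A: "Q A" "W s A" "W t A" using closed[OF 2(2)] by auto
  have eq: "disc_boundary_sub (Arr s A t) @ \<tau> = disc_boundary_sub A @ [s, t] @ \<tau>" by simp
  consider "i < 2 * dim_ty A" | "i = 2 * dim_ty A" | "i = Suc (2 * dim_ty A)"
    using 2(3) by (simp, linarith)
  then show ?case
  proof cases
    case 1
    then show ?thesis unfolding eq using 2(1) A(1) by blast
  next
    case 2
    then show ?thesis unfolding eq using A subst_sphere[of A "[s, t] @ \<tau>"] by (simp add: nth_append)
  next
    case 3
    then show ?thesis unfolding eq using A subst_sphere[of A "[s, t] @ \<tau>"] by (simp add: nth_append)
  qed
qed simp

lemma disc_sub_entries:
  assumes closed: "\<And>s A t. Q (Arr s A t) \<Longrightarrow> Q A \<and> W s A \<and> W t A"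
    and "Q A" "W t A" "i < length \<lfloor>disc (dim_ty A)\<rfloor>\<^sub>c"
  shows "W (disc_sub A t ! i) (subst_ty (\<lfloor>disc (dim_ty A)\<rfloor>\<^sub>c ! i) (disc_sub A t))"
proof (cases "i < 2 * dim_ty A")
  case True
  then show ?thesis
    using disc_boundary_entries[of Q W, OF closed \<open>Q A\<close> True] by (simp add: disc_sub_def ctx_of_disc_nth)
next
  case False
  then have "i = 2 * dim_ty A" using assms(4) by (simp add: length_ctx_of_disc)
  then show ?thesis
    using assms(3) subst_sphere[of A "[t]"] by (simp add: disc_sub_def ctx_of_disc_nth nth_append)
qed

lemma disc_sub_ok:
  assumes gens: "eq_generators R" and A: "ty_ok R \<Gamma> A" and t: "tm_ok R \<Gamma> t A"
  shows "sub_ok R \<Gamma> (disc_sub A t) \<lfloor>disc (dim_ty A)\<rfloor>\<^sub>c"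
proof (rule sub_okI[OF gens])
  show "ctx_ok R \<lfloor>disc (dim_ty A)\<rfloor>\<^sub>c" using gens by (rule ctx_of_ok)
  show "is_ctx \<Gamma>" using judgements_raw(2)[OF gens A] raw_scoped(2) by blast
  have closed: "ty_ok R \<Gamma> B \<and> tm_ok R \<Gamma> s B \<and> tm_ok R \<Gamma> u B" if "ty_ok R \<Gamma> (Arr s B u)" for s B u
    using that by cases auto
  show "tm_ok R \<Gamma> (disc_sub A t ! i) (subst_ty (\<lfloor>disc (dim_ty A)\<rfloor>\<^sub>c ! i) (disc_sub A t))"
    if "i < length \<lfloor>disc (dim_ty A)\<rfloor>\<^sub>c" for i
    using disc_sub_entries[of "ty_ok R \<Gamma>" "tm_ok R \<Gamma>", OF closed A t that] .
qed (simp add: length_disc_sub length_ctx_of_disc)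

lemma disc_sub_subst: "disc_sub (subst_ty A \<sigma>) (subst_tm t \<sigma>) = comp_sub (disc_sub A t) \<sigma>"
proof -
  have "disc_boundary_sub (subst_ty A \<sigma>) = comp_sub (disc_boundary_sub A) \<sigma>"
    by (induction A rule: disc_boundary_sub.induct) (auto simp: comp_sub_def)
  then show ?thesis by (simp add: disc_sub_def comp_sub_def)
qed

text \<open>The entries \<open>Var 0\<close> and \<open>Var 1\<close> that open a suspended
  substitution are the boundary list of the suspended point type.\<close>

lemma disc_sub_susp: "disc_sub (susp_ty A) (susp_tm t) = susp_sub (disc_sub A t)"
proof -
  have "disc_boundary_sub (susp_ty A) = susp_sub (disc_boundary_sub A)"
    by (induction A rule: disc_boundary_sub.induct) (auto simp: susp_sub_def)
  then show ?thesis by (simp add: disc_sub_def susp_sub_def)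
qed

lemma disc_sub_id: "disc_sub (sphere n) (Var (2 * n)) = id_sub \<lfloor>disc n\<rfloor>\<^sub>c"
proof -
  have "disc_boundary_sub (sphere n) = map Var [0..<2 * n]"
    by (induction n) auto
  then show ?thesis by (simp add: disc_sub_def id_sub_def length_ctx_of_disc)
qed

lemma linear_eq_disc: "linear T \<Longrightarrow> T = disc (dim_tree T)"
proof (induction T rule: trunk_height.induct)
  case (1 T)
  have "dim_tree (Node [T]) = Suc (dim_tree T)" by (simp add: dim_tree.simps)
  then show ?case using 1 by (simp add: linear_def)
qed (simp_all add: linear_def dim_tree.simps)

section \<open>Standard types, terms and coherences\<close>

lemma fv_std_tm: "fv_tm (std_tm n T) \<subseteq> {..<length \<lfloor>T\<rfloor>\<^sub>c}"
  by (auto simp: length_ctx_of_disc disc_top_def id_sub_def)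

lemma fv_std_ty: "fv_ty (std_ty n T) \<subseteq> {..<length \<lfloor>T\<rfloor>\<^sub>c}"
proof (induction n)
  case (Suc n)
  have "fv_tm (subst_tm (std_tm n (bdry n T)) (bdry_inc \<epsilon> n T)) \<subseteq> {..<length \<lfloor>T\<rfloor>\<^sub>c}" for \<epsilon>
    using scoped_bdry_inc by (rule fv_subst_scoped) (simp add: length_bdry_inc fv_std_tm del: std_tm.simps)
  then show ?case using Suc by (simp del: std_tm.simps)
qed simp

lemma dim_std_ty [simp]: "dim_ty (std_ty n T) = n"
  by (induction n) auto

text \<open>The standard type of dimension m is assembled from boundaries of level below m, which
  the n-boundary shares with T, so globularity applies. Consequently a standard source and target
  are parallel, whatever the sign.\<close>

lemma std_ty_bdry:
  "m \<le> n \<Longrightarrow> subst_ty (std_ty m (bdry n T)) (bdry_inc \<epsilon> n T) = std_ty m T"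
proof (induction m)
  case (Suc m)
  have "subst_tm (subst_tm (std_tm m (bdry m T)) (bdry_inc \<epsilon>' m (bdry n T))) (bdry_inc \<epsilon> n T)
      = subst_tm (std_tm m (bdry m T)) (bdry_inc \<epsilon>' m T)" for \<epsilon>'
  proof -
    have "fv_tm (std_tm m (bdry m T)) \<subseteq> {..<length (bdry_inc \<epsilon>' m (bdry n T))}"
      using Suc.prems fv_std_tm[of m "bdry m T"] by (simp add: length_bdry_inc bdry_bdry del: std_tm.simps)
    then show ?thesis
      using Suc.prems by (simp add: bdry_inc_comp del: std_tm.simps flip: subst_comp)
  qed
  then show ?case using Suc by (simp add: bdry_bdry del: std_tm.simps)
qed simp

lemma bdry_disc: "m \<le> n \<Longrightarrow> bdry m (disc n) = disc m"
proof (induction m arbitrary: n)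
  case (Suc m)
  then show ?case by (cases n) auto
qed simp

text \<open>The m-boundary of a disc is again a disc, with top variable at level 2m; the inclusion
  sends it to the m-dimensional source or target.\<close>

lemma bdry_inc_disc:
  "m < n \<Longrightarrow> bdry_inc \<epsilon> m (disc n) ! (2 * m) = Var (case \<epsilon> of Minus \<Rightarrow> 2 * m | Plus \<Rightarrow> Suc (2 * m))"
proof (induction m arbitrary: n)
  case 0
  then obtain n' where "n = Suc n'" by (cases n) auto
  then show ?case by (cases \<epsilon>) (simp_all add: ctx_of_single last_point_susp)
next
  case (Suc m)
  then obtain n' where n: "n = Suc n'" "m < n'" by (cases n) auto
  have "2 * m < length (bdry_inc \<epsilon> m (disc n'))"
    using n(2) by (simp add: length_bdry_inc bdry_disc length_ctx_of_disc)
  then show ?case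
    using Suc.IH[OF n(2)] unfolding n disc.simps bdry_inc_single by (cases \<epsilon>) simp_all
qed

lemma std_ty_disc: "m \<le> n \<Longrightarrow> std_ty m (disc n) = sphere m"
  by (induction m) (simp_all add: bdry_disc bdry_inc_disc disc_top_def)

text \<open>The type drives the induction: the coherence and the term of a given dimension follow
  from the type of that dimension, and the next type is built from terms over boundaries. This is
  why the claim ranges over all trees.\<close>

lemma susp_std:
  "susp_ty (std_ty n T) = std_ty (Suc n) (Node [T])"
  "susp_tm (std_coh n T) = std_coh (Suc n) (Node [T])"
  "susp_tm (std_tm n T) = std_tm (Suc n) (Node [T])"
proof -
  have coh: "susp_tm (std_coh n T) = std_coh (Suc n) (Node [T])"
    if "susp_ty (std_ty n T) = std_ty (Suc n) (Node [T])" for n T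
    using that susp_id[of "\<lfloor>T\<rfloor>\<^sub>c"] by (simp add: ctx_of_single susp_ctx_def susp_sub_def del: std_ty.simps)
  have tm: "susp_tm (std_tm n T) = std_tm (Suc n) (Node [T])"
    if "susp_ty (std_ty n T) = std_ty (Suc n) (Node [T])" for n T
    using coh[OF that] by (simp add: disc_top_def del: std_coh.simps)
  have "susp_ty (std_ty n T) = std_ty (Suc n) (Node [T])" for n T
  proof (induction n arbitrary: T)
    case 0
    \<comment> \<open>The first and last points of a suspension are its two suspension points, so
      both sides are the arrow from level 0 to level 1.\<close>
    show ?case by (simp add: disc_top_def ctx_of_single last_point_susp)
  next
    case (Suc n)
    have "susp_tm (subst_tm (std_tm n (bdry n T)) (bdry_inc \<epsilon> n T))
        = subst_tm (std_tm (Suc n) (bdry (Suc n) (Node [T]))) (bdry_inc \<epsilon> (Suc n) (Node [T]))" for \<epsilon>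
    proof -
      have "fv_tm (std_tm n (bdry n T)) \<subseteq> {..<length (bdry_inc \<epsilon> n T)}"
        unfolding length_bdry_inc by (rule fv_std_tm)
      moreover have "bdry (Suc n) (Node [T]) = Node [bdry n T]" by simp
      ultimately show ?thesis
        by (simp only: susp_subst bdry_inc_single tm[OF Suc.IH])
    qed
    then show ?case
      by (simp only: std_ty.simps(2)[of n T] std_ty.simps(2)[of "Suc n"] susp_ty.simps Suc.IH[of T])
  qed
  from this coh[OF this] tm[OF this]
  show "susp_ty (std_ty n T) = std_ty (Suc n) (Node [T])"
    "susp_tm (std_coh n T) = std_coh (Suc n) (Node [T])" "susp_tm (std_tm n T) = std_tm (Suc n) (Node [T])" .
qed


section \<open>Insertion\<close>

lemma down_closure_le: "V \<subseteq> down_closure \<Gamma> W \<Longrightarrow> down_closure \<Gamma> V \<subseteq> down_closure \<Gamma> W"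
proof
  fix i assume "V \<subseteq> down_closure \<Gamma> W" "i \<in> down_closure \<Gamma> V"
  then show "i \<in> down_closure \<Gamma> W"
    by (induction rule: down_closure.induct[OF \<open>i \<in> down_closure \<Gamma> V\<close>]) (auto intro: down_closure.step)
qed

text \<open>A coherence applied to \<rho> has the free variables of \<rho> at once. On a disc the
  term is a single variable, and downward closure recovers the rest, because the type of the top
  variable mentions every other variable of the disc.\<close>

lemma supp_std_tm:
  assumes ren: "ren \<lfloor>X\<rfloor>\<^sub>c \<Gamma> \<rho>"
  shows "supp_tm \<Gamma> (subst_tm (std_tm m X) \<rho>) = supp_sub \<Gamma> \<rho>"
proof (cases "X = disc m")
  case False
  have "map (\<lambda>t. subst_tm t \<rho>) (id_sub \<lfloor>X\<rfloor>\<^sub>c) = \<rho>"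
    using comp_id_left[OF ren_length[OF ren]] by (simp add: comp_sub_def)
  then have "subst_tm (std_tm m X) \<rho> = Coh \<lfloor>X\<rfloor>\<^sub>c (std_ty m X) \<rho>"
    using False by simp
  then show ?thesis by (simp add: supp_tm_def supp_sub_def)
next
  case True
  have len: "length \<lfloor>X\<rfloor>\<^sub>c = Suc (2 * m)" by (simp add: True length_ctx_of_disc)
  obtain v where v: "v < length \<Gamma>" "\<rho> ! (2 * m) = Var v" "\<Gamma> ! v = subst_ty (sphere m) \<rho>"
    using ren_nthE[OF ren, of "2 * m"] len ctx_of_disc_nth[of "2 * m" m] True by auto
  have tm: "subst_tm (std_tm m X) \<rho> = Var v" using True v by (simp add: disc_top_def)
  have "fv_tm (\<rho> ! i) \<subseteq> down_closure \<Gamma> {v}" if "i < length \<rho>" for i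
  proof (cases "i = 2 * m")
    case True
    then show ?thesis using v by (auto intro: down_closure.base)
  next
    case False
    then have "i < 2 * m" using that ren_length[OF ren] len by simp
    then have "fv_tm (\<rho> ! i) \<subseteq> fv_ty (\<Gamma> ! v)" by (auto simp: v(3) fv_subst fv_sphere)
    then show ?thesis using v(1) by (blast intro: down_closure.base down_closure.step)
  qed
  then have "fv_tm t \<subseteq> down_closure \<Gamma> {v}" if "t \<in> set \<rho>" for t
    using that by (metis in_set_conv_nth)
  then have "down_closure \<Gamma> (\<Union>t\<in>set \<rho>. fv_tm t) \<subseteq> down_closure \<Gamma> {v}"
    by (intro down_closure_le) blast
  moreover have "\<rho> ! (2 * m) \<in> set \<rho>" using ren_length[OF ren] len by (intro nth_mem) simp
  then have "down_closure \<Gamma> {v} \<subseteq> down_closure \<Gamma> (\<Union>t\<in>set \<rho>. fv_tm t)"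
    using v(2) by (intro down_closure_le) (force intro: down_closure.base)
  ultimately show ?thesis unfolding tm by (simp add: supp_tm_def supp_sub_def)
qed

lemma supp_id:
  assumes "scoped_ctx \<Gamma>"
  shows "supp_sub \<Gamma> (id_sub \<Gamma>) = {..<length \<Gamma>}"
proof -
  have "(\<Union>t\<in>set (id_sub \<Gamma>). fv_tm t) = {..<length \<Gamma>}" by (auto simp: id_sub_def)
  moreover have "i < length \<Gamma>" if "i \<in> down_closure \<Gamma> {..<length \<Gamma>}" for i
    using that
  proof induction
    case (step i j)
    then show ?case using scoped_ctx_nth[OF assms step(2)] by blast
  qed simp
  ultimately show ?thesis unfolding supp_sub_def by (auto intro: down_closure.base)
qed

text \<open>The two alternatives of the support condition both occur: in dimension at most m the
  boundary inclusions are identities and the supports are full; in dimension m+1 they are those of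
  the codimension-one boundary.\<close>

lemma std_coh_supp_cond:
  assumes "dim_tree T \<le> Suc m"
  shows "coh_supp_cond T (subst_tm (std_tm m (bdry m T)) (bdry_inc Minus m T))
    (subst_tm (std_tm m (bdry m T)) (bdry_inc Plus m T))"
proof (cases "dim_tree T \<le> m")
  case True
  then have "supp_sub \<lfloor>T\<rfloor>\<^sub>c (bdry_inc \<epsilon> m T) = {..<length \<lfloor>T\<rfloor>\<^sub>c}" for \<epsilon>
    by (simp add: bdry_inc_id supp_id ctx_of_scoped)
  then show ?thesis
    by (simp add: coh_supp_cond_def Let_def supp_std_tm[OF bdry_inc_ren] del: std_tm.simps)
next
  case False
  with assms have "dim_ctx \<lfloor>T\<rfloor>\<^sub>c = Suc m" by (simp add: dim_ctx_of)
  then show ?thesis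
    by (simp add: coh_supp_cond_def Let_def supp_std_tm[OF bdry_inc_ren] del: std_tm.simps)
qed

lemma std_coh_ok_if:
  assumes gens: "eq_generators R" and "ty_ok R \<lfloor>T\<rfloor>\<^sub>c (std_ty (Suc m) T)" "dim_tree T \<le> Suc m"
  shows "tm_ok R \<lfloor>T\<rfloor>\<^sub>c (std_coh (Suc m) T) (std_ty (Suc m) T)"
proof -
  have "tm_ok R \<lfloor>T\<rfloor>\<^sub>c (std_coh (Suc m) T) (subst_ty (std_ty (Suc m) T) (id_sub \<lfloor>T\<rfloor>\<^sub>c))"
    using assms(2) unfolding std_coh.simps std_ty.simps(2)
    by (rule tm_Coh[OF _ sub_ok_id[OF gens ctx_of_ok[OF gens]] std_coh_supp_cond[OF assms(3)]])
  then show ?thesis by (simp only: subst_id fv_std_ty)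
qed

text \<open>Types are claimed for every tree, terms only up to dimension n. This is enough to
  continue, since the ends of the next type are standard terms over the n-boundary, whose dimension
  is at most n.\<close>

lemma std_ok:
  assumes gens: "eq_generators R" and tame: "tame R"
  shows "ty_ok R \<lfloor>T\<rfloor>\<^sub>c (std_ty n T) \<and> (dim_tree T \<le> n \<longrightarrow> tm_ok R \<lfloor>T\<rfloor>\<^sub>c (std_tm n T) (std_ty n T))"
proof (induction n arbitrary: T)
  case 0
  have "ty_ok R \<lfloor>T\<rfloor>\<^sub>c Star" for T
    using judgements_raw(1)[OF gens ctx_of_ok[OF gens]] by (rule ty_Star)
  moreover have "T = Node []" if "dim_tree T \<le> 0"
    using that by (cases T) (simp only: dim_tree_le_0)
  moreover have "tm_ok R [Star] (Var 0) Star"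
    using tm_Var[of R "[Star]" 0] globular_ctx_ok[OF gens globular_point] by simp
  ultimately show ?case by (auto simp: disc_top_def ctx_of_Nil)
next
  case (Suc n)
  have "tm_ok R \<lfloor>T\<rfloor>\<^sub>c (subst_tm (std_tm n (bdry n T)) (bdry_inc \<epsilon> n T)) (std_ty n T)" for \<epsilon>
  proof -
    have "tm_ok R \<lfloor>bdry n T\<rfloor>\<^sub>c (std_tm n (bdry n T)) (std_ty n (bdry n T))"
      using Suc dim_bdry by blast
    moreover have "sub_ok R \<lfloor>T\<rfloor>\<^sub>c (bdry_inc \<epsilon> n T) \<lfloor>bdry n T\<rfloor>\<^sub>c"
      using gens ctx_of_ok[OF gens] ctx_of_ok[OF gens] bdry_inc_ren by (rule ren_sub_ok)
    ultimately show ?thesis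
      using judgements_subst(3)[OF gens tame] std_ty_bdry[of n n T \<epsilon>] by fastforce
  qed
  then have ty: "ty_ok R \<lfloor>T\<rfloor>\<^sub>c (std_ty (Suc n) T)"
    unfolding std_ty.simps(2) using Suc by (intro ty_Arr) auto
  moreover have "tm_ok R \<lfloor>T\<rfloor>\<^sub>c (std_tm (Suc n) T) (std_ty (Suc n) T)" if "dim_tree T \<le> Suc n"
  proof (cases "T = disc (Suc n)")
    case True
    have "tm_ok R \<lfloor>T\<rfloor>\<^sub>c (Var (2 * Suc n)) (\<lfloor>T\<rfloor>\<^sub>c ! (2 * Suc n))"
      unfolding True by (intro tm_Var ctx_of_ok[OF gens]) (simp only: length_ctx_of_disc)
    moreover have "\<lfloor>T\<rfloor>\<^sub>c ! (2 * Suc n) = std_ty (Suc n) T"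
      unfolding True using ctx_of_disc_nth[of "2 * Suc n" "Suc n"] std_ty_disc[of "Suc n" "Suc n"]
      by (simp del: std_ty.simps disc.simps)
    ultimately show ?thesis using True by (simp only: std_tm.simps disc_top_def simp_thms if_True)
  next
    case False
    then show ?thesis using std_coh_ok_if[OF gens ty that] by (simp only: std_tm.simps if_False)
  qed
  ultimately show ?case by blast
qed

text \<open>Positivity of n is essential to the coherence: the typing rule demands an arrow type,
  while the standard type of dimension 0 is the point type.\<close>

lemma std_disc_sub_ok:
  assumes gens: "eq_generators R" and tame: "tame R" and "dim_tree T \<le> n" "0 < n"
  shows "sub_ok R \<lfloor>T\<rfloor>\<^sub>c (disc_sub (std_ty n T) (std_coh n T)) \<lfloor>disc n\<rfloor>\<^sub>c"
proof -
  obtain m where "n = Suc m" using assms(4) by (cases n) auto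
  then show ?thesis
    using disc_sub_ok[OF gens, of "\<lfloor>T\<rfloor>\<^sub>c" "std_ty n T" "std_coh n T"] std_ok[OF gens tame, of T n]
      std_coh_ok_if[OF gens, of T m] assms(3) by (simp del: std_ty.simps std_coh.simps disc.simps)
qed

lemma scoped_disc_sub: "fv_ty A \<subseteq> {..<n} \<Longrightarrow> fv_tm t \<subseteq> {..<n} \<Longrightarrow> scoped n (disc_sub A t)"
proof -
  have "fv_ty A \<subseteq> {..<n} \<Longrightarrow> scoped n (disc_boundary_sub A)"
    by (induction A rule: disc_boundary_sub.induct) (auto simp: scoped_def)
  then show "fv_ty A \<subseteq> {..<n} \<Longrightarrow> fv_tm t \<subseteq> {..<n} \<Longrightarrow> scoped n (disc_sub A t)"
    by (auto simp: scoped_def disc_sub_def)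
qed

lemma fv_std_coh: "fv_tm (std_coh n T) \<subseteq> {..<length \<lfloor>T\<rfloor>\<^sub>c}"
  by (auto simp: id_sub_def)

text \<open>Each standard type extends the previous one by a final source and target, so the list
  always begins with the ends of the one-dimensional type, namely the first and last points of T;
  these are the images of levels 0 and 1 of the disc.\<close>

lemma std_disc_sub_bipointed:
  "bipointed \<lfloor>disc (Suc m)\<rfloor>\<^sub>c \<lfloor>T\<rfloor>\<^sub>c (disc_sub (std_ty (Suc m) T) (std_coh (Suc m) T))"
proof -
  have "\<exists>xs. disc_boundary_sub (std_ty (Suc m) T) = [Var 0, Var (last_point \<lfloor>T\<rfloor>\<^sub>c)] @ xs"
  proof (induction m)
    case 0
    show ?case by (simp add: disc_top_def)
  next
    case (Suc m)
    then obtain xs where "disc_boundary_sub (std_ty (Suc m) T) = [Var 0, Var (last_point \<lfloor>T\<rfloor>\<^sub>c)] @ xs" ..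
    then show ?case by (simp only: std_ty.simps(2)[of "Suc m"] disc_boundary_sub.simps) simp
  qed
  then have "disc_sub (std_ty (Suc m) T) (std_coh (Suc m) T) ! 0 = Var 0"
    "disc_sub (std_ty (Suc m) T) (std_coh (Suc m) T) ! Suc 0 = Var (last_point \<lfloor>T\<rfloor>\<^sub>c)"
    by (auto simp: disc_sub_def simp del: std_ty.simps std_coh.simps)
  then show ?thesis
    using scoped_disc_sub[OF fv_std_ty[of "Suc m" T] fv_std_coh[of "Suc m" T]]
    by (simp add: bipointed_def ctx_of_disc_Suc last_point_susp length_disc_sub length_ctx_of_disc
        del: disc.simps std_ty.simps std_coh.simps)
qed

section \<open>Gluing squares along a branch\<close>

lemma branch_var_Cons:
  fixes Ss k
  defines "L \<equiv> \<lfloor>Node (take k Ss)\<rfloor>\<^sub>c" and "N \<equiv> \<lfloor>Node (drop (Suc k) Ss)\<rfloor>\<^sub>c"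
  assumes "k < length Ss" and less: "branch_var (Ss ! k) P < length \<lfloor>Ss ! k\<rfloor>\<^sub>c"
  shows "\<lfloor>Node Ss\<rfloor>\<^sub>c = wedge L (wedge (susp_ctx \<lfloor>Ss ! k\<rfloor>\<^sub>c) N)"
    and "branch_var (Node Ss) (k # P) < length \<lfloor>Node Ss\<rfloor>\<^sub>c"
    and "\<lfloor>Node Ss\<rfloor>\<^sub>c ! branch_var (Node Ss) (k # P)
      = subst_ty (susp_ty (\<lfloor>Ss ! k\<rfloor>\<^sub>c ! branch_var (Ss ! k) P)) (wedge_inr L (wedge (susp_ctx \<lfloor>Ss ! k\<rfloor>\<^sub>c) N))"
proof -
  let ?X = "susp_ctx \<lfloor>Ss ! k\<rfloor>\<^sub>c" and ?p = "branch_var (Ss ! k) P"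
  have "Ss = take k Ss @ [Ss ! k] @ drop (Suc k) Ss"
    using assms(3) by (simp add: id_take_nth_drop)
  then show eq: "\<lfloor>Node Ss\<rfloor>\<^sub>c = wedge L (wedge ?X N)"
    unfolding L_def N_def by (metis ctx_of_split ctx_of_single)
  have glob: "globular L" "globular ?X" "globular N"
    by (simp_all add: L_def N_def globular_ctx_of globular_susp)
  have bv: "branch_var (Node Ss) (k # P) = wedge_right L (Suc (Suc ?p))" by (simp add: L_def)
  have X: "Suc (Suc ?p) < length ?X" using less by simp
  \<comment> \<open>The shift by two passes the suspension points, and the variable stays within the
    suspended subtree; hence its type in the wedge is the one declared there.\<close>
  then have XN: "Suc (Suc ?p) < length (wedge ?X N)" by (simp add: wedge_def)
  show "branch_var (Node Ss) (k # P) < length \<lfloor>Node Ss\<rfloor>\<^sub>c"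
    unfolding bv eq using glob(1) XN by (rule wedge_right_less)
  show "\<lfloor>Node Ss\<rfloor>\<^sub>c ! branch_var (Node Ss) (k # P) = subst_ty (susp_ty (\<lfloor>Ss ! k\<rfloor>\<^sub>c ! ?p)) (wedge_inr L (wedge ?X N))"
    unfolding bv eq using XN X less by (simp add: wedge_nth_right glob globular_wedge wedge_nth_left)
qed

lemma branch_var_less: "is_path S P \<Longrightarrow> linear (subtree S P) \<Longrightarrow> branch_var S P < length \<lfloor>S\<rfloor>\<^sub>c"
proof (induction S P rule: branch_var.induct)
  case (1 S)
  then have "S = disc (dim_tree S)" using linear_eq_disc by simp
  then have "length \<lfloor>S\<rfloor>\<^sub>c = Suc (2 * dim_tree S)" using length_ctx_of_disc by metis
  then show ?case by (simp add: disc_top_def)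
next
  case (2 Ss k P)
  then show ?case using branch_var_Cons(2)[of k Ss P] by simp
qed

text \<open>At the end of the branch the suspended subtree is the disc itself. The square is
  therefore the identity square on the standard disc substitution, wedged with the neighbouring
  subtrees.\<close>

lemma insertion_gluing_base:
  assumes k: "k < length Ss" and lin: "linear (Ss ! k)"
  defines "S \<equiv> Node Ss" and "n \<equiv> leaf_height (Node Ss) [k]"
  shows "n = Suc (dim_tree (Ss ! k))"
    and "gluing \<lfloor>disc n\<rfloor>\<^sub>c \<lfloor>S\<rfloor>\<^sub>c \<lfloor>T\<rfloor>\<^sub>c \<lfloor>insertion S [k] T\<rfloor>\<^sub>c
     (disc_sub (\<lfloor>S\<rfloor>\<^sub>c ! branch_var S [k]) (Var (branch_var S [k])))
     (disc_sub (std_ty n T) (std_coh n T)) (exterior S [k] T) (interior S [k] T)"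
proof -
  define m where "m = dim_tree (Ss ! k)"
  define L where "L = \<lfloor>Node (take k Ss)\<rfloor>\<^sub>c"
  define N where "N = \<lfloor>Node (drop (Suc k) Ss)\<rfloor>\<^sub>c"
  have Sk: "Ss ! k = disc m" using linear_eq_disc[OF lin] by (simp add: m_def)
  have bv: "branch_var (Ss ! k) [] = 2 * m" by (simp add: m_def disc_top_def)
  have less: "branch_var (Ss ! k) [] < length \<lfloor>Ss ! k\<rfloor>\<^sub>c" unfolding bv unfolding Sk by (simp add: length_ctx_of_disc)
  note cons = branch_var_Cons[OF k less, folded L_def N_def]
  have X: "susp_ctx \<lfloor>Ss ! k\<rfloor>\<^sub>c = \<lfloor>disc (Suc m)\<rfloor>\<^sub>c" unfolding Sk ctx_of_disc_Suc ..
  have ty: "susp_ty (\<lfloor>Ss ! k\<rfloor>\<^sub>c ! branch_var (Ss ! k) []) = sphere (Suc m)"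
    unfolding bv unfolding Sk using ctx_of_disc_nth[of "2 * m" m] by (simp add: susp_sphere del: sphere.simps)
  show n: "n = Suc (dim_tree (Ss ! k))"
    by (simp only: n_def leaf_height_def cons(3) ty dim_subst dim_sphere m_def)
  let ?j = "disc_sub (std_ty n T) (std_coh n T)"
  have nm: "n = Suc m" using n m_def by simp
  have bip: "bipointed \<lfloor>disc n\<rfloor>\<^sub>c \<lfloor>T\<rfloor>\<^sub>c ?j" unfolding nm by (rule std_disc_sub_bipointed)
  have glob: "globular L" "globular N" by (simp_all add: L_def N_def globular_ctx_of)
  have gl: "gluing \<lfloor>disc n\<rfloor>\<^sub>c \<lfloor>disc n\<rfloor>\<^sub>c \<lfloor>T\<rfloor>\<^sub>c \<lfloor>T\<rfloor>\<^sub>c (id_sub \<lfloor>disc n\<rfloor>\<^sub>c) ?j ?j (id_sub \<lfloor>T\<rfloor>\<^sub>c)"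
    using bip by (intro gluing_id ctx_of_scoped) (simp_all add: bipointed_def)
  have S: "\<lfloor>S\<rfloor>\<^sub>c = wedge L (wedge \<lfloor>disc n\<rfloor>\<^sub>c N)" unfolding S_def nm cons(1) X ..
  have Q: "\<lfloor>insertion S [k] T\<rfloor>\<^sub>c = wedge L (wedge \<lfloor>T\<rfloor>\<^sub>c N)"
    by (cases T) (simp add: S_def L_def N_def ctx_of_split)
  \<comment> \<open>A classifying substitution is natural in its type and term, and the top variable
    of the disc is classified by the identity; its transport is thus the wedge inclusion.\<close>
  have i: "disc_sub (\<lfloor>S\<rfloor>\<^sub>c ! branch_var S [k]) (Var (branch_var S [k]))
      = comp_sub (id_sub \<lfloor>disc n\<rfloor>\<^sub>c) (wedge_inr L (wedge \<lfloor>disc n\<rfloor>\<^sub>c N))" (is "?i = comp_sub _ ?r")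
  proof -
    have "2 * n < length (wedge \<lfloor>disc n\<rfloor>\<^sub>c N)" by (simp add: wedge_def length_ctx_of_disc)
    moreover have "branch_var S [k] = wedge_right L (2 * n)"
      using bv by (simp add: S_def L_def nm)
    ultimately have "Var (branch_var S [k]) = subst_tm (Var (2 * n)) ?r" by simp
    moreover have "\<lfloor>S\<rfloor>\<^sub>c ! branch_var S [k] = subst_ty (sphere n) ?r"
      unfolding S_def cons(3) ty unfolding X nm ..
    ultimately show ?thesis by (simp only: disc_sub_subst disc_sub_id)
  qed
  have "exterior S [k] T = wedges_sub [(L, id_sub L), (\<lfloor>T\<rfloor>\<^sub>c, ?j), (N, id_sub N)]"
    by (simp only: S_def exterior.simps Let_def L_def N_def n_def)
  moreover have "interior S [k] T = comp_sub (id_sub \<lfloor>T\<rfloor>\<^sub>c) (wedge_mid L \<lfloor>T\<rfloor>\<^sub>c N)"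
    by (subst comp_id_left) (simp_all add: S_def L_def N_def wedge_mid_def wedge_inl_id)
  ultimately show "gluing \<lfloor>disc n\<rfloor>\<^sub>c \<lfloor>S\<rfloor>\<^sub>c \<lfloor>T\<rfloor>\<^sub>c \<lfloor>insertion S [k] T\<rfloor>\<^sub>c ?i ?j (exterior S [k] T) (interior S [k] T)"
    using gluing_wedge_mid[OF gl bip glob globular_ctx_of globular_ctx_of globular_ctx_of globular_ctx_of]
    unfolding i by (simp only: S Q)
qed

text \<open>Every map of the square commutes with suspension: the classifying one by
  \<open>disc_sub_susp\<close>, the standard one by \<open>susp_std\<close>, and exterior and
  interior by their recursion. The tail P is nonempty so that the recursive equations apply.\<close>

lemma insertion_gluing_step:
  assumes k: "k < length Ss" and less: "branch_var (Ss ! k) P < length \<lfloor>Ss ! k\<rfloor>\<^sub>c" and P: "P = k' # P'"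
  defines "S \<equiv> Node Ss" and "n \<equiv> leaf_height (Ss ! k) P"
  assumes IH: "gluing \<lfloor>disc n\<rfloor>\<^sub>c \<lfloor>Ss ! k\<rfloor>\<^sub>c \<lfloor>T\<rfloor>\<^sub>c \<lfloor>insertion (Ss ! k) P T\<rfloor>\<^sub>c
     (disc_sub (\<lfloor>Ss ! k\<rfloor>\<^sub>c ! branch_var (Ss ! k) P) (Var (branch_var (Ss ! k) P)))
     (disc_sub (std_ty n T) (std_coh n T)) (exterior (Ss ! k) P T) (interior (Ss ! k) P T)"
  shows "leaf_height S (k # P) = Suc n"
    and "gluing \<lfloor>disc (Suc n)\<rfloor>\<^sub>c \<lfloor>S\<rfloor>\<^sub>c \<lfloor>Node [T]\<rfloor>\<^sub>c \<lfloor>insertion S (k # P) (Node [T])\<rfloor>\<^sub>c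
     (disc_sub (\<lfloor>S\<rfloor>\<^sub>c ! branch_var S (k # P)) (Var (branch_var S (k # P))))
     (disc_sub (std_ty (Suc n) (Node [T])) (std_coh (Suc n) (Node [T])))
     (exterior S (k # P) (Node [T])) (interior S (k # P) (Node [T]))"
proof -
  define L where "L = \<lfloor>Node (take k Ss)\<rfloor>\<^sub>c"
  define N where "N = \<lfloor>Node (drop (Suc k) Ss)\<rfloor>\<^sub>c"
  let ?X = "susp_ctx \<lfloor>Ss ! k\<rfloor>\<^sub>c" and ?Y = "susp_ctx \<lfloor>insertion (Ss ! k) P T\<rfloor>\<^sub>c"
  let ?p = "branch_var (Ss ! k) P" and ?A = "\<lfloor>Ss ! k\<rfloor>\<^sub>c ! branch_var (Ss ! k) P"
  note cons = branch_var_Cons[OF k less, folded L_def N_def S_def]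
  interpret IH: gluing "\<lfloor>disc n\<rfloor>\<^sub>c" "\<lfloor>Ss ! k\<rfloor>\<^sub>c" "\<lfloor>T\<rfloor>\<^sub>c" "\<lfloor>insertion (Ss ! k) P T\<rfloor>\<^sub>c"
     "disc_sub ?A (Var ?p)" "disc_sub (std_ty n T) (std_coh n T)" "exterior (Ss ! k) P T" "interior (Ss ! k) P T"
    by (fact IH)
  show "leaf_height S (k # P) = Suc n"
    by (simp only: leaf_height_def n_def cons(3) dim_subst dim_susp)
  have glob: "globular L" "globular N" by (simp_all add: L_def N_def globular_ctx_of)
  have gl: "gluing \<lfloor>disc (Suc n)\<rfloor>\<^sub>c ?X \<lfloor>Node [T]\<rfloor>\<^sub>c ?Y (susp_sub (disc_sub ?A (Var ?p)))
     (disc_sub (std_ty (Suc n) (Node [T])) (std_coh (Suc n) (Node [T])))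
     (susp_sub (exterior (Ss ! k) P T)) (susp_sub (interior (Ss ! k) P T))"
    using gluing_susp[OF IH ctx_of_scoped ctx_of_scoped ctx_of_scoped]
    unfolding ctx_of_disc_Suc ctx_of_single by (simp only: susp_std flip: disc_sub_susp)
  have bip: "bipointed ?X ?Y (susp_sub (exterior (Ss ! k) P T))"
    using IH.\<kappa>_length IH.\<kappa>_scoped by (rule bipointed_susp)
  have Q: "\<lfloor>insertion S (k # P) (Node [T])\<rfloor>\<^sub>c = wedge L (wedge ?Y N)"
    unfolding S_def P insertion.simps ctx_of_split ctx_of_single L_def N_def ..
  have i: "disc_sub (\<lfloor>S\<rfloor>\<^sub>c ! branch_var S (k # P)) (Var (branch_var S (k # P)))
      = comp_sub (susp_sub (disc_sub ?A (Var ?p))) (wedge_inr L (wedge ?X N))" (is "_ = comp_sub _ ?r")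
  proof -
    have "Suc (Suc ?p) < length (wedge ?X N)" using less by (simp add: wedge_def)
    then have "Var (branch_var S (k # P)) = subst_tm (susp_tm (Var ?p)) ?r"
      by (simp add: S_def L_def)
    then show ?thesis by (simp only: cons(3) disc_sub_subst disc_sub_susp)
  qed
  have "exterior S (k # P) (Node [T])
      = wedges_sub [(L, id_sub L), (?Y, susp_sub (exterior (Ss ! k) P T)), (N, id_sub N)]"
    by (simp only: S_def P exterior.simps Let_def L_def N_def)
  moreover have "interior S (k # P) (Node [T]) = comp_sub (susp_sub (interior (Ss ! k) P T)) (wedge_mid L ?Y N)"
    by (simp only: S_def P interior.simps L_def N_def)
  ultimately show "gluing \<lfloor>disc (Suc n)\<rfloor>\<^sub>c \<lfloor>S\<rfloor>\<^sub>c \<lfloor>Node [T]\<rfloor>\<^sub>c \<lfloor>insertion S (k # P) (Node [T])\<rfloor>\<^sub>c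
     (disc_sub (\<lfloor>S\<rfloor>\<^sub>c ! branch_var S (k # P)) (Var (branch_var S (k # P))))
     (disc_sub (std_ty (Suc n) (Node [T])) (std_coh (Suc n) (Node [T])))
     (exterior S (k # P) (Node [T])) (interior S (k # P) (Node [T]))"
    using gluing_wedge_mid[OF gl bip glob globular_ctx_of globular_susp[OF globular_ctx_of]
        globular_ctx_of globular_susp[OF globular_ctx_of]]
    unfolding i by (simp only: cons(1) Q)
qed

text \<open>S and T vary together in the induction, as each index passes to a subtree of both. The
  leaf height is at least 1 because a branch has at least one index, each adding a
  suspension.\<close>

lemma insertion_gluing:
  fixes S T P
  defines "n \<equiv> leaf_height S P"
  assumes "is_branch S P" "branch_height P \<le> trunk_height T"
  shows "0 < n \<and> gluing \<lfloor>disc n\<rfloor>\<^sub>c \<lfloor>S\<rfloor>\<^sub>c \<lfloor>T\<rfloor>\<^sub>c \<lfloor>insertion S P T\<rfloor>\<^sub>c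
     (disc_sub (\<lfloor>S\<rfloor>\<^sub>c ! branch_var S P) (Var (branch_var S P)))
     (disc_sub (std_ty n T) (std_coh n T)) (exterior S P T) (interior S P T)"
  using assms(2,3) unfolding n_def
proof (induction P arbitrary: S T)
  case Nil
  then show ?case by (simp add: is_branch_def)
next
  case (Cons k P)
  obtain Ss where S: "S = Node Ss" by (cases S)
  have k: "k < length Ss" and path: "is_path (Ss ! k) P" and lin: "linear (subtree (Ss ! k) P)"
    using Cons.prems(1) by (simp_all add: S is_branch_def)
  show ?case
  proof (cases P)
    case Nil
    then show ?thesis
      using insertion_gluing_base[OF k] lin unfolding S by (simp del: exterior.simps interior.simps insertion.simps)
  next
    case P: (Cons k' P')
    then have "Suc (length P') \<le> trunk_height T" using Cons.prems(2) by (simp add: branch_height_def)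
    \<comment> \<open>A positive trunk height forces a single subtree, matching the suspension on
      the side of S.\<close>
    then obtain T' where T: "T = Node [T']" "length P' \<le> trunk_height T'"
      by (cases T rule: trunk_height.cases) auto
    have "is_branch (Ss ! k) P" "branch_height P \<le> trunk_height T'"
      using path lin P T by (simp_all add: is_branch_def branch_height_def)
    note IH = Cons.IH[OF this]
    note step = insertion_gluing_step[OF k branch_var_less[OF path lin] P conjunct2[OF IH]]
    show ?thesis unfolding S T step(1) using step(2) by blast
  qed
qed

theorem theorem28:
  fixes R :: eq_gens and S T :: tree and P :: "nat list" and n :: nat and A :: ty
  assumes "eq_generators R" and "tame R"
    and "insertion_point S P T"
    and "n = leaf_height S P"
    and "A = \<lfloor>S\<rfloor>\<^sub>c ! branch_var S P"
  shows "pushout_square (Catt R) \<lfloor>disc n\<rfloor>\<^sub>c \<lfloor>S\<rfloor>\<^sub>c \<lfloor>T\<rfloor>\<^sub>c \<lfloor>insertion S P T\<rfloor>\<^sub>c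
     (sub_class R \<lfloor>disc n\<rfloor>\<^sub>c \<lfloor>S\<rfloor>\<^sub>c (disc_sub A (Var (branch_var S P))))
     (sub_class R \<lfloor>disc n\<rfloor>\<^sub>c \<lfloor>T\<rfloor>\<^sub>c (disc_sub (std_ty n T) (std_coh n T)))
     (sub_class R \<lfloor>S\<rfloor>\<^sub>c \<lfloor>insertion S P T\<rfloor>\<^sub>c (exterior S P T))
     (sub_class R \<lfloor>T\<rfloor>\<^sub>c \<lfloor>insertion S P T\<rfloor>\<^sub>c (interior S P T))"
proof -
  have ip: "is_branch S P" "branch_height P \<le> trunk_height T" "dim_tree T \<le> n"
    using assms(3,4) by (simp_all add: insertion_point_def)
  note gl = insertion_gluing[OF ip(1,2), folded assms(4,5)]
  show ?thesis
    \<comment> \<open>What remains is typing: pasting contexts are globular, hence valid, and the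
      leaf height bound makes the standard disc substitution well typed.\<close>
    using gluing.pushout[OF conjunct2[OF gl] assms(1,2)] ctx_of_ok[OF assms(1)]
      std_disc_sub_ok[OF assms(1,2) ip(3) conjunct1[OF gl]] by blast
qed

end
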